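(* Let $\pi<\beta\le2\pi$ and let $r:[0,\beta]\to(0,\infty)$ be a Lipschitz function such that $r'(\theta)\le0$ for $0\le\theta\le\beta/2$ and $r'(\theta)\ge0$ for $\beta/2\le\theta\le\beta$. Let $D_\beta=\{(\rho\cos\theta,\rho\sin\theta): 0<\theta<\beta,\ 0<\rho<r(\theta)\}$, whose boundary is $\Gamma_0\cup\Gamma$ with $\Gamma_0=\{(t,0):0\le t\le r(0)\}\cup\{t(\cos\beta,\sin\beta):0\le t\le r(\beta)\}$ and $\Gamma=\{(r(\theta)\cos\theta,r(\theta)\sin\theta):0\le\theta\le\beta\}$, and let $d(x)=\mathrm{dist}(x,\Gamma_0)$. Then for all $u\in C^\infty(\overline{D_\beta})$ that vanish in a neighbourhood of $\Gamma_0$, $$\int_{D_\beta}|\nabla u|^2\,dx\,dy\ge c_\beta\int_{D_\beta}\frac{u^2}{d^2}\,dx\,dy,$$ and the constant $c_\beta$ is the best possible for this inequality.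
   Context: For $\beta\in[\pi,2\pi]$, $\Lambda_\beta=\{(r\cos\theta,r\sin\theta): r>0,\ 0<\theta<\beta\}$ and $c_\beta$ denotes the Hardy constant of $\Lambda_\beta$, i.e. the largest $c\ge0$ with $\int_{\Lambda_\beta}|\nabla u|^2\ge c\int_{\Lambda_\beta}u^2/\mathrm{dist}(x,\partial\Lambda_\beta)^2$ for all $u\in C_c^\infty(\Lambda_\beta)$. It is known that $c_\beta\in(0,1/4]$; $c_\beta=1/4$ for $\pi\le\beta\le\beta_{cr}$, where $\beta_{cr}\in(\pi,2\pi)$ is the unique solution in $(\pi,2\pi)$ of $\tan\big(\frac{\beta_{cr}-\pi}{4}\big)=4\big(\Gamma(3/4)/\Gamma(1/4)\big)^2$; and for $\beta_{cr}\le\beta<2\pi$, $c_\beta$ is the unique solution of $\sqrt{c}\tan\big(\sqrt{c}\,\frac{\beta-\pi}{2}\big)=2\Big(\frac{\Gamma(\frac{3+\sqrt{1-4c}}{4})}{\Gamma(\frac{1+\sqrt{1-4c}}{4})}\Big)^2$. *)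

theory Defs
  imports "HOL-Analysis.Analysis"
begin

definition smooth_R2 :: "(real \<times> real \<Rightarrow> real) \<Rightarrow> bool" where
  "smooth_R2 f \<longleftrightarrow> (\<exists>F. f \<in> F \<and> (\<forall>g\<in>F. \<exists>g1 g2. g1 \<in> F \<and> g2 \<in> F \<and>
      (\<forall>x. (g has_derivative (\<lambda>h. fst h * g1 x + snd h * g2 x)) (at x))))"

definition grad_sq :: "(real \<times> real \<Rightarrow> real) \<Rightarrow> real \<times> real \<Rightarrow> real" where
  "grad_sq u p = (frechet_derivative u (at p) (1, 0))\<^sup>2 + (frechet_derivative u (at p) (0, 1))\<^sup>2"

definition wedge :: "real \<Rightarrow> (real \<times> real) set" where
  "wedge \<beta> = {(\<rho> * cos \<theta>, \<rho> * sin \<theta>) | \<rho> \<theta>. \<rho> > 0 \<and> 0 < \<theta> \<and> \<theta> < \<beta>}"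

definition Cc_infty :: "(real \<times> real) set \<Rightarrow> (real \<times> real \<Rightarrow> real) set" where
  "Cc_infty \<Omega> = {u. smooth_R2 u \<and> (\<exists>K. compact K \<and> K \<subseteq> \<Omega> \<and> (\<forall>x. x \<notin> K \<longrightarrow> u x = 0))}"

definition hardy_const :: "real \<Rightarrow> real" where
  "hardy_const \<beta> = Sup {c. c \<ge> 0 \<and> (\<forall>u \<in> Cc_infty (wedge \<beta>).
      (\<integral>\<^sup>+ x \<in> wedge \<beta>. ennreal (grad_sq u x) \<partial>lborel) \<ge>
      ennreal c * (\<integral>\<^sup>+ x \<in> wedge \<beta>. ennreal ((u x)\<^sup>2 / (infdist x (frontier (wedge \<beta>)))\<^sup>2) \<partial>lborel))}"

definition Dom :: "real \<Rightarrow> (real \<Rightarrow> real) \<Rightarrow> (real \<times> real) set" where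
  "Dom \<beta> r = {(\<rho> * cos \<theta>, \<rho> * sin \<theta>) | \<rho> \<theta>. 0 < \<theta> \<and> \<theta> < \<beta> \<and> 0 < \<rho> \<and> \<rho> < r \<theta>}"

definition Gamma0 :: "real \<Rightarrow> (real \<Rightarrow> real) \<Rightarrow> (real \<times> real) set" where
  "Gamma0 \<beta> r = {(t, 0) | t. 0 \<le> t \<and> t \<le> r 0} \<union> {(t * cos \<beta>, t * sin \<beta>) | t. 0 \<le> t \<and> t \<le> r \<beta>}"

text \<open>C-infinity(closure D) functions vanishing in a neighbourhood of Gamma0: restrictions to
  closure D of smooth functions on the plane that vanish on U \<inter> closure D for an open U
  containing Gamma0.\<close>
definition admissible :: "real \<Rightarrow> (real \<Rightarrow> real) \<Rightarrow> (real \<times> real \<Rightarrow> real) set" where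
  "admissible \<beta> r = {u. smooth_R2 u \<and>
      (\<exists>U. open U \<and> Gamma0 \<beta> r \<subseteq> U \<and> (\<forall>x \<in> U \<inter> closure (Dom \<beta> r). u x = 0))}"

end

theory Submission
  imports Defs
begin

text \<open>No explicit value of the Hardy constant is needed. Testing the inequality of the wedge, with
  any admissible constant \<open>c\<close>, on products \<open>f (ln \<rho>) w(\<theta>)\<close> with slowly varying \<open>f\<close> gives the
  one-dimensional inequality \<open>c \<integral> V w\<^sup>2 \<le> \<integral> w'\<^sup>2\<close> on \<open>(0, \<beta>)\<close>, where \<open>V(\<theta>)\<close> is the inverse square of
  the distance of \<open>(cos \<theta>, sin \<theta>)\<close> to the boundary of the wedge. Since \<open>V\<close> is symmetric about \<open>\<beta>/2\<close>,
  extending a function on \<open>(0, a)\<close>, \<open>a \<le> \<beta>/2\<close>, by a constant up to \<open>\<beta>/2\<close> and reflecting it shows that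
  the same inequality holds on \<open>(0, a)\<close> for functions that vanish near \<open>0\<close> only. As \<open>r\<close> decreases on
  \<open>[0, \<beta>/2]\<close> and increases on \<open>[\<beta>/2, \<beta>]\<close>, every circle about the origin meets the domain in
  at most two arcs of this kind, one at each side; integrating over the radius gives the inequality on
  the domain. Sharpness follows by shrinking test functions of the wedge into the domain, because
  both integrals are invariant under scaling.\<close>

section \<open>Smooth functions of one variable\<close>

text \<open>Admissible functions are free on the curved part of the boundary, so the angular
  inequality is wanted without a condition at one end of the arc. Extension by a constant followed
  by reflection would create kinks, hence the fold is performed by a smooth inner function whose
  slope on the half interval lies between 0 and 1; this bound on the slope is what keeps the energy
  from growing. The hypotheses on \<open>r\<close> control derivatives only where they exist, so the
  monotonicity behind the arcs is a theorem in its own right. For a Lipschitz function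
  \<open>f\<close> and large \<open>K\<close> the function \<open>K * x - f x\<close> is increasing,
  and Vitali coverings compare its Stieltjes measure with Lebesgue measure; this yields exactly the
  part of almost everywhere differentiability that is required. All integrals take values in the
  extended nonnegative reals, so a divergent potential term needs no case of its own, except where a
  factor is cancelled and where the supremum over the constants is taken.\<close>

primrec ck :: "nat \<Rightarrow> (real \<Rightarrow> real) \<Rightarrow> bool" where
  "ck 0 f \<longleftrightarrow> True"
| "ck (Suc n) f \<longleftrightarrow> (\<exists>f'. (\<forall>x. (f has_real_derivative f' x) (at x)) \<and> ck n f')"

lemma ck_SucI: "(\<And>x. (f has_real_derivative f' x) (at x)) \<Longrightarrow> ck n f' \<Longrightarrow> ck (Suc n) f"
  by auto

lemma ck_Suc_D: "ck (Suc n) f \<Longrightarrow> ck n f"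
proof (induction n arbitrary: f)
  case (Suc n)
  from Suc.prems obtain f' where f': "\<And>x. (f has_real_derivative f' x) (at x)" "ck (Suc n) f'"
    by auto
  show ?case using f'(1) Suc.IH[OF f'(2)] by auto
qed simp

lemma ck_const: "ck n (\<lambda>x. c)"
proof (induction n arbitrary: c)
  case (Suc n)
  have "\<forall>x. ((\<lambda>x. c) has_real_derivative (\<lambda>x. 0) x) (at x)" by simp
  with Suc[of 0] show ?case by (auto intro!: exI[of _ "\<lambda>x. 0"])
qed simp

lemma ck_ident: "ck n (\<lambda>x. x)"
  by (cases n) (auto intro!: exI[of _ "\<lambda>x. 1"] ck_const)

lemma ck_add: "ck n f \<Longrightarrow> ck n g \<Longrightarrow> ck n (\<lambda>x. f x + g x)"
proof (induction n arbitrary: f g)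
  case (Suc n)
  from Suc.prems obtain f' g' where "\<And>x. (f has_real_derivative f' x) (at x)" "ck n f'"
    "\<And>x. (g has_real_derivative g' x) (at x)" "ck n g'" by auto
  with Suc.IH[of f' g'] show ?case
    by (auto intro!: exI[of _ "\<lambda>x. f' x + g' x"] derivative_intros)
qed simp

lemma ck_mult: "ck n f \<Longrightarrow> ck n g \<Longrightarrow> ck n (\<lambda>x. f x * g x)"
proof (induction n arbitrary: f g)
  case (Suc n)
  from Suc.prems obtain f' g' where d: "\<And>x. (f has_real_derivative f' x) (at x)" "ck n f'"
    "\<And>x. (g has_real_derivative g' x) (at x)" "ck n g'" by auto
  have "((\<lambda>x. f x * g x) has_real_derivative (f' x * g x + f x * g' x)) (at x)" for x
    using DERIV_mult[OF d(1,3), of x] by (simp add: algebra_simps)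
  moreover have "ck n (\<lambda>x. f' x * g x + f x * g' x)"
    using Suc.prems d by (intro ck_add Suc.IH) (auto dest: ck_Suc_D simp del: ck.simps)
  ultimately show ?case by (rule ck_SucI)
qed simp

lemma ck_minus: "ck n f \<Longrightarrow> ck n g \<Longrightarrow> ck n (\<lambda>x. f x - g x)"
  using ck_add[OF _ ck_mult[OF ck_const[of n "-1"]], of f g] by simp

lemma ck_inverse: "ck n f \<Longrightarrow> (\<And>x. f x \<noteq> 0) \<Longrightarrow> ck n (\<lambda>x. inverse (f x))"
proof (induction n)
  case (Suc n)
  from Suc.prems obtain f' where d: "\<And>x. (f has_real_derivative f' x) (at x)" "ck n f'"
    by auto
  have "((\<lambda>x. inverse (f x)) has_real_derivative - 1 * (f' x * (inverse (f x) * inverse (f x)))) (at x)" for x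
    using DERIV_inverse_fun[OF d(1) Suc.prems(2), of x] by (simp add: field_simps power2_eq_square)
  moreover have "ck n (\<lambda>x. - 1 * (f' x * (inverse (f x) * inverse (f x))))"
    using Suc.prems d by (intro ck_mult ck_const Suc.IH) (auto dest: ck_Suc_D simp del: ck.simps)
  ultimately show ?case by (rule ck_SucI)
qed simp

lemma ck_compose: "ck n f \<Longrightarrow> ck n g \<Longrightarrow> ck n (\<lambda>x. f (g x))"
proof (induction n arbitrary: f)
  case (Suc n)
  from Suc.prems obtain f' g' where d: "\<And>x. (f has_real_derivative f' x) (at x)" "ck n f'"
    "\<And>x. (g has_real_derivative g' x) (at x)" "ck n g'" by auto
  have "((\<lambda>x. f (g x)) has_real_derivative (f' (g x) * g' x)) (at x)" for x
    using DERIV_chain2[OF d(1) d(3)] by simp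
  moreover have "ck n (\<lambda>x. f' (g x) * g' x)"
    by (rule ck_mult[OF Suc.IH[OF d(2) ck_Suc_D[OF Suc.prems(2)]] d(4)])
  ultimately show ?case by (rule ck_SucI)
qed simp

text \<open>\<open>ck n\<close> asserts only that \<open>n\<close> successive derivatives exist,
  with witnesses that may differ for each \<open>n\<close>; this makes every closure rule a plain
  induction on \<open>n\<close>. Continuity of the top derivative is not demanded, which costs
  nothing once all \<open>n\<close> are taken.\<close>

definition smooth1 :: "(real \<Rightarrow> real) \<Rightarrow> bool" where
  "smooth1 f \<longleftrightarrow> (\<forall>n. ck n f)"

text \<open>The derivative supplied by \<open>ck (Suc n)\<close> could depend on \<open>n\<close>;
  uniqueness of derivatives shows that one function serves every order.\<close>

lemma smooth1_derivE:
  assumes "smooth1 f"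
  obtains f' where "\<And>x. (f has_real_derivative f' x) (at x)" "smooth1 f'"
proof -
  have 1: "ck (Suc n) f" for n using assms by (simp add: smooth1_def del: ck.simps)
  from 1[of 0] obtain f' where f': "\<And>x. (f has_real_derivative f' x) (at x)" by auto
  have "ck n f'" for n
  proof -
    from 1[of n] obtain g where g: "\<And>x. (f has_real_derivative g x) (at x)" "ck n g" by auto
    have "g = f'" using DERIV_unique[OF g(1) f'] by auto
    with g show ?thesis by simp
  qed
  with f' show ?thesis using that by (auto simp: smooth1_def)
qed

lemma smooth1_antideriv:
  assumes "\<And>x. (f has_real_derivative f' x) (at x)" "smooth1 f'"
  shows "smooth1 f"
  unfolding smooth1_def
proof
  fix n
  have "ck (Suc n) f" using assms by (auto simp: smooth1_def)
  thus "ck n f" by (rule ck_Suc_D)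
qed

lemma smooth1_intros:
  "smooth1 (\<lambda>x. c)" "smooth1 (\<lambda>x. x)"
  "smooth1 f \<Longrightarrow> smooth1 g \<Longrightarrow> smooth1 (\<lambda>x. f x + g x)"
  "smooth1 f \<Longrightarrow> smooth1 g \<Longrightarrow> smooth1 (\<lambda>x. f x - g x)"
  "smooth1 f \<Longrightarrow> smooth1 g \<Longrightarrow> smooth1 (\<lambda>x. f x * g x)"
  "smooth1 f \<Longrightarrow> (\<And>x. f x \<noteq> 0) \<Longrightarrow> smooth1 (\<lambda>x. inverse (f x))"
  by (auto simp: smooth1_def intro: ck_const ck_ident ck_add ck_minus ck_mult ck_inverse)

lemma smooth1_compose: "smooth1 f \<Longrightarrow> smooth1 g \<Longrightarrow> smooth1 (\<lambda>x. f (g x))"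
  by (auto simp: smooth1_def intro: ck_compose)

lemma smooth1_isCont: "smooth1 f \<Longrightarrow> isCont f x"
  using smooth1_derivE DERIV_isCont by metis

lemma smooth1_continuous_on: "smooth1 f \<Longrightarrow> continuous_on A f"
  by (simp add: continuous_at_imp_continuous_on smooth1_isCont)

lemma smooth1_measurable: "smooth1 f \<Longrightarrow> f \<in> borel_measurable borel"
  by (rule borel_measurable_continuous_onI) (rule smooth1_continuous_on)

lemma ck_sin_cos: "ck n sin \<and> ck n cos"
proof (induction n)
  case (Suc n)
  have "ck (Suc n) cos"
  proof (rule ck_SucI)
    show "(cos has_real_derivative - 1 * sin x) (at x)" for x :: real
      by (auto intro!: derivative_eq_intros)
    show "ck n (\<lambda>x. - 1 * sin x)" using Suc by (intro ck_mult ck_const) auto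
  qed
  moreover have "ck (Suc n) sin"
    by (rule ck_SucI[of _ cos]) (use Suc in \<open>auto intro!: derivative_eq_intros\<close>)
  ultimately show ?case by blast
qed simp

lemma smooth1_sin_cos: "smooth1 sin" "smooth1 cos"
  using ck_sin_cos by (auto simp: smooth1_def)

section \<open>Flat functions and smooth cutoffs\<close>

definition flat_exp :: "nat \<Rightarrow> real \<Rightarrow> real" where
  "flat_exp k x = (if x > 0 then (1 / x) ^ k * exp (- (1 / x)) else 0)"

lemma flat_exp_tendsto: "(flat_exp k \<longlongrightarrow> 0) (at 0)"
proof -
  \<comment> \<open>With t = 1 / x the behaviour to the right of 0 becomes the decay of
    \<open>t ^ k / exp t\<close> at infinity.\<close>
  have 1: "((\<lambda>t::real. t ^ k / exp t) \<longlongrightarrow> 0) at_top" by (rule tendsto_power_div_exp_0)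
  have 2: "filterlim (\<lambda>x::real. 1 / x) at_top (at_right 0)"
    using filterlim_inverse_at_top_right by (simp add: inverse_eq_divide)
  have "((\<lambda>x. (1/x) ^ k / exp (1/x)) \<longlongrightarrow> 0) (at_right (0::real))"
    using filterlim_compose[OF 1 2] by simp
  hence r: "(flat_exp k \<longlongrightarrow> 0) (at_right 0)"
    by (rule Lim_transform_eventually)
       (auto simp: eventually_at_right_field flat_exp_def exp_minus divide_inverse intro!: exI[of _ 1])
  have "((\<lambda>x. 0) \<longlongrightarrow> 0) (at_left (0::real))" by simp
  hence l: "(flat_exp k \<longlongrightarrow> 0) (at_left 0)"
    by (rule Lim_transform_eventually)
       (auto simp: eventually_at_left_field flat_exp_def intro!: exI[of _ "-1"])
  show ?thesis using l r by (rule filterlim_split_at)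
qed

lemma flat_exp_deriv:
  "(flat_exp k has_real_derivative (- real k) * flat_exp (k+1) x + flat_exp (k+2) x) (at x)"
proof -
  consider "x > 0" | "x < 0" | "x = 0" by linarith
  thus ?thesis
  proof cases
    case 1
    define t where "t = 1 / x"
    have i: "((\<lambda>x. 1 / x) has_real_derivative - (t ^ 2)) (at x)"
      using 1 by (auto intro!: derivative_eq_intros simp: t_def power2_eq_square)
    \<comment> \<open>For \<open>k = 0\<close> the subtraction \<open>k - 1\<close> is truncated,
      but the factor \<open>real k\<close> makes both sides vanish.\<close>
    have p: "real k * t ^ (k - 1) * t ^ 2 = real k * t ^ (k + 1)"
      by (cases k) (simp_all add: power2_eq_square)
    have "((\<lambda>x. (1/x) ^ k * exp (- (1/x))) has_real_derivative
        (real k * (- (t ^ 2) * t ^ (k - 1))) * exp (- t) + (exp (- t) * t ^ 2) * t ^ k) (at x)"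
      using DERIV_mult[OF DERIV_power[OF i, of k] DERIV_fun_exp[OF DERIV_minus[OF i]]]
      by (simp add: t_def)
    also have "(real k * (- (t ^ 2) * t ^ (k - 1))) * exp (- t) + (exp (- t) * t ^ 2) * t ^ k
        = (- (real k * t ^ (k - 1) * t ^ 2) + t ^ (k + 2)) * exp (- t)"
      by (simp add: algebra_simps power_add power2_eq_square)
    also have "\<dots> = (- real k) * flat_exp (k+1) x + flat_exp (k+2) x"
      using 1 unfolding p by (simp add: flat_exp_def t_def algebra_simps)
    finally have "((\<lambda>x. (1/x) ^ k * exp (- (1/x))) has_real_derivative
        (- real k) * flat_exp (k+1) x + flat_exp (k+2) x) (at x)" .
    thus ?thesis
      by (rule has_field_derivative_transform_within_open[of _ _ _ "{0<..}"])
         (use 1 in \<open>auto simp: flat_exp_def\<close>)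
  next
    case 2
    have "((\<lambda>x. 0) has_real_derivative
        (- real k) * flat_exp (k+1) x + flat_exp (k+2) x) (at x)"
      using 2 by (simp add: flat_exp_def)
    thus ?thesis
      by (rule has_field_derivative_transform_within_open[of _ _ _ "{..<0}"])
         (use 2 in \<open>auto simp: flat_exp_def\<close>)
  next
    case 3
    \<comment> \<open>The difference quotient at 0 is the next member of the family, so its limit 0
      is already known. Division by zero gives 0, in agreement with
      \<open>flat_exp (k+1) 0\<close>.\<close>
    have "(\<lambda>h. (flat_exp k (0 + h) - flat_exp k 0) / h) = flat_exp (k+1)"
      by (auto simp: flat_exp_def fun_eq_iff)
    thus ?thesis using flat_exp_tendsto[of "k+1"] 3 
      by (simp add: DERIV_def flat_exp_def)
  qed
qed

text \<open>Each derivative is a linear combination of two later members of the family, so the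
  induction on the order must treat all \<open>k\<close> at once.\<close>

lemma smooth1_flat_exp: "smooth1 (flat_exp k)"
proof -
  have "\<forall>k. ck n (flat_exp k)" for n
  proof (induction n)
    case (Suc n)
    have "ck n (\<lambda>x. (- real k) * flat_exp (k+1) x + flat_exp (k+2) x)" for k
      using Suc by (intro ck_add ck_mult ck_const) blast+
    then show ?case using ck_SucI[OF flat_exp_deriv] by blast
  qed simp
  thus ?thesis by (simp add: smooth1_def)
qed

text \<open>The standard quotient cutoff: for \<open>a < b\<close> it is 1 up to \<open>a\<close>
  and 0 from \<open>b\<close> on, and the denominator is positive because its two summands never
  vanish together.\<close>

definition smooth_step :: "real \<Rightarrow> real \<Rightarrow> real \<Rightarrow> real" where
  "smooth_step a b x = flat_exp 0 (b - x) * inverse (flat_exp 0 (b - x) + flat_exp 0 (x - a))"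

lemma flat_exp_nonneg: "flat_exp k x \<ge> 0" and flat_exp_pos: "x > 0 \<Longrightarrow> flat_exp k x > 0"
  by (auto simp: flat_exp_def)

lemma smooth_step_denom_pos: "a < b \<Longrightarrow> flat_exp 0 (b - x) + flat_exp 0 (x - a) > 0"
  using flat_exp_nonneg[of 0 "b-x"] flat_exp_nonneg[of 0 "x-a"] flat_exp_pos[of "b-x" 0] flat_exp_pos[of "x-a" 0]
  by (cases "x < b") auto

lemma smooth1_smooth_step: "a < b \<Longrightarrow> smooth1 (smooth_step a b)"
  unfolding smooth_step_def[abs_def]
  by (intro smooth1_intros smooth1_compose[OF smooth1_flat_exp])
     (use smooth_step_denom_pos in \<open>auto simp: less_le\<close>)

lemma smooth_step_le: "a < b \<Longrightarrow> x \<le> a \<Longrightarrow> smooth_step a b x = 1"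
  using smooth_step_denom_pos[of a b x] by (auto simp: smooth_step_def flat_exp_def)

lemma smooth_step_ge: "x \<ge> b \<Longrightarrow> smooth_step a b x = 0"
  by (auto simp: smooth_step_def flat_exp_def)

lemma smooth_step_bounds: "a < b \<Longrightarrow> 0 \<le> smooth_step a b x \<and> smooth_step a b x \<le> 1"
  using smooth_step_denom_pos[of a b x] flat_exp_nonneg[of 0 "b-x"] flat_exp_nonneg[of 0 "x-a"]
  by (auto simp: smooth_step_def field_simps)

section \<open>Smooth functions of two variables and polar coordinates\<close>

text \<open>The set \<open>S\<close> is carried along because angle and logarithmic radius are
  differentiable only off a half line. Derivatives are nevertheless taken at full neighbourhoods, so
  \<open>S\<close> is meant to be open.\<close>

primrec ck2 :: "(real \<times> real) set \<Rightarrow> nat \<Rightarrow> (real \<times> real \<Rightarrow> real) \<Rightarrow> bool" where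
  "ck2 S 0 f \<longleftrightarrow> True"
| "ck2 S (Suc n) f \<longleftrightarrow> (\<exists>f1 f2.
     (\<forall>x\<in>S. (f has_derivative (\<lambda>h. fst h * f1 x + snd h * f2 x)) (at x)) \<and> ck2 S n f1 \<and> ck2 S n f2)"

lemma ck2_SucI:
  "(\<And>x. x \<in> S \<Longrightarrow> (f has_derivative (\<lambda>h. fst h * f1 x + snd h * f2 x)) (at x)) \<Longrightarrow>
    ck2 S n f1 \<Longrightarrow> ck2 S n f2 \<Longrightarrow> ck2 S (Suc n) f"
  unfolding ck2.simps by blast

lemma ck2_SucE:
  assumes "ck2 S (Suc n) f"
  obtains f1 f2 where "\<And>x. x \<in> S \<Longrightarrow> (f has_derivative (\<lambda>h. fst h * f1 x + snd h * f2 x)) (at x)"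
    "ck2 S n f1" "ck2 S n f2"
  using assms by auto

lemma ck2_Suc_D: "ck2 S (Suc n) f \<Longrightarrow> ck2 S n f"
proof (induction n arbitrary: f)
  case (Suc n)
  from Suc.prems obtain f1 f2 where
    d: "\<And>x. x \<in> S \<Longrightarrow> (f has_derivative (\<lambda>h. fst h * f1 x + snd h * f2 x)) (at x)"
    "ck2 S (Suc n) f1" "ck2 S (Suc n) f2" by (rule ck2_SucE) blast
  show ?case by (rule ck2_SucI[OF d(1) Suc.IH[OF d(2)] Suc.IH[OF d(3)]])
qed simp

lemma ck2_cong:
  assumes "open S" "\<And>x. x \<in> S \<Longrightarrow> f x = g x" "ck2 S n f"
  shows "ck2 S n g"
proof (cases n)
  case (Suc m)
  obtain f1 f2 where
    d: "\<And>x. x \<in> S \<Longrightarrow> (f has_derivative (\<lambda>h. fst h * f1 x + snd h * f2 x)) (at x)"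
    "ck2 S m f1" "ck2 S m f2" using assms(3) unfolding Suc by (rule ck2_SucE) blast
  show ?thesis unfolding Suc
    by (rule ck2_SucI[OF _ d(2,3)])
       (rule has_derivative_transform_within_open[OF d(1) assms(1)], use assms(2) in auto)
qed simp

lemma ck2_const: "ck2 S n (\<lambda>x. c)"
proof (induction n arbitrary: c)
  case (Suc n)
  show ?case by (rule ck2_SucI[of _ _ "\<lambda>x. 0" "\<lambda>x. 0"]) (use Suc in auto)
qed simp

lemma ck2_fst: "ck2 S n fst"
proof (cases n)
  case (Suc m)
  show ?thesis unfolding Suc
    by (rule ck2_SucI[OF _ ck2_const[of _ _ 1] ck2_const[of _ _ 0]])
       (auto intro!: derivative_eq_intros)
qed simp

lemma ck2_snd: "ck2 S n snd"
proof (cases n)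
  case (Suc m)
  show ?thesis unfolding Suc
    by (rule ck2_SucI[OF _ ck2_const[of _ _ 0] ck2_const[of _ _ 1]])
       (auto intro!: derivative_eq_intros)
qed simp

lemma ck2_add: "ck2 S n f \<Longrightarrow> ck2 S n g \<Longrightarrow> ck2 S n (\<lambda>x. f x + g x)"
proof (induction n arbitrary: f g)
  case (Suc n)
  obtain f1 f2 where f: "\<And>x. x \<in> S \<Longrightarrow> (f has_derivative (\<lambda>h. fst h * f1 x + snd h * f2 x)) (at x)"
    "ck2 S n f1" "ck2 S n f2" using Suc.prems(1) by (rule ck2_SucE) blast
  obtain g1 g2 where g: "\<And>x. x \<in> S \<Longrightarrow> (g has_derivative (\<lambda>h. fst h * g1 x + snd h * g2 x)) (at x)"
    "ck2 S n g1" "ck2 S n g2" using Suc.prems(2) by (rule ck2_SucE) blast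
  show ?case
  proof (rule ck2_SucI)
    show "((\<lambda>x. f x + g x) has_derivative
        (\<lambda>h. fst h * (f1 x + g1 x) + snd h * (f2 x + g2 x))) (at x)" if "x \<in> S" for x
      by (rule has_derivative_eq_rhs[OF has_derivative_add[OF f(1)[OF that] g(1)[OF that]]])
         (auto simp: fun_eq_iff algebra_simps)
  qed (rule Suc.IH f g)+
qed simp

lemma ck2_mult: "ck2 S n f \<Longrightarrow> ck2 S n g \<Longrightarrow> ck2 S n (\<lambda>x. f x * g x)"
proof (induction n arbitrary: f g)
  case (Suc n)
  obtain f1 f2 where f: "\<And>x. x \<in> S \<Longrightarrow> (f has_derivative (\<lambda>h. fst h * f1 x + snd h * f2 x)) (at x)"
    "ck2 S n f1" "ck2 S n f2" using Suc.prems(1) by (rule ck2_SucE) blast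
  obtain g1 g2 where g: "\<And>x. x \<in> S \<Longrightarrow> (g has_derivative (\<lambda>h. fst h * g1 x + snd h * g2 x)) (at x)"
    "ck2 S n g1" "ck2 S n g2" using Suc.prems(2) by (rule ck2_SucE) blast
  note fg = Suc.prems[THEN ck2_Suc_D]
  show ?case
  proof (rule ck2_SucI)
    show "((\<lambda>x. f x * g x) has_derivative
        (\<lambda>h. fst h * (f x * g1 x + f1 x * g x) + snd h * (f x * g2 x + f2 x * g x))) (at x)"
      if "x \<in> S" for x
      by (rule has_derivative_eq_rhs[OF has_derivative_mult[OF f(1)[OF that] g(1)[OF that]]])
         (auto simp: fun_eq_iff algebra_simps)
    show "ck2 S n (\<lambda>x. f x * g1 x + f1 x * g x)" "ck2 S n (\<lambda>x. f x * g2 x + f2 x * g x)"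
      by (rule ck2_add[OF Suc.IH Suc.IH] fg f g)+
  qed
qed simp

lemma ck2_inverse:
  "ck2 S n f \<Longrightarrow> (\<And>x. x \<in> S \<Longrightarrow> f x \<noteq> 0) \<Longrightarrow> ck2 S n (\<lambda>x. inverse (f x))"
proof (induction n)
  case (Suc n)
  obtain f1 f2 where f: "\<And>x. x \<in> S \<Longrightarrow> (f has_derivative (\<lambda>h. fst h * f1 x + snd h * f2 x)) (at x)"
    "ck2 S n f1" "ck2 S n f2" using Suc.prems(1) by (rule ck2_SucE) blast
  note i = Suc.IH[OF ck2_Suc_D[OF Suc.prems(1)] Suc.prems(2)]
  show ?case
  proof (rule ck2_SucI)
    show "((\<lambda>x. inverse (f x)) has_derivative
        (\<lambda>h. fst h * (- 1 * (f1 x * (inverse (f x) * inverse (f x))))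
           + snd h * (- 1 * (f2 x * (inverse (f x) * inverse (f x)))))) (at x)"
      if "x \<in> S" for x
      by (rule has_derivative_eq_rhs[OF Deriv.has_derivative_inverse[OF Suc.prems(2)[OF that] f(1)[OF that]]])
         (auto simp: fun_eq_iff algebra_simps)
  qed (rule ck2_mult ck2_const i f | assumption)+
qed simp

lemma ck2_compose: "ck n f \<Longrightarrow> ck2 S n g \<Longrightarrow> ck2 S n (\<lambda>x. f (g x))"
proof (induction n arbitrary: f)
  case (Suc n)
  from Suc.prems(1) obtain f' where f: "\<And>x. (f has_real_derivative f' x) (at x)" "ck n f'"
    unfolding ck.simps by blast
  obtain g1 g2 where g: "\<And>x. x \<in> S \<Longrightarrow> (g has_derivative (\<lambda>h. fst h * g1 x + snd h * g2 x)) (at x)"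
    "ck2 S n g1" "ck2 S n g2" using Suc.prems(2) by (rule ck2_SucE) blast
  have f': "ck2 S n (\<lambda>x. f' (g x))" by (rule Suc.IH[OF f(2) ck2_Suc_D[OF Suc.prems(2)]])
  show ?case
  proof (rule ck2_SucI)
    fix x assume x: "x \<in> S"
    have "(f has_derivative (\<lambda>h. h * f' (g x))) (at (g x))"
      using f(1)[of "g x"] unfolding has_field_derivative_def
      by (rule has_derivative_eq_rhs) (auto simp: fun_eq_iff)
    from has_derivative_compose[OF g(1)[OF x] this]
    show "((\<lambda>x. f (g x)) has_derivative
        (\<lambda>h. fst h * (f' (g x) * g1 x) + snd h * (f' (g x) * g2 x))) (at x)"
      by (rule has_derivative_eq_rhs) (auto simp: fun_eq_iff algebra_simps)
  qed (rule ck2_mult[OF f' g(2)], rule ck2_mult[OF f' g(3)])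
qed simp

lemma has_derivative2_unique:
  assumes "(f has_derivative (\<lambda>h. fst h * a + snd h * b)) (at (x :: real \<times> real))"
    "(f has_derivative (\<lambda>h. fst h * a' + snd h * b')) (at x)"
  shows "a = (a' :: real)" "b = b'"
  using fun_cong[OF has_derivative_unique[OF assms], of "(1, 0)"]
    fun_cong[OF has_derivative_unique[OF assms], of "(0, 1)"] by auto

text \<open>This turns local smoothness on \<open>S\<close> into smoothness on the plane:
  \<open>S\<close> and the complement of the closed set \<open>K\<close> are open and cover the
  plane, and off \<open>K\<close> all derivatives are 0.\<close>

lemma smooth_R2_zero_extend:
  assumes S: "open S" and K: "closed K" "K \<subseteq> S" and f: "\<And>n. ck2 S n f" "\<And>x. x \<notin> K \<Longrightarrow> f x = 0"
  shows "smooth_R2 f"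
proof -
  \<comment> \<open>\<open>smooth_R2\<close> asks for a family closed under partial derivatives;
    this is the largest natural candidate containing \<open>f\<close>.\<close>
  define F where "F = {g. (\<forall>n. ck2 S n g) \<and> (\<forall>x. x \<notin> K \<longrightarrow> g x = 0)}"
  have "\<exists>h1 h2. h1 \<in> F \<and> h2 \<in> F \<and> (\<forall>x. (g has_derivative (\<lambda>h. fst h * h1 x + snd h * h2 x)) (at x))"
    if g: "g \<in> F" for g
  proof -
    have ck2: "ck2 S (Suc n) g" for n using g unfolding F_def by blast
    obtain g1 g2 where d: "\<And>x. x \<in> S \<Longrightarrow> (g has_derivative (\<lambda>h. fst h * g1 x + snd h * g2 x)) (at x)"
      using ck2[of 0] by (rule ck2_SucE) blast
    have z: "(g has_derivative (\<lambda>h. fst h * 0 + snd h * 0)) (at x)" if "x \<notin> K" for x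
      by (rule has_derivative_transform_within_open[of "\<lambda>x. 0" _ _ _ "- K"])
         (use g that K in \<open>auto simp: F_def\<close>)
    have eq: "g1 x = 0 \<and> g2 x = 0" if "x \<in> S" "x \<notin> K" for x
      using has_derivative2_unique[OF d[OF that(1)] z[OF that(2)]] by simp
    \<comment> \<open>The local derivatives are arbitrary off \<open>S\<close>. Cutting them to
      \<open>K\<close> makes them globally correct and leaves them unchanged on \<open>S\<close>,
      since there they vanish off \<open>K\<close> anyway.\<close>
    define h1 h2 where "h1 = (\<lambda>x. if x \<in> K then g1 x else 0)" and "h2 = (\<lambda>x. if x \<in> K then g2 x else 0)"
    have h: "h1 x = g1 x \<and> h2 x = g2 x" if "x \<in> S" for x
      using eq[OF that] by (auto simp: h1_def h2_def)
    have "(g has_derivative (\<lambda>h. fst h * h1 x + snd h * h2 x)) (at x)" for x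
      using d[of x] h[of x] z[of x] K(2) by (cases "x \<in> K") (auto simp: h1_def h2_def)
    moreover have "ck2 S n h1 \<and> ck2 S n h2" for n
    proof -
      \<comment> \<open>The witnesses for order \<open>n\<close> are identified with the fixed pair
        by uniqueness of the partial derivatives.\<close>
      obtain k1 k2 where k: "\<And>x. x \<in> S \<Longrightarrow> (g has_derivative (\<lambda>h. fst h * k1 x + snd h * k2 x)) (at x)"
        "ck2 S n k1" "ck2 S n k2" using ck2[of n] by (rule ck2_SucE) blast
      have "k1 x = h1 x \<and> k2 x = h2 x" if "x \<in> S" for x
        using has_derivative2_unique[OF k(1)[OF that] d[OF that]] h[OF that] by simp
      thus ?thesis using ck2_cong[OF S _ k(2)] ck2_cong[OF S _ k(3)] by blast
    qed
    moreover have "h1 x = 0 \<and> h2 x = 0" if "x \<notin> K" for x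
      using that by (simp add: h1_def h2_def)
    ultimately have "h1 \<in> F" "h2 \<in> F" unfolding F_def by blast+
    with \<open>\<And>x. (g has_derivative (\<lambda>h. fst h * h1 x + snd h * h2 x)) (at x)\<close> show ?thesis by blast
  qed
  moreover have "f \<in> F" using f by (auto simp: F_def)
  ultimately show ?thesis unfolding smooth_R2_def by blast
qed

lemma smooth_R2_gradE:
  assumes "smooth_R2 u"
  obtains u1 u2 where "\<And>x. (u has_derivative (\<lambda>h. fst h * u1 x + snd h * u2 x)) (at x)"
    "smooth_R2 u1" "smooth_R2 u2"
proof -
  from assms obtain F where F: "u \<in> F" "\<forall>g\<in>F. \<exists>g1 g2. g1 \<in> F \<and> g2 \<in> F \<and>
      (\<forall>x. (g has_derivative (\<lambda>h. fst h * g1 x + snd h * g2 x)) (at x))"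
    unfolding smooth_R2_def by blast
  then obtain u1 u2 where u: "u1 \<in> F" "u2 \<in> F"
    "\<And>x. (u has_derivative (\<lambda>h. fst h * u1 x + snd h * u2 x)) (at x)" by blast
  have "smooth_R2 u1" "smooth_R2 u2" unfolding smooth_R2_def using F(2) u(1,2) by blast+
  with u(3) that show ?thesis by blast
qed

lemma smooth_R2_continuous:
  assumes "smooth_R2 u" shows "continuous_on A u"
proof -
  obtain u1 u2 where "\<And>x. (u has_derivative (\<lambda>h. fst h * u1 x + snd h * u2 x)) (at x)"
    using assms by (rule smooth_R2_gradE) blast
  hence "isCont u x" for x by (rule has_derivative_continuous)
  thus ?thesis by (simp add: continuous_at_imp_continuous_on)
qed

text \<open>Used for circles about the origin. By the chain rule the derivative involves other
  members of the witnessing family, so the induction ranges over the whole family.\<close>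

lemma smooth_R2_curve:
  assumes u: "smooth_R2 u" and p: "smooth1 p" and q: "smooth1 q"
  shows "smooth1 (\<lambda>t. u (p t, q t))"
proof -
  from u obtain F where F: "u \<in> F" "\<And>g. g \<in> F \<Longrightarrow> \<exists>g1 g2. g1 \<in> F \<and> g2 \<in> F \<and>
      (\<forall>x. (g has_derivative (\<lambda>h. fst h * g1 x + snd h * g2 x)) (at x))"
    unfolding smooth_R2_def by blast
  obtain p' where p': "\<And>x. (p has_real_derivative p' x) (at x)" "smooth1 p'"
    using p by (rule smooth1_derivE) blast
  obtain q' where q': "\<And>x. (q has_real_derivative q' x) (at x)" "smooth1 q'"
    using q by (rule smooth1_derivE) blast
  have "\<forall>g\<in>F. ck n (\<lambda>t. g (p t, q t))" for n
  proof (induction n)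
    case (Suc n)
    show ?case
    proof
      fix g assume "g \<in> F"
      then obtain g1 g2 where g: "g1 \<in> F" "g2 \<in> F"
        "\<And>x. (g has_derivative (\<lambda>h. fst h * g1 x + snd h * g2 x)) (at x)" using F(2) by blast
      have "((\<lambda>t. g (p t, q t)) has_real_derivative
          (g1 (p t, q t) * p' t + g2 (p t, q t) * q' t)) (at t)" for t
      proof -
        have "((\<lambda>t. (p t, q t)) has_derivative (\<lambda>h. (p' t * h, q' t * h))) (at t)"
          using p'(1) q'(1) by (intro has_derivative_Pair) (auto simp: has_field_derivative_def)
        from has_derivative_compose[OF this g(3)] show ?thesis
          unfolding has_field_derivative_def
          by (rule has_derivative_eq_rhs) (auto simp: fun_eq_iff algebra_simps)
      qed
      moreover have "ck n (\<lambda>t. g1 (p t, q t) * p' t + g2 (p t, q t) * q' t)"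
        using Suc g p'(2) q'(2) by (auto simp: smooth1_def intro!: ck_add[OF ck_mult ck_mult])
      ultimately show "ck (Suc n) (\<lambda>t. g (p t, q t))" by (rule ck_SucI)
    qed
  qed simp
  thus ?thesis using F(1) by (auto simp: smooth1_def)
qed

lemma grad_sq_eq:
  assumes "(u has_derivative (\<lambda>h. fst h * a + snd h * b)) (at x)"
  shows "grad_sq u x = a\<^sup>2 + b\<^sup>2"
  unfolding grad_sq_def frechet_derivative_at[OF assms, symmetric] by simp

lemma grad_sq_measurable:
  assumes "smooth_R2 u" shows "grad_sq u \<in> borel_measurable borel"
proof -
  obtain u1 u2 where u: "\<And>x. (u has_derivative (\<lambda>h. fst h * u1 x + snd h * u2 x)) (at x)"
    "smooth_R2 u1" "smooth_R2 u2" using assms by (rule smooth_R2_gradE) blast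
  have [measurable]: "u1 \<in> borel_measurable borel" "u2 \<in> borel_measurable borel"
    using u(2,3)[THEN smooth_R2_continuous, THEN borel_measurable_continuous_onI] by blast+
  have "grad_sq u = (\<lambda>x. (u1 x)\<^sup>2 + (u2 x)\<^sup>2)" using grad_sq_eq[OF u(1)] by auto
  thus ?thesis by simp
qed

section \<open>Polar angle and logarithmic radius\<close>

definition ang :: "real \<times> real \<Rightarrow> real" where
  "ang p = Arg2pi (Complex (fst p) (snd p))"

text \<open>The cut of \<open>ang\<close> is the nonnegative half axis, which lies in the boundary
  of every wedge of opening at most \<open>2 * pi\<close>; a principal argument would instead be cut
  inside the wedges considered here.\<close>

definition slit_plane :: "(real \<times> real) set" where
  "slit_plane = - {p. snd p = 0 \<and> fst p \<ge> 0}"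

definition pol :: "real \<Rightarrow> real \<Rightarrow> real \<times> real" where
  "pol \<rho> \<theta> = (\<rho> * cos \<theta>, \<rho> * sin \<theta>)"

lemma open_slit_plane: "open slit_plane"
  unfolding slit_plane_def open_Compl
  by (intro open_Compl closed_Collect_conj closed_Collect_eq closed_Collect_le continuous_intros)

lemma ang_bounds: "0 \<le> ang p" "ang p < 2 * pi"
  by (auto simp: ang_def Arg2pi_ge_0 Arg2pi_lt_2pi)

lemma ang_pos: "p \<in> slit_plane \<Longrightarrow> 0 < ang p"
  unfolding ang_def slit_plane_def by (intro Arg2pi_gt_0) (auto simp: complex_nonneg_Reals_iff)

lemma norm_pol: "norm (pol \<rho> \<theta>) = \<bar>\<rho>\<bar>"
proof -
  have "(\<rho> * cos \<theta>)\<^sup>2 + (\<rho> * sin \<theta>)\<^sup>2 = \<rho>\<^sup>2 * ((cos \<theta>)\<^sup>2 + (sin \<theta>)\<^sup>2)"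
    by (simp add: power_mult_distrib distrib_left del: sin_cos_squared_add sin_cos_squared_add2)
  thus ?thesis by (simp add: pol_def norm_Pair)
qed

lemma pol_ang: "pol (norm p) (ang p) = p"
proof -
  have "norm p = cmod (Complex (fst p) (snd p))" by (cases p) (simp add: norm_Pair cmod_def)
  thus ?thesis using cos_Arg2pi[of "Complex (fst p) (snd p)"] sin_Arg2pi[of "Complex (fst p) (snd p)"]
    by (cases p) (simp add: pol_def ang_def)
qed

lemma ang_pol: "\<rho> > 0 \<Longrightarrow> 0 \<le> \<theta> \<Longrightarrow> \<theta> < 2 * pi \<Longrightarrow> ang (pol \<rho> \<theta>) = \<theta>"
  unfolding ang_def pol_def
  by (rule Arg2pi_unique[of \<rho>]) (auto simp: complex_eq_iff Re_exp Im_exp)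

lemma slit_plane_iff: "p \<in> slit_plane \<longleftrightarrow> 0 < ang p"
proof -
  have "p \<in> slit_plane" if "ang p > 0"
    using that Arg2pi_eq_0[of "Complex (fst p) (snd p)"]
    by (auto simp: ang_def slit_plane_def complex_is_Real_iff)
  thus ?thesis using ang_pos by blast
qed

lemma slit_plane_nonzero: "p \<in> slit_plane \<Longrightarrow> (fst p)\<^sup>2 + (snd p)\<^sup>2 > 0"
  unfolding slit_plane_def by (auto simp: sum_power2_gt_zero_iff)

text \<open>Off the cut, \<open>Arg2pi z\<close> equals \<open>Im (Ln (- z)) + pi\<close>; the sign
  change moves the cut of \<open>Ln\<close> from the negative to the positive half axis, so the
  complex derivative of \<open>Ln\<close> applies.\<close>

lemma has_derivative_ang:
  assumes "p \<in> slit_plane"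
  defines "q \<equiv> inverse ((fst p)\<^sup>2 + (snd p)\<^sup>2)"
  shows "(ang has_derivative (\<lambda>h. fst h * (- (snd p * q)) + snd h * (fst p * q))) (at p)"
proof -
  define z where "z = - Complex (fst p) (snd p)"
  have nz: "z \<notin> \<real>\<^sub>\<le>\<^sub>0" using assms(1)
    by (auto simp: z_def slit_plane_def complex_nonpos_Reals_iff)
  have "((\<lambda>p. - (complex_of_real (fst p) + \<i> * complex_of_real (snd p))) has_derivative
      (\<lambda>h. - Complex (fst h) (snd h))) (at p)"
    by (auto intro!: derivative_eq_intros simp: fun_eq_iff complex_eq_iff)
  hence "((\<lambda>p. - Complex (fst p) (snd p)) has_derivative (\<lambda>h. - Complex (fst h) (snd h))) (at p)"
    by (simp add: Complex_eq)
  moreover have "(Ln has_derivative (\<lambda>h. inverse z * h)) (at (- Complex (fst p) (snd p)))"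
    using has_field_derivative_Ln[OF nz] unfolding has_field_derivative_def z_def .
  ultimately have "((\<lambda>p. Ln (- Complex (fst p) (snd p))) has_derivative
      (\<lambda>h. inverse z * (- Complex (fst h) (snd h)))) (at p)"
    by (rule has_derivative_compose)
  from has_derivative_add[OF bounded_linear.has_derivative[OF bounded_linear_Im this] has_derivative_const[of pi]]
  have "((\<lambda>p. Im (Ln (- Complex (fst p) (snd p))) + pi) has_derivative
      (\<lambda>h. fst h * (- (snd p * q)) + snd h * (fst p * q))) (at p)"
    by (rule has_derivative_eq_rhs)
       (auto simp: fun_eq_iff z_def q_def inverse_eq_divide Im_divide diff_divide_distrib add_divide_distrib algebra_simps)
  thus ?thesis
    by (rule has_derivative_transform_within_open[OF _ open_slit_plane assms(1)])
       (use ang_pos in \<open>auto simp: ang_def Arg2pi_Ln\<close>)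
qed

lemma continuous_on_ang: "continuous_on slit_plane ang"
  using has_derivative_ang has_derivative_continuous continuous_at_imp_continuous_on by blast

text \<open>This is the logarithm of the norm, written with squares so that its partial derivatives
  are rational functions.\<close>

definition log_rad :: "real \<times> real \<Rightarrow> real" where
  "log_rad p = ln ((fst p)\<^sup>2 + (snd p)\<^sup>2) / 2"

lemma has_derivative_log_rad:
  assumes "p \<in> slit_plane"
  defines "q \<equiv> inverse ((fst p)\<^sup>2 + (snd p)\<^sup>2)"
  shows "(log_rad has_derivative (\<lambda>h. fst h * (fst p * q) + snd h * (snd p * q))) (at p)"
proof -
  let ?s = "(fst p)\<^sup>2 + (snd p)\<^sup>2"
  have 1: "((\<lambda>p. (fst p)\<^sup>2 + (snd p)\<^sup>2) has_derivative (\<lambda>h. fst h * (2 * fst p) + snd h * (2 * snd p))) (at p)"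
    by (auto intro!: derivative_eq_intros simp: fun_eq_iff algebra_simps)
  have 2: "((\<lambda>t. ln t / 2) has_derivative (\<lambda>h. q * h / 2)) (at ?s)"
  proof -
    have "((\<lambda>t. ln t / 2) has_real_derivative (1 / ?s / 2)) (at ?s)"
      by (rule DERIV_cdivide[OF DERIV_ln_divide[OF slit_plane_nonzero[OF assms(1)]]])
    thus ?thesis unfolding has_field_derivative_def
      by (rule has_derivative_eq_rhs) (simp add: fun_eq_iff q_def inverse_eq_divide)
  qed
  show ?thesis unfolding log_rad_def[abs_def]
    by (rule has_derivative_eq_rhs[OF has_derivative_compose[OF 1 2]])
       (simp add: fun_eq_iff ring_distribs add_divide_distrib)
qed

lemma log_rad_pol: "\<rho> > 0 \<Longrightarrow> log_rad (pol \<rho> \<theta>) = ln \<rho>"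
proof -
  assume "\<rho> > 0"
  have "(\<rho> * cos \<theta>)\<^sup>2 + (\<rho> * sin \<theta>)\<^sup>2 = \<rho>\<^sup>2 * ((cos \<theta>)\<^sup>2 + (sin \<theta>)\<^sup>2)"
    by (simp add: power_mult_distrib distrib_left del: sin_cos_squared_add sin_cos_squared_add2)
  thus ?thesis using \<open>\<rho> > 0\<close> by (simp add: pol_def log_rad_def ln_realpow)
qed

lemma ck2_inv_rad_sq: "ck2 slit_plane n (\<lambda>p. inverse ((fst p)\<^sup>2 + (snd p)\<^sup>2))"
proof -
  have "ck2 slit_plane n (\<lambda>p. fst p * fst p + snd p * snd p)"
    by (rule ck2_add[OF ck2_mult[OF ck2_fst ck2_fst] ck2_mult[OF ck2_snd ck2_snd]])
  hence 1: "ck2 slit_plane n (\<lambda>p. (fst p)\<^sup>2 + (snd p)\<^sup>2)" by (simp add: power2_eq_square)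
  show ?thesis by (rule ck2_inverse[OF 1]) (metis slit_plane_nonzero less_irrefl)
qed

lemma ck2_ang: "ck2 slit_plane n ang"
proof (cases n)
  case (Suc m)
  have "ck2 slit_plane m (\<lambda>p. - 1 * (snd p * inverse ((fst p)\<^sup>2 + (snd p)\<^sup>2)))"
    by (rule ck2_mult ck2_const ck2_snd ck2_inv_rad_sq)+
  hence 1: "ck2 slit_plane m (\<lambda>p. - (snd p * inverse ((fst p)\<^sup>2 + (snd p)\<^sup>2)))" by simp
  show ?thesis unfolding Suc
    by (rule ck2_SucI[OF has_derivative_ang 1 ck2_mult[OF ck2_fst ck2_inv_rad_sq]])
qed simp

lemma ck2_log_rad: "ck2 slit_plane n log_rad"
proof (cases n)
  case (Suc m)
  show ?thesis unfolding Suc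
    by (rule ck2_SucI[OF has_derivative_log_rad ck2_mult[OF ck2_fst ck2_inv_rad_sq]
          ck2_mult[OF ck2_snd ck2_inv_rad_sq]])
qed simp

section \<open>Integration in polar coordinates\<close>

text \<open>The substitution rule is available on compact intervals; both sides are exhausted by
  them and monotone convergence gives the whole line.\<close>

lemma nn_integral_arctan:
  fixes f :: "real \<Rightarrow> ennreal"
  assumes [measurable]: "f \<in> borel_measurable borel"
  shows "(\<integral>\<^sup>+ t. f (arctan t) * ennreal (1 / (1 + t\<^sup>2)) \<partial>lborel) = (\<integral>\<^sup>+ \<phi>\<in>{- (pi / 2)<..<pi / 2}. f \<phi> \<partial>lborel)"
proof -
  \<comment> \<open>\<open>Suc n\<close> instead of \<open>n\<close> keeps every interval
    nondegenerate.\<close>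
  define A where "A n = (\<integral>\<^sup>+ \<phi>\<in>{arctan (- real (Suc n))..arctan (real (Suc n))}. f \<phi> \<partial>lborel)" for n
  define B where "B n = (\<integral>\<^sup>+ t\<in>{- real (Suc n)..real (Suc n)}. f (arctan t) * ennreal (1 / (1 + t\<^sup>2)) \<partial>lborel)" for n
  have "A n = B n" for n unfolding A_def B_def
    by (rule nn_integral_substitution_aux)
       (auto intro!: derivative_eq_intros continuous_intros
         simp: divide_inverse add_nonneg_eq_0_iff)
  hence "A = B" by auto
  moreover have "A \<longlonglongrightarrow> (\<integral>\<^sup>+ \<phi>\<in>{- (pi / 2)<..<pi / 2}. f \<phi> \<partial>lborel)" unfolding A_def
  proof (rule nn_integral_LIMSEQ)
    show "incseq (\<lambda>n \<phi>. f \<phi> * indicator {arctan (- real (Suc n))..arctan (real (Suc n))} \<phi>)"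
    proof (rule incseq_SucI, rule le_funI)
      fix m :: nat and \<phi> :: real
      let ?n = "Suc m"
      have "{arctan (- real (Suc m))..arctan (real (Suc m))} \<subseteq> {arctan (- real (Suc ?n))..arctan (real (Suc ?n))}"
        unfolding atLeastatMost_subset_iff arctan_le_iff by simp
      thus "f \<phi> * indicator {arctan (- real (Suc m))..arctan (real (Suc m))} \<phi> \<le>
          f \<phi> * indicator {arctan (- real (Suc ?n))..arctan (real (Suc ?n))} \<phi>"
        by (intro mult_left_mono indicator_leI) auto
    qed
    fix \<phi> :: real
    have "\<forall>\<^sub>F n in sequentially. f \<phi> * indicator {arctan (- real (Suc n))..arctan (real (Suc n))} \<phi>
        = f \<phi> * indicator {- (pi / 2)<..<pi / 2} \<phi>"
    proof (cases "\<phi> \<in> {- (pi / 2)<..<pi / 2}")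
      case True
      hence at: "arctan (tan \<phi>) = \<phi>" by (intro arctan_tan) auto
      obtain N :: nat where N: "\<bar>tan \<phi>\<bar> \<le> real N" using real_arch_simple by blast
      have "\<phi> \<in> {arctan (- real (Suc n))..arctan (real (Suc n))}" if "n \<ge> N" for n
        using N that arctan_le_iff[of "- real (Suc n)" "tan \<phi>"] arctan_le_iff[of "tan \<phi>" "real (Suc n)"]
          of_nat_mono[OF that, where 'a = real] by (simp add: at; linarith)
      thus ?thesis using True by (auto intro!: eventually_sequentiallyI[of N])
    next
      case False
      have "\<phi> \<notin> {arctan (- real (Suc n))..arctan (real (Suc n))}" for n
        using False arctan_bounded[of "real (Suc n)"] by (auto simp: arctan_minus simp del: of_nat_Suc)
      thus ?thesis using False by auto
    qed
    thus "(\<lambda>n. f \<phi> * indicator {arctan (- real (Suc n))..arctan (real (Suc n))} \<phi>) \<longlonglongrightarrow>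
        f \<phi> * indicator {- (pi / 2)<..<pi / 2} \<phi>"
      by (rule tendsto_eventually)
  qed simp
  moreover have "B \<longlonglongrightarrow> (\<integral>\<^sup>+ t. f (arctan t) * ennreal (1 / (1 + t\<^sup>2)) \<partial>lborel)" unfolding B_def
  proof (rule nn_integral_LIMSEQ)
    show "incseq (\<lambda>n t. f (arctan t) * ennreal (1 / (1 + t\<^sup>2)) * indicator {- real (Suc n)..real (Suc n)} t)"
      by (auto simp: incseq_def le_fun_def indicator_def)
    fix t :: real
    obtain N :: nat where N: "\<bar>t\<bar> \<le> real N" using real_arch_simple by blast
    have "\<forall>\<^sub>F n in sequentially. f (arctan t) * ennreal (1 / (1 + t\<^sup>2)) * indicator {- real (Suc n)..real (Suc n)} t
        = f (arctan t) * ennreal (1 / (1 + t\<^sup>2))"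
      using N by (intro eventually_sequentiallyI[of N]) (auto simp: indicator_def)
    thus "(\<lambda>n. f (arctan t) * ennreal (1 / (1 + t\<^sup>2)) * indicator {- real (Suc n)..real (Suc n)} t)
        \<longlonglongrightarrow> f (arctan t) * ennreal (1 / (1 + t\<^sup>2))"
      by (rule tendsto_eventually)
  qed simp
  ultimately show ?thesis using LIMSEQ_unique by metis
qed

text \<open>Only one-dimensional substitutions and Fubini are used: on each horizontal line x = y t,
  then on each line of fixed t the radius replaces y, and t = tan(phi) brings in the angle
  \<open>phi\<close> measured from the vertical axis. The final reflection
  \<open>pi / 2 - \<theta>\<close> restores the usual angle.\<close>

lemma nn_integral_polar_upper:
  fixes g :: "real \<times> real \<Rightarrow> ennreal"
  assumes [measurable]: "g \<in> borel_measurable borel"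
  shows "(\<integral>\<^sup>+ y. (\<integral>\<^sup>+ x. g (x, y) * indicator {0<..} y \<partial>lborel) \<partial>lborel) =
    (\<integral>\<^sup>+ \<rho>. (\<integral>\<^sup>+ \<theta>. ennreal \<rho> * g (pol \<rho> \<theta>) * indicator {0<..} \<rho> * indicator {0<..<pi} \<theta> \<partial>lborel) \<partial>lborel)"
proof -
  have g1: "(\<lambda>(t, y). ennreal y * g (y * t, y) * indicator {0<..} y) \<in> borel_measurable (lborel \<Otimes>\<^sub>M lborel)"
  proof -
    have "(\<lambda>x. (snd x * fst x, snd x)) \<in> borel_measurable (borel :: (real \<times> real) measure)"
      by (intro borel_measurable_continuous_onI continuous_intros)
    from measurable_compose[OF this assms]
    have [measurable]: "(\<lambda>x. g (snd x * fst x, snd x)) \<in> borel_measurable (lborel \<Otimes>\<^sub>M lborel)"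
      by (simp add: lborel_prod)
    show ?thesis unfolding case_prod_beta by measurable
  qed
  have g2: "(\<lambda>(\<rho>, \<theta>). ennreal \<rho> * g (pol \<rho> \<theta>) * indicator {0<..} \<rho> * indicator {0<..<pi} \<theta>)
      \<in> borel_measurable (lborel \<Otimes>\<^sub>M lborel)"
  proof -
    have "(\<lambda>x. pol (fst x) (snd x)) \<in> borel_measurable (borel :: (real \<times> real) measure)"
      unfolding pol_def by (intro borel_measurable_continuous_onI continuous_intros)
    from measurable_compose[OF this assms]
    have [measurable]: "(\<lambda>x. g (pol (fst x) (snd x))) \<in> borel_measurable (lborel \<Otimes>\<^sub>M lborel)"
      by (simp add: lborel_prod)
    show ?thesis unfolding case_prod_beta by measurable
  qed
  have m1: "(\<lambda>y. g (y * a, y * b)) \<in> borel_measurable borel" for a b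
    by (rule measurable_compose[OF _ assms], rule borel_measurable_continuous_onI)
       (intro continuous_intros)
  have m2: "(\<lambda>x. g (x, y)) \<in> borel_measurable borel" for y
    by (rule measurable_compose[OF _ assms], rule borel_measurable_continuous_onI)
       (intro continuous_intros)
  have m3: "(\<lambda>\<theta>. \<integral>\<^sup>+ \<rho>. ennreal \<rho> * g (\<rho> * sin \<theta>, \<rho> * cos \<theta>) * indicator {0<..} \<rho> \<partial>lborel) \<in> borel_measurable borel"
  proof -
    have "(\<lambda>x. (snd x * sin (fst x), snd x * cos (fst x))) \<in> borel_measurable (borel :: (real \<times> real) measure)"
      by (intro borel_measurable_continuous_onI continuous_intros)
    from measurable_compose[OF this assms]
    have [measurable]: "(\<lambda>x. g (snd x * sin (fst x), snd x * cos (fst x))) \<in> borel_measurable (lborel \<Otimes>\<^sub>M lborel)"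
      by (simp add: lborel_prod)
    have "(\<lambda>(\<theta>, \<rho>). ennreal \<rho> * g (\<rho> * sin \<theta>, \<rho> * cos \<theta>) * indicator {0<..} \<rho>) \<in> borel_measurable (lborel \<Otimes>\<^sub>M lborel)"
      unfolding case_prod_beta by measurable
    from lborel.borel_measurable_nn_integral_fst[OF this] show ?thesis by simp
  qed
  have "(\<integral>\<^sup>+ y. (\<integral>\<^sup>+ x. g (x, y) * indicator {0<..} y \<partial>lborel) \<partial>lborel)
      = (\<integral>\<^sup>+ y. (\<integral>\<^sup>+ t. ennreal y * g (y * t, y) * indicator {0<..} y \<partial>lborel) \<partial>lborel)"
  proof (rule nn_integral_cong)
    fix y :: real
    show "(\<integral>\<^sup>+ x. g (x, y) * indicator {0<..} y \<partial>lborel) = (\<integral>\<^sup>+ t. ennreal y * g (y * t, y) * indicator {0<..} y \<partial>lborel)"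
    proof (cases "y > 0")
      case True
      have [measurable]: "(\<lambda>t. g (y * t, y)) \<in> borel_measurable borel"
        by (rule measurable_compose[OF _ assms], rule borel_measurable_continuous_onI)
           (intro continuous_intros)
      show ?thesis using True nn_integral_real_affine[OF m2[of y], of y 0]
        by (simp add: nn_integral_cmult)
    qed simp
  qed
  also have "\<dots> = (\<integral>\<^sup>+ t. (\<integral>\<^sup>+ y. ennreal y * g (y * t, y) * indicator {0<..} y \<partial>lborel) \<partial>lborel)"
    using lborel_pair.Fubini'[OF g1] by simp
  also have "\<dots> = (\<integral>\<^sup>+ t. (\<integral>\<^sup>+ \<rho>. ennreal \<rho> * g (\<rho> * sin (arctan t), \<rho> * cos (arctan t)) * indicator {0<..} \<rho> \<partial>lborel)
      * ennreal (1 / (1 + t\<^sup>2)) \<partial>lborel)"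
  proof (rule nn_integral_cong)
    fix t :: real
    \<comment> \<open>On the line with slope parameter \<open>t\<close> the radius is
      \<open>y * s\<close>. One factor \<open>1 / s\<close> comes from the change of y and one from
      the weight y; their product is the derivative of \<open>arctan\<close>.\<close>
    define s where "s = sqrt (1 + t\<^sup>2)"
    have s: "s > 0" "s * s = 1 + t\<^sup>2" unfolding s_def by (auto simp: add_pos_nonneg)
    have [measurable]: "(\<lambda>y. g (y * t, y)) \<in> borel_measurable borel" using m1[of t 1] by simp
    have [measurable]: "(\<lambda>y. g (y * sin (arctan t), y * cos (arctan t))) \<in> borel_measurable borel" by (rule m1)
    have i: "indicator {0<..} (\<rho> / s) = (indicator {0<..} \<rho> :: ennreal)" for \<rho>
      using s by (auto simp: indicator_def zero_less_divide_iff)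
    have "(\<integral>\<^sup>+ y. ennreal y * g (y * t, y) * indicator {0<..} y \<partial>lborel)
        = ennreal (1 / s) * (\<integral>\<^sup>+ \<rho>. ennreal (\<rho> / s) * g (\<rho> / s * t, \<rho> / s) * indicator {0<..} (\<rho> / s) \<partial>lborel)"
      by (subst nn_integral_real_affine[where c = "1 / s" and t = 0]) (use s in auto)
    also have "\<dots> = ennreal (1 / s) * (\<integral>\<^sup>+ \<rho>. ennreal (1 / s) *
        (ennreal \<rho> * g (\<rho> * sin (arctan t), \<rho> * cos (arctan t)) * indicator {0<..} \<rho>) \<partial>lborel)"
    proof (rule arg_cong2[where f = "(*)", OF refl nn_integral_cong])
      fix \<rho> :: real
      have "ennreal (\<rho> / s) = ennreal (1 / s) * ennreal \<rho>" if "\<rho> > 0"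
        using s that by (subst ennreal_mult[symmetric]) auto
      thus "ennreal (\<rho> / s) * g (\<rho> / s * t, \<rho> / s) * indicator {0<..} (\<rho> / s) = ennreal (1 / s) *
        (ennreal \<rho> * g (\<rho> * sin (arctan t), \<rho> * cos (arctan t)) * indicator {0<..} \<rho>)"
        unfolding i by (auto simp: indicator_def sin_arctan cos_arctan s_def mult.assoc)
    qed
    also have "\<dots> = (ennreal (1 / s) * ennreal (1 / s)) *
        (\<integral>\<^sup>+ \<rho>. ennreal \<rho> * g (\<rho> * sin (arctan t), \<rho> * cos (arctan t)) * indicator {0<..} \<rho> \<partial>lborel)"
      by (subst nn_integral_cmult) (auto simp: mult.assoc)
    also have "ennreal (1 / s) * ennreal (1 / s) = ennreal (1 / (1 + t\<^sup>2))"
      using s by (subst ennreal_mult[symmetric]) auto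
    finally show "(\<integral>\<^sup>+ y. ennreal y * g (y * t, y) * indicator {0<..} y \<partial>lborel) =
      (\<integral>\<^sup>+ \<rho>. ennreal \<rho> * g (\<rho> * sin (arctan t), \<rho> * cos (arctan t)) * indicator {0<..} \<rho> \<partial>lborel)
      * ennreal (1 / (1 + t\<^sup>2))" by (simp add: mult.commute)
  qed
  also have "\<dots> = (\<integral>\<^sup>+ \<phi>. (\<integral>\<^sup>+ \<rho>. ennreal \<rho> * g (\<rho> * sin \<phi>, \<rho> * cos \<phi>) * indicator {0<..} \<rho> \<partial>lborel)
      * indicator {- (pi / 2)<..<pi / 2} \<phi> \<partial>lborel)"
    by (rule nn_integral_arctan[OF m3])
  also have "\<dots> = (\<integral>\<^sup>+ \<theta>. (\<integral>\<^sup>+ \<rho>. ennreal \<rho> * g (\<rho> * sin (pi / 2 - \<theta>), \<rho> * cos (pi / 2 - \<theta>)) * indicator {0<..} \<rho> \<partial>lborel)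
      * indicator {- (pi / 2)<..<pi / 2} (pi / 2 - \<theta>) \<partial>lborel)"
    using m3 by (subst nn_integral_real_affine[where c = "-1" and t = "pi / 2"]) auto
  also have "\<dots> = (\<integral>\<^sup>+ \<theta>. (\<integral>\<^sup>+ \<rho>. ennreal \<rho> * g (pol \<rho> \<theta>) * indicator {0<..} \<rho> * indicator {0<..<pi} \<theta> \<partial>lborel) \<partial>lborel)"
  proof (rule nn_integral_cong)
    fix \<theta> :: real
    have [measurable]: "(\<lambda>\<rho>. g (pol \<rho> \<theta>)) \<in> borel_measurable borel" unfolding pol_def by (rule m1)
    have i: "indicator {- (pi / 2)<..<pi / 2} (pi / 2 - \<theta>) = (indicator {0<..<pi} \<theta> :: ennreal)"
      by (auto simp: indicator_def)
    have "sin (pi / 2 - \<theta>) = cos \<theta>" "cos (pi / 2 - \<theta>) = sin \<theta>" 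
      by (simp_all add: sin_diff cos_diff)
    thus "(\<integral>\<^sup>+ \<rho>. ennreal \<rho> * g (\<rho> * sin (pi / 2 - \<theta>), \<rho> * cos (pi / 2 - \<theta>)) * indicator {0<..} \<rho> \<partial>lborel)
      * indicator {- (pi / 2)<..<pi / 2} (pi / 2 - \<theta>)
      = (\<integral>\<^sup>+ \<rho>. ennreal \<rho> * g (pol \<rho> \<theta>) * indicator {0<..} \<rho> * indicator {0<..<pi} \<theta> \<partial>lborel)"
      unfolding i by (subst nn_integral_multc) (auto simp: pol_def)
  qed
  also have "\<dots> = (\<integral>\<^sup>+ \<rho>. (\<integral>\<^sup>+ \<theta>. ennreal \<rho> * g (pol \<rho> \<theta>) * indicator {0<..} \<rho> * indicator {0<..<pi} \<theta> \<partial>lborel) \<partial>lborel)"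
    using lborel_pair.Fubini'[OF g2] by simp
  finally show ?thesis .
qed

text \<open>The horizontal axis is a null set and the lower half plane is the image of the upper one
  under the point reflection, which shifts the angle by \<open>pi\<close>.\<close>

lemma nn_integral_polar:
  fixes g :: "real \<times> real \<Rightarrow> ennreal"
  assumes g[measurable]: "g \<in> borel_measurable borel"
  shows "(\<integral>\<^sup>+ p. g p \<partial>lborel) =
    (\<integral>\<^sup>+ \<rho>\<in>{0<..}. (\<integral>\<^sup>+ \<theta>\<in>{0<..<2 * pi}. ennreal \<rho> * g (pol \<rho> \<theta>) \<partial>lborel) \<partial>lborel)"
proof -
  \<comment> \<open>\<open>h\<close> carries the lower half plane to the upper one, so the half
    plane formula serves twice.\<close>
  define h where "h p = g (- p)" for p
  have h[measurable]: "h \<in> borel_measurable borel"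
    unfolding h_def[abs_def]
    by (rule measurable_compose[OF _ g], rule borel_measurable_continuous_onI) (intro continuous_intros)
  have mx: "(\<lambda>x. f (x, y)) \<in> borel_measurable borel" if "f \<in> borel_measurable borel" for y and f :: "real \<times> real \<Rightarrow> ennreal"
    by (rule measurable_compose[OF _ that], rule borel_measurable_continuous_onI)
       (intro continuous_intros)
  have g': "(\<lambda>(y, x). g (x, y)) \<in> borel_measurable (lborel \<Otimes>\<^sub>M lborel)"
  proof -
    have "(\<lambda>x. (snd x, fst x)) \<in> borel_measurable (borel :: (real \<times> real) measure)"
      by (intro borel_measurable_continuous_onI continuous_intros)
    from measurable_compose[OF this g] show ?thesis by (simp add: lborel_prod case_prod_beta)
  qed
  have my[measurable]: "(\<lambda>y. \<integral>\<^sup>+ x. g (x, y) \<partial>lborel) \<in> borel_measurable borel"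
    using lborel.borel_measurable_nn_integral_fst[OF g'] by simp
  have mp[measurable]: "(\<lambda>\<theta>. f (pol \<rho> \<theta>)) \<in> borel_measurable borel" if "f \<in> borel_measurable borel" for \<rho> and f :: "real \<times> real \<Rightarrow> ennreal"
    by (rule measurable_compose[OF _ that], rule borel_measurable_continuous_onI)
       (auto intro!: continuous_intros simp: pol_def)
  have mpp: "(\<lambda>\<rho>. \<integral>\<^sup>+ \<theta>. ennreal \<rho> * f (pol \<rho> \<theta>) * indicator {0<..} \<rho> * indicator {0<..<pi} \<theta> \<partial>lborel) \<in> borel_measurable lborel"
    if f: "f \<in> borel_measurable borel" for f :: "real \<times> real \<Rightarrow> ennreal"
  proof -
    have "(\<lambda>x. pol (fst x) (snd x)) \<in> borel_measurable (borel :: (real \<times> real) measure)"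
      unfolding pol_def by (intro borel_measurable_continuous_onI continuous_intros)
    from measurable_compose[OF this f]
    have [measurable]: "(\<lambda>x. f (pol (fst x) (snd x))) \<in> borel_measurable (lborel \<Otimes>\<^sub>M lborel)"
      by (simp add: lborel_prod)
    have "(\<lambda>(\<rho>, \<theta>). ennreal \<rho> * f (pol \<rho> \<theta>) * indicator {0<..} \<rho> * indicator {0<..<pi} \<theta>)
      \<in> borel_measurable (lborel \<Otimes>\<^sub>M lborel)" unfolding case_prod_beta by measurable
    from lborel.borel_measurable_nn_integral_fst[OF this] show ?thesis by simp
  qed
  have neg: "h (x, y) = g (- x, - y)" for x y by (simp add: h_def)
  have "(\<integral>\<^sup>+ p. g p \<partial>lborel) = (\<integral>\<^sup>+ y. (\<integral>\<^sup>+ x. g (x, y) \<partial>lborel) \<partial>lborel)"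
    using lborel_pair.nn_integral_snd[of g] by (simp add: lborel_prod)
  also have "\<dots> = (\<integral>\<^sup>+ y. (\<integral>\<^sup>+ x. g (x, y) \<partial>lborel) * indicator {0<..} y
      + (\<integral>\<^sup>+ x. g (x, y) \<partial>lborel) * indicator {..<0} y \<partial>lborel)"
    using AE_lborel_singleton[of "0 :: real"]
    by (intro nn_integral_cong_AE) (auto elim!: eventually_mono simp: indicator_def)
  also have "\<dots> = (\<integral>\<^sup>+ y. (\<integral>\<^sup>+ x. g (x, y) \<partial>lborel) * indicator {0<..} y \<partial>lborel)
      + (\<integral>\<^sup>+ y. (\<integral>\<^sup>+ x. g (x, y) \<partial>lborel) * indicator {..<0} y \<partial>lborel)"
    by (rule nn_integral_add) auto
  also have "(\<integral>\<^sup>+ y. (\<integral>\<^sup>+ x. g (x, y) \<partial>lborel) * indicator {..<0} y \<partial>lborel)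
      = (\<integral>\<^sup>+ y. (\<integral>\<^sup>+ x. h (x, y) * indicator {0<..} y \<partial>lborel) \<partial>lborel)"
  proof -
    have "(\<integral>\<^sup>+ y. (\<integral>\<^sup>+ x. g (x, y) \<partial>lborel) * indicator {..<0} y \<partial>lborel)
      = (\<integral>\<^sup>+ y. (\<integral>\<^sup>+ x. g (x, - y) \<partial>lborel) * indicator {..<0} (- y) \<partial>lborel)"
      by (subst nn_integral_real_affine[where c = "-1" and t = 0]) auto
    also have "\<dots> = (\<integral>\<^sup>+ y. (\<integral>\<^sup>+ x. h (x, y) * indicator {0<..} y \<partial>lborel) \<partial>lborel)"
    proof (rule nn_integral_cong)
      fix y :: real
      have "(\<integral>\<^sup>+ x. g (x, - y) \<partial>lborel) = (\<integral>\<^sup>+ x. h (x, y) \<partial>lborel)"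
        using mx[OF g] unfolding neg by (subst nn_integral_real_affine[where c = "-1" and t = 0]) auto
      thus "(\<integral>\<^sup>+ x. g (x, - y) \<partial>lborel) * indicator {..<0} (- y) = (\<integral>\<^sup>+ x. h (x, y) * indicator {0<..} y \<partial>lborel)"
        using mx[OF h] by (auto simp: indicator_def)
    qed
    finally show ?thesis .
  qed
  also have "(\<integral>\<^sup>+ y. (\<integral>\<^sup>+ x. g (x, y) \<partial>lborel) * indicator {0<..} y \<partial>lborel)
      = (\<integral>\<^sup>+ y. (\<integral>\<^sup>+ x. g (x, y) * indicator {0<..} y \<partial>lborel) \<partial>lborel)"
    using mx[OF g] by (intro nn_integral_cong) (auto simp: nn_integral_multc)
  also have "(\<integral>\<^sup>+ y. (\<integral>\<^sup>+ x. g (x, y) * indicator {0<..} y \<partial>lborel) \<partial>lborel)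
      + (\<integral>\<^sup>+ y. (\<integral>\<^sup>+ x. h (x, y) * indicator {0<..} y \<partial>lborel) \<partial>lborel)
      = (\<integral>\<^sup>+ \<rho>. (\<integral>\<^sup>+ \<theta>. ennreal \<rho> * g (pol \<rho> \<theta>) * indicator {0<..} \<rho> * indicator {0<..<pi} \<theta> \<partial>lborel)
        + (\<integral>\<^sup>+ \<theta>. ennreal \<rho> * h (pol \<rho> \<theta>) * indicator {0<..} \<rho> * indicator {0<..<pi} \<theta> \<partial>lborel) \<partial>lborel)"
    unfolding nn_integral_polar_upper[OF g] nn_integral_polar_upper[OF h]
    by (rule nn_integral_add[symmetric]) (rule mpp g h)+
  also have "\<dots> = (\<integral>\<^sup>+ \<rho>\<in>{0<..}. (\<integral>\<^sup>+ \<theta>\<in>{0<..<2 * pi}. ennreal \<rho> * g (pol \<rho> \<theta>) \<partial>lborel) \<partial>lborel)"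
  proof (rule nn_integral_cong)
    fix \<rho> :: real
    show "(\<integral>\<^sup>+ \<theta>. ennreal \<rho> * g (pol \<rho> \<theta>) * indicator {0<..} \<rho> * indicator {0<..<pi} \<theta> \<partial>lborel)
        + (\<integral>\<^sup>+ \<theta>. ennreal \<rho> * h (pol \<rho> \<theta>) * indicator {0<..} \<rho> * indicator {0<..<pi} \<theta> \<partial>lborel)
      = (\<integral>\<^sup>+ \<theta>\<in>{0<..<2 * pi}. ennreal \<rho> * g (pol \<rho> \<theta>) \<partial>lborel) * indicator {0<..} \<rho>"
    proof (cases "\<rho> > 0")
      case True
      have hp: "h (pol \<rho> (\<theta> - pi)) = g (pol \<rho> \<theta>)" for \<theta>
        by (simp add: h_def pol_def cos_diff sin_diff)
      have hm: "(\<lambda>\<theta>. h (pol \<rho> \<theta>)) \<in> borel_measurable borel" using mp[OF h] .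
      have gm: "(\<lambda>\<theta>. g (pol \<rho> \<theta>)) \<in> borel_measurable borel" using mp[OF g] .
      have "(\<integral>\<^sup>+ \<theta>. ennreal \<rho> * h (pol \<rho> \<theta>) * indicator {0<..<pi} \<theta> \<partial>lborel)
          = (\<integral>\<^sup>+ \<theta>. ennreal \<rho> * h (pol \<rho> (\<theta> - pi)) * indicator {0<..<pi} (\<theta> - pi) \<partial>lborel)"
        using hm by (subst nn_integral_real_affine[where c = 1 and t = "- pi"]) auto
      also have "\<dots> = (\<integral>\<^sup>+ \<theta>. ennreal \<rho> * g (pol \<rho> \<theta>) * indicator {pi<..<2 * pi} \<theta> \<partial>lborel)"
        unfolding hp by (intro nn_integral_cong) (auto simp: indicator_def)
      finally have "(\<integral>\<^sup>+ \<theta>. ennreal \<rho> * g (pol \<rho> \<theta>) * indicator {0<..<pi} \<theta> \<partial>lborel)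
        + (\<integral>\<^sup>+ \<theta>. ennreal \<rho> * h (pol \<rho> \<theta>) * indicator {0<..<pi} \<theta> \<partial>lborel)
        = (\<integral>\<^sup>+ \<theta>. ennreal \<rho> * g (pol \<rho> \<theta>) * indicator {0<..<pi} \<theta>
            + ennreal \<rho> * g (pol \<rho> \<theta>) * indicator {pi<..<2 * pi} \<theta> \<partial>lborel)"
        using gm by (simp add: nn_integral_add)
      also have "\<dots> = (\<integral>\<^sup>+ \<theta>\<in>{0<..<2 * pi}. ennreal \<rho> * g (pol \<rho> \<theta>) \<partial>lborel)"
        using AE_lborel_singleton[of pi]
        by (intro nn_integral_cong_AE) (auto elim!: eventually_mono simp: indicator_def)
      finally show ?thesis using True by simp
    qed simp
  qed
  finally show ?thesis .
qed

section \<open>The wedge and the distance to its boundary\<close>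

text \<open>Two closed half lines from the origin, which coincide when
  \<open>\<beta> = 2 * pi\<close>. Unlike \<open>Gamma0\<close> this set is invariant under
  dilations.\<close>

definition rays :: "real \<Rightarrow> (real \<times> real) set" where
  "rays \<beta> = {pol t \<theta> | t \<theta>. 0 \<le> t \<and> \<theta> \<in> {0, \<beta>}}"

lemma raysI: "0 \<le> t \<Longrightarrow> \<theta> = 0 \<or> \<theta> = \<beta> \<Longrightarrow> pol t \<theta> \<in> rays \<beta>"
  unfolding rays_def by blast

lemma ang_zero: "ang 0 = 0"
  by (simp add: ang_def zero_complex.code[symmetric])

lemma norm_pos_if_ang_pos: "0 < ang p \<Longrightarrow> 0 < norm p"
  by (auto simp: ang_zero)

lemma wedge_iff:
  assumes "\<beta> \<le> 2 * pi"
  shows "p \<in> wedge \<beta> \<longleftrightarrow> 0 < ang p \<and> ang p < \<beta>"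
proof
  assume "p \<in> wedge \<beta>"
  then obtain \<rho> \<theta> where "p = pol \<rho> \<theta>" "\<rho> > 0" "0 < \<theta>" "\<theta> < \<beta>" by (auto simp: wedge_def pol_def)
  thus "0 < ang p \<and> ang p < \<beta>" using assms by (simp add: ang_pol)
next
  assume "0 < ang p \<and> ang p < \<beta>"
  moreover have "p = (norm p * cos (ang p), norm p * sin (ang p))"
    using pol_ang[of p] by (simp add: pol_def)
  ultimately show "p \<in> wedge \<beta>" using norm_pos_if_ang_pos[of p] unfolding wedge_def by blast
qed

lemma Dom_iff:
  assumes "\<beta> \<le> 2 * pi"
  shows "p \<in> Dom \<beta> r \<longleftrightarrow> 0 < ang p \<and> ang p < \<beta> \<and> norm p < r (ang p)"
proof
  assume "p \<in> Dom \<beta> r"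
  then obtain \<rho> \<theta> where "p = pol \<rho> \<theta>" "\<rho> > 0" "0 < \<theta>" "\<theta> < \<beta>" "\<rho> < r \<theta>"
    by (auto simp: Dom_def pol_def)
  thus "0 < ang p \<and> ang p < \<beta> \<and> norm p < r (ang p)" using assms by (simp add: ang_pol norm_pol)
next
  assume "0 < ang p \<and> ang p < \<beta> \<and> norm p < r (ang p)"
  moreover have "p = (norm p * cos (ang p), norm p * sin (ang p))"
    using pol_ang[of p] by (simp add: pol_def)
  ultimately show "p \<in> Dom \<beta> r" using norm_pos_if_ang_pos[of p] unfolding Dom_def by blast
qed

lemma open_wedge:
  assumes "\<beta> \<le> 2 * pi" shows "open (wedge \<beta>)"
proof -
  have "open (slit_plane \<inter> ang -` {..<\<beta>})"
    by (rule continuous_open_preimage[OF continuous_on_ang open_slit_plane open_lessThan])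
  moreover have "slit_plane \<inter> ang -` {..<\<beta>} = wedge \<beta>"
    by (auto simp: wedge_iff[OF assms] slit_plane_iff)
  ultimately show ?thesis by simp
qed

lemma open_Dom:
  assumes "\<beta> \<le> 2 * pi" "continuous_on {0..\<beta>} r" shows "open (Dom \<beta> r)"
proof -
  have "continuous_on (wedge \<beta>) ang"
    by (rule continuous_on_subset[OF continuous_on_ang]) (auto simp: wedge_iff[OF assms(1)] slit_plane_iff)
  hence "continuous_on (wedge \<beta>) (\<lambda>p. r (ang p))"
    by (rule continuous_on_compose2[OF assms(2)]) (auto simp: wedge_iff[OF assms(1)])
  hence "continuous_on (wedge \<beta>) (\<lambda>p. r (ang p) - norm p)" by (intro continuous_intros)
  from continuous_open_preimage[OF this open_wedge[OF assms(1)] open_greaterThan[of 0]]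
  moreover have "wedge \<beta> \<inter> (\<lambda>p. r (ang p) - norm p) -` {0<..} = Dom \<beta> r"
    by (auto simp: Dom_iff[OF assms(1)] wedge_iff[OF assms(1)])
  ultimately show ?thesis by simp
qed

text \<open>The sector is the projection of a closed set along a compact range of angles. Describing
  it by the existence of an angle, and not by \<open>ang\<close>, avoids the jump of
  \<open>ang\<close> at the cut.\<close>

lemma closed_sector: "closed {p. \<exists>\<theta>. \<theta> \<in> {a..b} \<and> p = pol (norm p) \<theta>}"
proof -
  have "closed {x. snd x = pol (norm (snd x)) (fst x)}"
    unfolding pol_def by (intro closed_Collect_eq continuous_intros)
  from closed_compact_projection[OF compact_Icc[of a b] this] show ?thesis by simp
qed

lemma pol_tendsto: "x \<longlonglongrightarrow> \<theta> \<Longrightarrow> (\<lambda>n. pol t (x n)) \<longlonglongrightarrow> pol t \<theta>"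
  unfolding pol_def by (intro tendsto_intros)

lemma frontier_wedge:
  assumes b: "0 < \<beta>" "\<beta> \<le> 2 * pi"
  shows "frontier (wedge \<beta>) = rays \<beta>"
proof -
  note W = wedge_iff[OF b(2)]
  have "closure (wedge \<beta>) \<subseteq> {p. \<exists>\<theta>. \<theta> \<in> {0..\<beta>} \<and> p = pol (norm p) \<theta>}"
  proof (rule closure_minimal[OF _ closed_sector], rule subsetI, rule CollectI)
    fix p assume "p \<in> wedge \<beta>"
    thus "\<exists>\<theta>. \<theta> \<in> {0..\<beta>} \<and> p = pol (norm p) \<theta>"
      by (intro exI[of _ "ang p"]) (auto simp: pol_ang W)
  qed
  moreover have "p \<in> rays \<beta>" if "\<theta> \<in> {0..\<beta>}" "p = pol (norm p) \<theta>" "p \<notin> wedge \<beta>" for p \<theta>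
  proof -
    have "norm p = 0 \<or> \<theta> = 0 \<or> \<theta> = \<beta>"
    proof (rule ccontr)
      assume "\<not> (norm p = 0 \<or> \<theta> = 0 \<or> \<theta> = \<beta>)"
      hence "norm p > 0" "0 < \<theta>" "\<theta> < \<beta>" using that(1) by auto
      hence "ang p = \<theta>" using b that(2) ang_pol[of "norm p" \<theta>] by auto
      thus False using that(3) \<open>0 < \<theta>\<close> \<open>\<theta> < \<beta>\<close> by (simp add: W)
    qed
    thus ?thesis
    proof (elim disjE)
      assume "norm p = 0"
      hence "p = pol 0 0" by (simp add: pol_def zero_prod_def)
      thus ?thesis unfolding rays_def by blast
    qed (use that(2) raysI[of "norm p" \<theta> \<beta>] in auto)
  qed
  moreover have "p \<in> closure (wedge \<beta>)" "p \<notin> wedge \<beta>" if pr: "p \<in> rays \<beta>" for p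
  proof -
    obtain t \<theta> where t: "p = pol t \<theta>" "t \<ge> 0" "\<theta> = 0 \<or> \<theta> = \<beta>" using pr by (auto simp: rays_def)
    have pos: "p' \<in> closure (wedge \<beta>)" if t': "p' = pol s \<theta>" "s > 0" for p' s
    proof -
      \<comment> \<open>Angles inside the wedge that tend to the boundary angle; the denominator
        starts at 2 so that they stay strictly between 0 and \<open>\<beta>\<close>.\<close>
      define x where "x n = (if \<theta> = 0 then \<beta> / (real n + 2) else \<beta> - \<beta> / (real n + 2))" for n
      have "(\<lambda>n. \<beta> / real (n + 2)) \<longlonglongrightarrow> 0"
        by (rule LIMSEQ_ignore_initial_segment[OF lim_const_over_n])
      hence lim: "(\<lambda>n. \<beta> / (real n + 2)) \<longlonglongrightarrow> 0" by (simp add: add.commute)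
      have "x \<longlonglongrightarrow> \<theta>"
      proof (cases "\<theta> = 0")
        case True thus ?thesis using lim by (simp add: x_def[abs_def])
      next
        case False
        with t(3) have "\<theta> = \<beta>" by simp
        thus ?thesis using tendsto_diff[OF tendsto_const[of \<beta>] lim] False by (simp add: x_def[abs_def])
      qed
      hence "(\<lambda>n. pol s (x n)) \<longlonglongrightarrow> p'" unfolding t'(1) by (rule pol_tendsto)
      moreover have "pol s (x n) \<in> wedge \<beta>" for n
      proof -
        have "0 < \<beta> / (real n + 2)" "\<beta> / (real n + 2) < \<beta>" using b by (auto simp: field_simps add_pos_nonneg)
        hence "0 < x n" "x n < \<beta>" by (auto simp: x_def)
        thus ?thesis using b t'(2) by (simp add: W ang_pol)
      qed
      ultimately show ?thesis unfolding closure_sequential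
        by (intro exI[of _ "\<lambda>n. pol s (x n)"] conjI allI)
    qed
    show "p \<in> closure (wedge \<beta>)"
    proof (cases "t = 0")
      case False thus ?thesis using pos[OF t(1)] t(2) by simp
    next
      case True
      have "(\<lambda>n. pol (inverse (real (Suc n))) \<theta>) \<longlonglongrightarrow> pol 0 \<theta>"
        unfolding pol_def by (intro tendsto_intros LIMSEQ_inverse_real_of_nat)
      moreover have "pol (inverse (real (Suc n))) \<theta> \<in> closure (wedge \<beta>)" for n by (rule pos) auto
      ultimately show ?thesis unfolding t(1) True
        by (intro closed_sequentially[OF closed_closure, where l = "pol 0 \<theta>"])
    qed
    show "p \<notin> wedge \<beta>"
    \<comment> \<open>At the origin and on a ray of angle \<open>2 * pi\<close> the value of
      \<open>ang\<close> is 0 and need not be the given angle, so these cases are separated.\<close>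
    proof (cases "t = 0 \<or> \<theta> = 2 * pi")
      case True
      hence "ang p = 0" 
      proof
        assume "t = 0" thus ?thesis using t(1) ang_zero by (simp add: pol_def zero_prod_def)
      next
        assume *: "\<theta> = 2 * pi"
        show ?thesis
        proof (cases "t = 0")
          case True thus ?thesis using t(1) ang_zero by (simp add: pol_def zero_prod_def)
        next
          case False
          have "p = pol t 0" using t(1) * by (simp add: pol_def)
          thus ?thesis using ang_pol[of t 0] t(2) False by simp
        qed
      qed
      thus ?thesis by (simp add: W)
    next
      case False
      hence "ang p = \<theta>" using t b by (auto intro!: ang_pol)
      thus ?thesis using t(3) by (auto simp: W)
    qed
  qed
  ultimately show ?thesis unfolding frontier_def using interior_open[OF open_wedge[OF b(2)]] by blast
qed

lemma closed_rays: "0 < \<beta> \<Longrightarrow> \<beta> \<le> 2 * pi \<Longrightarrow> closed (rays \<beta>)"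
  using frontier_wedge frontier_closed by metis

lemma zero_in_rays: "0 \<in> rays \<beta>"
  unfolding rays_def by (auto simp: pol_def zero_prod_def intro!: exI[of _ 0])

lemma rays_ne: "rays \<beta> \<noteq> {}"
  using zero_in_rays by blast

lemma Gamma0_subset_rays: "Gamma0 \<beta> r \<subseteq> rays \<beta>"
proof -
  have "(t, 0) = pol t 0" "(t * cos \<beta>, t * sin \<beta>) = pol t \<beta>" for t by (simp_all add: pol_def)
  thus ?thesis unfolding Gamma0_def rays_def by auto
qed

lemma Gamma0_iff:
  assumes "p \<in> rays \<beta>" "norm p \<le> r 0" "norm p \<le> r \<beta>"
  shows "p \<in> Gamma0 \<beta> r"
proof -
  obtain t \<theta> where "p = pol t \<theta>" "t \<ge> 0" "\<theta> = 0 \<or> \<theta> = \<beta>" using assms(1) by (auto simp: rays_def)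
  moreover from this have "t \<le> r 0" "t \<le> r \<beta>" using assms(2,3) by (auto simp: norm_pol)
  ultimately show ?thesis unfolding Gamma0_def pol_def by auto
qed

text \<open>A nearest point on the rays stays on them after dilation, which gives one inequality for
  every factor; the factors \<open>\<rho>\<close> and \<open>1 / \<rho>\<close> together give
  equality.\<close>

lemma infdist_pol_scale:
  assumes b: "0 < \<beta>" "\<beta> \<le> 2 * pi" and "\<rho> > 0"
  shows "infdist (pol \<rho> \<theta>) (rays \<beta>) = \<rho> * infdist (pol 1 \<theta>) (rays \<beta>)"
proof -
  have le: "infdist (pol (c * s) \<theta>) (rays \<beta>) \<le> c * infdist (pol s \<theta>) (rays \<beta>)" if "c > 0" for c s
  proof -
    obtain p where p: "p \<in> rays \<beta>" "infdist (pol s \<theta>) (rays \<beta>) = dist (pol s \<theta>) p"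
      using infdist_attains_inf[OF closed_rays[OF b] rays_ne] by blast
    obtain t \<phi> where t: "p = pol t \<phi>" "t \<ge> 0" "\<phi> \<in> {0, \<beta>}" using p(1) by (auto simp: rays_def)
    have sc: "pol (c * x) \<phi> = c *\<^sub>R pol x \<phi>" for x \<phi> by (simp add: pol_def)
    have "pol (c * t) \<phi> \<in> rays \<beta>" unfolding rays_def using t that by force
    hence "infdist (pol (c * s) \<theta>) (rays \<beta>) \<le> dist (pol (c * s) \<theta>) (pol (c * t) \<phi>)" by (rule infdist_le)
    also have "\<dots> = c * dist (pol s \<theta>) p" unfolding sc t(1) dist_norm scaleR_diff_right[symmetric] using that by simp
    finally show ?thesis using p(2) by simp
  qed
  show ?thesis using le[of \<rho> 1] le[of "1 / \<rho>" \<rho>] \<open>\<rho> > 0\<close> by (simp add: field_simps)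
qed

text \<open>The reflection in the bisector of the wedge is an isometry exchanging the two rays. It
  is an involution, so one inequality suffices.\<close>

lemma infdist_pol_reflect:
  assumes b: "0 < \<beta>" "\<beta> \<le> 2 * pi"
  shows "infdist (pol s (\<beta> - \<theta>)) (rays \<beta>) = infdist (pol s \<theta>) (rays \<beta>)"
proof -
  have le: "infdist (pol s (\<beta> - \<theta>)) (rays \<beta>) \<le> infdist (pol s \<theta>) (rays \<beta>)" for \<theta>
  proof -
    obtain p where p: "p \<in> rays \<beta>" "infdist (pol s \<theta>) (rays \<beta>) = dist (pol s \<theta>) p"
      using infdist_attains_inf[OF closed_rays[OF b] rays_ne] by blast
    obtain t \<phi> where t: "p = pol t \<phi>" "t \<ge> 0" "\<phi> \<in> {0, \<beta>}" using p(1) by (auto simp: rays_def)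
    \<comment> \<open>The reflection in the line of angle \<open>\<beta> / 2\<close>, as a matrix;
      it sends angle \<open>y\<close> to \<open>\<beta> - y\<close>.\<close>
    define R where "R q = (cos \<beta> * fst q + sin \<beta> * snd q, sin \<beta> * fst q - cos \<beta> * snd q)" for q :: "real \<times> real"
    have Rp: "R (pol x y) = pol x (\<beta> - y)" for x y
      by (simp add: R_def pol_def cos_diff sin_diff algebra_simps)
    have Rn: "norm (R q) = norm q" for q
      using Rp[of "norm q" "ang q"] norm_pol[of "norm q" "\<beta> - ang q"] by (simp add: pol_ang)
    have Rd: "R x - R y = R (x - y)" for x y by (simp add: R_def algebra_simps)
    have "pol t (\<beta> - \<phi>) \<in> rays \<beta>" unfolding rays_def using t by force
    hence "infdist (pol s (\<beta> - \<theta>)) (rays \<beta>) \<le> dist (pol s (\<beta> - \<theta>)) (pol t (\<beta> - \<phi>))" by (rule infdist_le)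
    also have "\<dots> = dist (pol s \<theta>) p" unfolding t(1) Rp[symmetric] dist_norm Rd Rn ..
    finally show ?thesis using p(2) by simp
  qed
  show ?thesis using le[of \<theta>] le[of "\<beta> - \<theta>"] by simp
qed

lemma infdist_pol_bounds:
  assumes b: "0 < \<beta>" "\<beta> \<le> 2 * pi" and \<theta>: "0 < \<theta>" "\<theta> < \<beta>"
  shows "0 < infdist (pol 1 \<theta>) (rays \<beta>)" "infdist (pol 1 \<theta>) (rays \<beta>) \<le> 1"
proof -
  have "pol 1 \<theta> \<in> wedge \<beta>" using assms by (simp add: wedge_iff ang_pol)
  hence "pol 1 \<theta> \<notin> rays \<beta>"
    unfolding frontier_wedge[OF b, symmetric] frontier_def interior_open[OF open_wedge[OF b(2)]] by blast
  hence "infdist (pol 1 \<theta>) (rays \<beta>) \<noteq> 0"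
    using in_closed_iff_infdist_zero[OF closed_rays[OF b] rays_ne] by blast
  thus "0 < infdist (pol 1 \<theta>) (rays \<beta>)" using infdist_nonneg[of "pol 1 \<theta>" "rays \<beta>"] by linarith
  show "infdist (pol 1 \<theta>) (rays \<beta>) \<le> 1"
    using infdist_le[OF zero_in_rays, of "pol 1 \<theta>"] by (simp add: norm_pol)
qed

text \<open>By homogeneity the potential of the wedge at \<open>pol \<rho> \<theta>\<close> is
  \<open>ang_pot \<beta> \<theta>\<close> divided by the square of \<open>\<rho>\<close>.\<close>

definition ang_pot :: "real \<Rightarrow> real \<Rightarrow> real" where
  "ang_pot \<beta> \<theta> = 1 / (infdist (pol 1 \<theta>) (rays \<beta>))\<^sup>2"

lemma ang_pot_measurable[measurable]: "ang_pot \<beta> \<in> borel_measurable borel"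
proof -
  have "(\<lambda>\<theta>. infdist (pol 1 \<theta>) (rays \<beta>)) \<in> borel_measurable borel"
    unfolding pol_def by (intro borel_measurable_continuous_onI continuous_on_infdist continuous_intros)
  thus ?thesis unfolding ang_pot_def[abs_def] by simp
qed

lemma ang_pot_nonneg: "0 \<le> ang_pot \<beta> \<theta>"
  by (simp add: ang_pot_def)

lemma ang_pot_ge_1:
  assumes "0 < \<beta>" "\<beta> \<le> 2 * pi" "0 < \<theta>" "\<theta> < \<beta>" shows "1 \<le> ang_pot \<beta> \<theta>"
  using infdist_pol_bounds[OF assms] by (simp add: ang_pot_def power_le_one)

lemma ang_pot_reflect: "0 < \<beta> \<Longrightarrow> \<beta> \<le> 2 * pi \<Longrightarrow> ang_pot \<beta> (\<beta> - \<theta>) = ang_pot \<beta> \<theta>"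
  by (simp add: ang_pot_def infdist_pol_reflect)

section \<open>From the wedge to the angular variable\<close>

text \<open>Names membership in the set whose supremum is \<open>hardy_const\<close>. The argument
  works with one such \<open>c\<close> at a time, so it does not have to be known that the supremum
  is attained.\<close>

definition wedge_hardy :: "real \<Rightarrow> real \<Rightarrow> bool" where
  "wedge_hardy \<beta> c \<longleftrightarrow> c \<ge> 0 \<and> (\<forall>u \<in> Cc_infty (wedge \<beta>).
      (\<integral>\<^sup>+ x \<in> wedge \<beta>. ennreal (grad_sq u x) \<partial>lborel) \<ge>
      ennreal c * (\<integral>\<^sup>+ x \<in> wedge \<beta>. ennreal ((u x)\<^sup>2 / (infdist x (frontier (wedge \<beta>)))\<^sup>2) \<partial>lborel))"

lemma hardy_const_eq: "hardy_const \<beta> = Sup {c. wedge_hardy \<beta> c}"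
  unfolding hardy_const_def wedge_hardy_def ..

lemma nn_integral_polar_set:
  fixes g :: "real \<times> real \<Rightarrow> ennreal"
  assumes [measurable]: "A \<in> sets borel" "g \<in> borel_measurable borel"
    and B: "\<And>\<rho>. B \<rho> \<subseteq> {0<..<2 * pi}"
    and AB: "\<And>\<rho> \<theta>. 0 < \<rho> \<Longrightarrow> 0 < \<theta> \<Longrightarrow> \<theta> < 2 * pi \<Longrightarrow> pol \<rho> \<theta> \<in> A \<longleftrightarrow> \<theta> \<in> B \<rho>"
  shows "(\<integral>\<^sup>+ x\<in>A. g x \<partial>lborel) =
    (\<integral>\<^sup>+ \<rho>\<in>{0<..}. (\<integral>\<^sup>+ \<theta>\<in>B \<rho>. ennreal \<rho> * g (pol \<rho> \<theta>) \<partial>lborel) \<partial>lborel)"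
proof -
  have "(\<integral>\<^sup>+ x\<in>A. g x \<partial>lborel) = (\<integral>\<^sup>+ \<rho>\<in>{0<..}. (\<integral>\<^sup>+ \<theta>\<in>{0<..<2 * pi}.
      ennreal \<rho> * (g (pol \<rho> \<theta>) * indicator A (pol \<rho> \<theta>)) \<partial>lborel) \<partial>lborel)"
    by (rule nn_integral_polar) simp
  also have "\<dots> = (\<integral>\<^sup>+ \<rho>\<in>{0<..}. (\<integral>\<^sup>+ \<theta>\<in>B \<rho>. ennreal \<rho> * g (pol \<rho> \<theta>) \<partial>lborel) \<partial>lborel)"
  proof (rule nn_integral_cong)
    fix \<rho> :: real
    show "(\<integral>\<^sup>+ \<theta>\<in>{0<..<2 * pi}. ennreal \<rho> * (g (pol \<rho> \<theta>) * indicator A (pol \<rho> \<theta>)) \<partial>lborel) * indicator {0<..} \<rho>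
      = (\<integral>\<^sup>+ \<theta>\<in>B \<rho>. ennreal \<rho> * g (pol \<rho> \<theta>) \<partial>lborel) * indicator {0<..} \<rho>"
    proof (cases "\<rho> > 0")
      case True
      have "(\<integral>\<^sup>+ \<theta>\<in>{0<..<2 * pi}. ennreal \<rho> * (g (pol \<rho> \<theta>) * indicator A (pol \<rho> \<theta>)) \<partial>lborel)
        = (\<integral>\<^sup>+ \<theta>\<in>B \<rho>. ennreal \<rho> * g (pol \<rho> \<theta>) \<partial>lborel)"
      proof (rule nn_integral_cong)
        fix \<theta> :: real
        show "ennreal \<rho> * (g (pol \<rho> \<theta>) * indicator A (pol \<rho> \<theta>)) * indicator {0<..<2 * pi} \<theta>
            = ennreal \<rho> * g (pol \<rho> \<theta>) * indicator (B \<rho>) \<theta>"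
          using AB[OF True, of \<theta>] B[of \<rho>] by (cases "\<theta> \<in> {0<..<2 * pi}") (auto simp: indicator_def)
      qed
      thus ?thesis by simp
    qed simp
  qed
  finally show ?thesis .
qed

lemma nn_integral_Dom:
  fixes g :: "real \<times> real \<Rightarrow> ennreal"
  assumes b: "\<beta> \<le> 2 * pi" and r: "continuous_on {0..\<beta>} r" and g: "g \<in> borel_measurable borel"
  shows "(\<integral>\<^sup>+ x\<in>Dom \<beta> r. g x \<partial>lborel) =
    (\<integral>\<^sup>+ \<rho>\<in>{0<..}. (\<integral>\<^sup>+ \<theta>\<in>{\<theta>. 0 < \<theta> \<and> \<theta> < \<beta> \<and> \<rho> < r \<theta>}. ennreal \<rho> * g (pol \<rho> \<theta>) \<partial>lborel) \<partial>lborel)"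
  by (rule nn_integral_polar_set[OF _ g]) (use b open_Dom[OF b r] in \<open>auto simp: Dom_iff ang_pol norm_pol\<close>)

lemma nn_integral_wedge:
  fixes g :: "real \<times> real \<Rightarrow> ennreal"
  assumes b: "\<beta> \<le> 2 * pi" and g: "g \<in> borel_measurable borel"
  shows "(\<integral>\<^sup>+ x\<in>wedge \<beta>. g x \<partial>lborel) =
    (\<integral>\<^sup>+ \<rho>\<in>{0<..}. (\<integral>\<^sup>+ \<theta>\<in>{0<..<\<beta>}. ennreal \<rho> * g (pol \<rho> \<theta>) \<partial>lborel) \<partial>lborel)"
  by (rule nn_integral_polar_set[OF _ g]) (use b open_wedge[OF b] in \<open>auto simp: wedge_iff ang_pol\<close>)

lemma ck2_subset: "T \<subseteq> S \<Longrightarrow> ck2 S n f \<Longrightarrow> ck2 T n f"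
proof (induction n arbitrary: f)
  case (Suc n)
  obtain f1 f2 where f: "\<And>x. x \<in> S \<Longrightarrow> (f has_derivative (\<lambda>h. fst h * f1 x + snd h * f2 x)) (at x)"
    "ck2 S n f1" "ck2 S n f2" using Suc.prems(2) by (rule ck2_SucE) blast
  show ?case
    by (rule ck2_SucI[OF f(1) Suc.IH[OF Suc.prems(1) f(2)] Suc.IH[OF Suc.prems(1) f(3)]])
       (use Suc.prems(1) in blast)
qed simp

lemma wedge_subset_slit_plane: "\<beta> \<le> 2 * pi \<Longrightarrow> wedge \<beta> \<subseteq> slit_plane"
  by (auto simp: wedge_iff slit_plane_iff)

section \<open>Separated test functions on the wedge\<close>

definition separated :: "real \<Rightarrow> (real \<Rightarrow> real) \<Rightarrow> (real \<Rightarrow> real) \<Rightarrow> real \<times> real \<Rightarrow> real" where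
  "separated \<beta> f w p = (if p \<in> wedge \<beta> then f (log_rad p) * w (ang p) else 0)"

text \<open>The support lies in the image of a compact rectangle under the map from logarithmic
  radius and angle to the plane. Only the values of \<open>w\<close> inside the wedge matter, since
  \<open>separated\<close> is cut off outside.\<close>

lemma separated_in_Cc_infty:
  assumes b: "0 < \<beta>" "\<beta> \<le> 2 * pi" and f: "smooth1 f" and w: "smooth1 w"
    and f0: "\<And>t. t \<notin> {a..b} \<Longrightarrow> f t = 0"
    and d: "0 < \<delta>" and w0: "\<And>\<theta>. \<theta> \<in> {0<..<\<beta>} \<Longrightarrow> \<theta> \<notin> {\<delta>..\<beta> - \<delta>} \<Longrightarrow> w \<theta> = 0"
  shows "separated \<beta> f w \<in> Cc_infty (wedge \<beta>)"
proof -
  define K where "K = (\<lambda>x. pol (exp (fst x)) (snd x)) ` ({a..b} \<times> {\<delta>..\<beta> - \<delta>})"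
  have K: "compact K" unfolding K_def pol_def
    by (intro compact_continuous_image compact_Times compact_Icc continuous_intros)
  have KW: "K \<subseteq> wedge \<beta>" using b d by (auto simp: K_def wedge_iff ang_pol)
  have u0: "separated \<beta> f w p = 0" if "p \<notin> K" for p
  proof (rule ccontr)
    assume nz: "separated \<beta> f w p \<noteq> 0"
    hence p: "p \<in> wedge \<beta>" "f (log_rad p) \<noteq> 0" "w (ang p) \<noteq> 0" by (auto simp: separated_def split: if_splits)
    have A: "0 < ang p" "ang p < \<beta>" using p(1) b by (auto simp: wedge_iff)
    have n: "norm p > 0" using A norm_pos_if_ang_pos by simp
    have "log_rad p = ln (norm p)" using log_rad_pol[OF n, of "ang p"] by (simp add: pol_ang)
    hence "p = pol (exp (log_rad p)) (ang p)" using n by (simp add: pol_ang)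
    moreover have "log_rad p \<in> {a..b}" "ang p \<in> {\<delta>..\<beta> - \<delta>}" using p f0 w0 A by force+
    ultimately have "p \<in> K" unfolding K_def by (intro image_eqI[of _ _ "(log_rad p, ang p)"]) auto
    thus False using that by blast
  qed
  have "smooth_R2 (separated \<beta> f w)"
  proof (rule smooth_R2_zero_extend[OF open_wedge[OF b(2)] compact_imp_closed[OF K] KW _ u0])
    fix n
    have "ck2 slit_plane n (\<lambda>p. f (log_rad p) * w (ang p))"
      using f w by (intro ck2_mult[OF ck2_compose[OF _ ck2_log_rad] ck2_compose[OF _ ck2_ang]])
        (auto simp: smooth1_def)
    from ck2_subset[OF wedge_subset_slit_plane[OF b(2)] this]
    show "ck2 (wedge \<beta>) n (separated \<beta> f w)"
      by (rule ck2_cong[OF open_wedge[OF b(2)], rotated]) (simp add: separated_def)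
  qed
  thus ?thesis using K KW u0 unfolding Cc_infty_def by blast
qed

text \<open>The gradients of \<open>log_rad\<close> and \<open>ang\<close> are orthogonal and both
  have length \<open>1 / \<rho>\<close>, so the mixed terms cancel.\<close>

lemma grad_sq_separated:
  assumes b: "\<beta> \<le> 2 * pi" and \<rho>: "\<rho> > 0" and \<theta>: "0 < \<theta>" "\<theta> < \<beta>"
    and f: "\<And>x. (f has_real_derivative f' x) (at x)" and w: "\<And>x. (w has_real_derivative w' x) (at x)"
  shows "grad_sq (separated \<beta> f w) (pol \<rho> \<theta>)
    = ((f' (ln \<rho>))\<^sup>2 * (w \<theta>)\<^sup>2 + (f (ln \<rho>))\<^sup>2 * (w' \<theta>)\<^sup>2) / \<rho>\<^sup>2"
proof -
  let ?p = "pol \<rho> \<theta>"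
  define x y q where "x = \<rho> * cos \<theta>" and "y = \<rho> * sin \<theta>" and "q = inverse (\<rho>\<^sup>2)"
  have xy: "fst ?p = x" "snd ?p = y" by (simp_all add: pol_def x_def y_def)
  have "x\<^sup>2 + y\<^sup>2 = \<rho>\<^sup>2 * ((cos \<theta>)\<^sup>2 + (sin \<theta>)\<^sup>2)"
    by (simp add: x_def y_def power_mult_distrib distrib_left del: sin_cos_squared_add sin_cos_squared_add2)
  hence r2: "x\<^sup>2 + y\<^sup>2 = \<rho>\<^sup>2" by simp
  have a: "ang ?p = \<theta>" using assms by (simp add: ang_pol)
  have l: "log_rad ?p = ln \<rho>" using assms by (simp add: log_rad_pol)
  have pW: "?p \<in> wedge \<beta>" using assms a by (simp add: wedge_iff)
  have pS: "?p \<in> slit_plane" using wedge_subset_slit_plane[OF b] pW by blast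
  define F1 F0 W1 W0 where "F1 = f' (ln \<rho>)" and "F0 = f (ln \<rho>)" and "W1 = w' \<theta>" and "W0 = w \<theta>"
  have 1: "((\<lambda>p. f (log_rad p)) has_derivative (\<lambda>h. F1 * (fst h * (x * q) + snd h * (y * q)))) (at ?p)"
    using has_derivative_compose[OF has_derivative_log_rad[OF pS] f[unfolded has_field_derivative_def]]
    unfolding xy r2 l F1_def q_def .
  have 2: "((\<lambda>p. w (ang p)) has_derivative (\<lambda>h. W1 * (fst h * (- (y * q)) + snd h * (x * q)))) (at ?p)"
    using has_derivative_compose[OF has_derivative_ang[OF pS] w[unfolded has_field_derivative_def]]
    unfolding xy r2 a W1_def q_def .
  have "((\<lambda>p. f (log_rad p) * w (ang p)) has_derivative
      (\<lambda>h. fst h * (F1 * x * q * W0 - F0 * W1 * y * q) + snd h * (F1 * y * q * W0 + F0 * W1 * x * q))) (at ?p)"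
    by (rule has_derivative_eq_rhs[OF has_derivative_mult[OF 1 2]])
       (simp add: fun_eq_iff a l F0_def W0_def algebra_simps)
  hence "(separated \<beta> f w has_derivative
      (\<lambda>h. fst h * (F1 * x * q * W0 - F0 * W1 * y * q) + snd h * (F1 * y * q * W0 + F0 * W1 * x * q))) (at ?p)"
    by (rule has_derivative_transform_within_open[OF _ open_wedge[OF b] pW]) (simp add: separated_def)
  from grad_sq_eq[OF this] have "grad_sq (separated \<beta> f w) ?p
      = (F1\<^sup>2 * W0\<^sup>2 + F0\<^sup>2 * W1\<^sup>2) * (q * (q * (x\<^sup>2 + y\<^sup>2)))"
    by (simp add: power2_eq_square algebra_simps)
  also have "q * (q * (x\<^sup>2 + y\<^sup>2)) = inverse (\<rho>\<^sup>2)" unfolding r2 q_def using \<rho> by simp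
  finally show ?thesis unfolding F1_def F0_def W1_def W0_def by (simp add: divide_inverse)
qed

text \<open>Gradient square and potential both carry the inverse square of \<open>\<rho>\<close>;
  against the area weight \<open>\<rho>\<close> this leaves d(rho) / rho, the measure of ln(rho),
  and the integrals factor. \<open>A\<close> and \<open>B\<close> are the integrals of the squares
  of \<open>f\<close> and \<open>f'\<close> in the logarithmic variable.\<close>

lemma separated_hardy:
  assumes b: "0 < \<beta>" "\<beta> \<le> 2 * pi" and c: "wedge_hardy \<beta> c"
    and f: "\<And>x. (f has_real_derivative f' x) (at x)" "smooth1 f'" and w: "\<And>x. (w has_real_derivative w' x) (at x)" "smooth1 w'"
    and f0: "\<And>t. t \<notin> {a..b} \<Longrightarrow> f t = 0"
    and d: "0 < \<delta>" and w0: "\<And>\<theta>. \<theta> \<in> {0<..<\<beta>} \<Longrightarrow> \<theta> \<notin> {\<delta>..\<beta> - \<delta>} \<Longrightarrow> w \<theta> = 0"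
  defines "A \<equiv> \<integral>\<^sup>+ \<rho>\<in>{0<..}. ennreal ((f (ln \<rho>))\<^sup>2 / \<rho>) \<partial>lborel"
    and "B \<equiv> \<integral>\<^sup>+ \<rho>\<in>{0<..}. ennreal ((f' (ln \<rho>))\<^sup>2 / \<rho>) \<partial>lborel"
  shows "ennreal c * (A * (\<integral>\<^sup>+ \<theta>\<in>{0<..<\<beta>}. ennreal (ang_pot \<beta> \<theta> * (w \<theta>)\<^sup>2) \<partial>lborel))
    \<le> B * (\<integral>\<^sup>+ \<theta>\<in>{0<..<\<beta>}. ennreal ((w \<theta>)\<^sup>2) \<partial>lborel) + A * (\<integral>\<^sup>+ \<theta>\<in>{0<..<\<beta>}. ennreal ((w' \<theta>)\<^sup>2) \<partial>lborel)"
    (is "_ * (_ * ?V) \<le> _ * ?E + _ * ?D")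
proof -
  let ?u = "separated \<beta> f w"
  let ?q = "\<lambda>x. (?u x)\<^sup>2 / (infdist x (frontier (wedge \<beta>)))\<^sup>2"
  have sf: "smooth1 f" and sw: "smooth1 w" using smooth1_antideriv f w by blast+
  note [measurable] = smooth1_measurable[OF sf] smooth1_measurable[OF sw] smooth1_measurable[OF f(2)] smooth1_measurable[OF w(2)]
  have u: "?u \<in> Cc_infty (wedge \<beta>)" by (rule separated_in_Cc_infty[OF b sf sw f0 d w0])
  hence su: "smooth_R2 ?u" by (simp add: Cc_infty_def)
  have mg: "(\<lambda>x. ennreal (grad_sq ?u x)) \<in> borel_measurable borel" using grad_sq_measurable[OF su] by simp
  have mv: "(\<lambda>x. ennreal (?q x)) \<in> borel_measurable borel"
  proof -
    have [measurable]: "?u \<in> borel_measurable borel" 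
      by (rule borel_measurable_continuous_onI[OF smooth_R2_continuous[OF su]])
    have [measurable]: "(\<lambda>x. infdist x (frontier (wedge \<beta>))) \<in> borel_measurable borel"
      by (intro borel_measurable_continuous_onI continuous_on_infdist continuous_intros)
    show ?thesis by simp
  qed
  have up: "?u (pol \<rho> \<theta>) = f (ln \<rho>) * w \<theta>" if "\<rho> > 0" "0 < \<theta>" "\<theta> < \<beta>" for \<rho> \<theta>
    using that b by (simp add: separated_def wedge_iff ang_pol log_rad_pol)
  have "(\<integral>\<^sup>+ x\<in>wedge \<beta>. ennreal (?q x) \<partial>lborel)
      = (\<integral>\<^sup>+ \<rho>. ennreal ((f (ln \<rho>))\<^sup>2 / \<rho>) * indicator {0<..} \<rho> * ?V \<partial>lborel)"
    unfolding nn_integral_wedge[OF b(2) mv]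
  proof (rule nn_integral_cong)
    fix \<rho> :: real
    show "(\<integral>\<^sup>+ \<theta>\<in>{0<..<\<beta>}. ennreal \<rho> * ennreal (?q (pol \<rho> \<theta>)) \<partial>lborel) * indicator {0<..} \<rho>
      = ennreal ((f (ln \<rho>))\<^sup>2 / \<rho>) * indicator {0<..} \<rho> * ?V"
    proof (cases "\<rho> > 0")
      case True
      have "(\<integral>\<^sup>+ \<theta>\<in>{0<..<\<beta>}. ennreal \<rho> * ennreal (?q (pol \<rho> \<theta>)) \<partial>lborel)
        = (\<integral>\<^sup>+ \<theta>. ennreal ((f (ln \<rho>))\<^sup>2 / \<rho>) * (ennreal (ang_pot \<beta> \<theta> * (w \<theta>)\<^sup>2) * indicator {0<..<\<beta>} \<theta>) \<partial>lborel)"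
      proof (rule nn_integral_cong)
        fix \<theta> :: real
        have "\<rho> * (?q (pol \<rho> \<theta>))
            = (f (ln \<rho>))\<^sup>2 / \<rho> * (ang_pot \<beta> \<theta> * (w \<theta>)\<^sup>2)" if "0 < \<theta>" "\<theta> < \<beta>"
          unfolding up[OF True that] frontier_wedge[OF b] infdist_pol_scale[OF b True] ang_pot_def
          using True infdist_pol_bounds(1)[OF b that] by (simp add: field_simps power2_eq_square)
        thus "ennreal \<rho> * ennreal (?q (pol \<rho> \<theta>)) * indicator {0<..<\<beta>} \<theta>
          = ennreal ((f (ln \<rho>))\<^sup>2 / \<rho>) * (ennreal (ang_pot \<beta> \<theta> * (w \<theta>)\<^sup>2) * indicator {0<..<\<beta>} \<theta>)"
          using True by (auto simp: indicator_def ennreal_mult[symmetric] ang_pot_nonneg)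
      qed
      also have "\<dots> = ennreal ((f (ln \<rho>))\<^sup>2 / \<rho>) * ?V" by (rule nn_integral_cmult) simp
      finally show ?thesis using True by simp
    qed simp
  qed
  also have "\<dots> = A * ?V" unfolding A_def by (rule nn_integral_multc) simp
  finally have lhs: "(\<integral>\<^sup>+ x\<in>wedge \<beta>. ennreal (?q x) \<partial>lborel) = A * ?V" .
  have "(\<integral>\<^sup>+ x\<in>wedge \<beta>. ennreal (grad_sq ?u x) \<partial>lborel)
      = (\<integral>\<^sup>+ \<rho>. (ennreal ((f' (ln \<rho>))\<^sup>2 / \<rho>) * indicator {0<..} \<rho>) * ?E
           + (ennreal ((f (ln \<rho>))\<^sup>2 / \<rho>) * indicator {0<..} \<rho>) * ?D \<partial>lborel)"
    unfolding nn_integral_wedge[OF b(2) mg]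
  proof (rule nn_integral_cong)
    fix \<rho> :: real
    show "(\<integral>\<^sup>+ \<theta>\<in>{0<..<\<beta>}. ennreal \<rho> * ennreal (grad_sq ?u (pol \<rho> \<theta>)) \<partial>lborel) * indicator {0<..} \<rho>
      = (ennreal ((f' (ln \<rho>))\<^sup>2 / \<rho>) * indicator {0<..} \<rho>) * ?E
           + (ennreal ((f (ln \<rho>))\<^sup>2 / \<rho>) * indicator {0<..} \<rho>) * ?D"
    proof (cases "\<rho> > 0")
      case True
      have "(\<integral>\<^sup>+ \<theta>\<in>{0<..<\<beta>}. ennreal \<rho> * ennreal (grad_sq ?u (pol \<rho> \<theta>)) \<partial>lborel)
        = (\<integral>\<^sup>+ \<theta>. ennreal ((f' (ln \<rho>))\<^sup>2 / \<rho>) * (ennreal ((w \<theta>)\<^sup>2) * indicator {0<..<\<beta>} \<theta>)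
            + ennreal ((f (ln \<rho>))\<^sup>2 / \<rho>) * (ennreal ((w' \<theta>)\<^sup>2) * indicator {0<..<\<beta>} \<theta>) \<partial>lborel)"
      proof (rule nn_integral_cong)
        fix \<theta> :: real
        have "\<rho> * grad_sq ?u (pol \<rho> \<theta>) = (f' (ln \<rho>))\<^sup>2 / \<rho> * (w \<theta>)\<^sup>2 + (f (ln \<rho>))\<^sup>2 / \<rho> * (w' \<theta>)\<^sup>2"
          if "0 < \<theta>" "\<theta> < \<beta>"
          unfolding grad_sq_separated[OF b(2) True that f(1) w(1)] using True
          by (simp add: power2_eq_square[of \<rho>] add_divide_distrib distrib_left)
        moreover have "grad_sq ?u (pol \<rho> \<theta>) \<ge> 0" by (simp add: grad_sq_def)
        ultimately show "ennreal \<rho> * ennreal (grad_sq ?u (pol \<rho> \<theta>)) * indicator {0<..<\<beta>} \<theta>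
          = ennreal ((f' (ln \<rho>))\<^sup>2 / \<rho>) * (ennreal ((w \<theta>)\<^sup>2) * indicator {0<..<\<beta>} \<theta>)
            + ennreal ((f (ln \<rho>))\<^sup>2 / \<rho>) * (ennreal ((w' \<theta>)\<^sup>2) * indicator {0<..<\<beta>} \<theta>)"
          using True by (auto simp: indicator_def ennreal_mult[symmetric] ennreal_plus[symmetric] simp del: ennreal_plus)
      qed
      also have "\<dots> = ennreal ((f' (ln \<rho>))\<^sup>2 / \<rho>) * ?E + ennreal ((f (ln \<rho>))\<^sup>2 / \<rho>) * ?D"
        by (subst nn_integral_add) (simp_all add: nn_integral_cmult)
      finally show ?thesis using True by simp
    qed simp
  qed
  also have "\<dots> = (\<integral>\<^sup>+ \<rho>. (ennreal ((f' (ln \<rho>))\<^sup>2 / \<rho>) * indicator {0<..} \<rho>) * ?E \<partial>lborel)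
      + (\<integral>\<^sup>+ \<rho>. (ennreal ((f (ln \<rho>))\<^sup>2 / \<rho>) * indicator {0<..} \<rho>) * ?D \<partial>lborel)"
    by (rule nn_integral_add) measurable
  also have "\<dots> = B * ?E + A * ?D" unfolding A_def B_def
    by (intro arg_cong2[of _ _ _ _ "(+)"] nn_integral_multc) measurable
  finally have rhs: "(\<integral>\<^sup>+ x\<in>wedge \<beta>. ennreal (grad_sq ?u x) \<partial>lborel) = B * ?E + A * ?D" .
  have "ennreal c * (\<integral>\<^sup>+ x\<in>wedge \<beta>. ennreal (?q x) \<partial>lborel)
      \<le> (\<integral>\<^sup>+ x\<in>wedge \<beta>. ennreal (grad_sq ?u x) \<partial>lborel)"
    using c u unfolding wedge_hardy_def by blast
  thus ?thesis unfolding lhs rhs .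
qed

lemma nn_integral_log_strip:
  assumes "a \<le> b"
  shows "(\<integral>\<^sup>+ \<rho>\<in>{0<..}. ennreal (1 / \<rho>) * indicator {a..b} (ln \<rho>) \<partial>lborel) = ennreal (b - a)"
proof -
  have "(\<integral>\<^sup>+ \<rho>\<in>{0<..}. ennreal (1 / \<rho>) * indicator {a..b} (ln \<rho>) \<partial>lborel)
      = (\<integral>\<^sup>+ \<rho>\<in>{exp a..exp b}. ennreal (1 / \<rho>) \<partial>lborel)"
  proof (rule nn_integral_cong)
    fix \<rho> :: real
    have "0 < \<rho> \<and> ln \<rho> \<in> {a..b} \<longleftrightarrow> \<rho> \<in> {exp a..exp b}"
      using ln_ge_iff[of \<rho> a] ln_le_cancel_iff[of \<rho> "exp b"] less_le_trans[OF exp_gt_zero[of a], of \<rho>] by auto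
    thus "ennreal (1 / \<rho>) * indicator {a..b} (ln \<rho>) * indicator {0<..} \<rho> = ennreal (1 / \<rho>) * indicator {exp a..exp b} \<rho>"
      by (auto simp: indicator_def)
  qed
  also have "\<dots> = ennreal (ln (exp b) - ln (exp a))"
  proof (rule nn_integral_FTC_Icc)
    fix x assume "x \<in> {exp a..exp b}"
    hence "x > 0" using less_le_trans[OF exp_gt_zero[of a]] by auto
    thus "(ln has_real_derivative 1 / x) (at x)" "0 \<le> 1 / x" by (auto intro: DERIV_ln_divide)
  qed (use assms in auto)
  finally show ?thesis by simp
qed

lemma nn_integral_square_bounded:
  assumes "0 < \<beta>" "continuous_on {0..\<beta>} w"
  obtains N where "0 \<le> N" "(\<integral>\<^sup>+ \<theta>\<in>{0<..<\<beta>}. ennreal ((w \<theta>)\<^sup>2) \<partial>lborel) \<le> ennreal (N * \<beta>)"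
proof -
  have "compact (w ` {0..\<beta>})" by (intro compact_continuous_image assms compact_Icc)
  then obtain N where N: "\<And>t. t \<in> {0..\<beta>} \<Longrightarrow> \<bar>w t\<bar> \<le> N"
    using compact_imp_bounded bounded_iff by (metis imageI real_norm_def)
  have "(\<integral>\<^sup>+ \<theta>\<in>{0<..<\<beta>}. ennreal ((w \<theta>)\<^sup>2) \<partial>lborel) \<le> (\<integral>\<^sup>+ \<theta>. ennreal (N\<^sup>2) * indicator {0<..<\<beta>} \<theta> \<partial>lborel)"
  proof (rule nn_integral_mono)
    fix \<theta> :: real
    have "(w \<theta>)\<^sup>2 \<le> N\<^sup>2" if "0 < \<theta>" "\<theta> < \<beta>"
      using power_mono[of "\<bar>w \<theta>\<bar>" N 2] N[of \<theta>] that by simp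
    thus "ennreal ((w \<theta>)\<^sup>2) * indicator {0<..<\<beta>} \<theta> \<le> ennreal (N\<^sup>2) * indicator {0<..<\<beta>} \<theta>"
      by (auto simp: indicator_def intro: ennreal_leI)
  qed
  also have "\<dots> = ennreal (N\<^sup>2 * \<beta>)" using assms(1) by (simp add: nn_integral_cmult ennreal_mult)
  finally show ?thesis by (intro that[of "N\<^sup>2"]) auto
qed

text \<open>Testing the Hardy inequality of the wedge with cutoffs that vary slowly in \<open>ln \<rho>\<close>
  makes the radial part of the energy negligible.\<close>

lemma angular_hardy:
  assumes b: "0 < \<beta>" "\<beta> \<le> 2 * pi" and c: "wedge_hardy \<beta> c"
    and w: "\<And>x. (w has_real_derivative w' x) (at x)" "smooth1 w'"
    and d: "0 < \<delta>" and w0: "\<And>\<theta>. \<theta> \<in> {0<..<\<beta>} \<Longrightarrow> \<theta> \<notin> {\<delta>..\<beta> - \<delta>} \<Longrightarrow> w \<theta> = 0"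
  shows "ennreal c * (\<integral>\<^sup>+ \<theta>\<in>{0<..<\<beta>}. ennreal (ang_pot \<beta> \<theta> * (w \<theta>)\<^sup>2) \<partial>lborel)
    \<le> (\<integral>\<^sup>+ \<theta>\<in>{0<..<\<beta>}. ennreal ((w' \<theta>)\<^sup>2) \<partial>lborel)" (is "_ * ?V \<le> ?D")
proof (rule ennreal_le_epsilon)
  fix \<epsilon> :: real assume \<epsilon>: "\<epsilon> > 0"
  let ?E = "\<integral>\<^sup>+ \<theta>\<in>{0<..<\<beta>}. ennreal ((w \<theta>)\<^sup>2) \<partial>lborel"
  \<comment> \<open>A plateau: 1 on [-1, 1] and 0 outside [-2, 2]. It is stretched by a large
    \<open>n\<close> below.\<close>
  define F where "F t = smooth_step 1 2 t * smooth_step 1 2 (- t)" for t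
  have "smooth1 (\<lambda>x. -1 * x)" by (intro smooth1_intros)
  hence "smooth1 (\<lambda>x. - x)" by simp
  hence "smooth1 F" unfolding F_def[abs_def]
    by (intro smooth1_intros smooth1_compose[of "smooth_step 1 2" uminus] smooth1_smooth_step) auto
  then obtain F' where F': "\<And>x. (F has_real_derivative F' x) (at x)" "smooth1 F'" by (rule smooth1_derivE) blast
  have F0: "F t = 0" if "t \<notin> {-2..2}" for t
    using that smooth_step_ge[of 2 t 1] smooth_step_ge[of 2 "-t" 1] by (auto simp: F_def)
  have F1: "F t = 1" if "t \<in> {-1..1}" for t using that by (simp add: F_def smooth_step_le)
  have Fle: "(F t)\<^sup>2 \<le> 1" for t
    using smooth_step_bounds[of 1 2 t] smooth_step_bounds[of 1 2 "-t"] 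
    by (simp add: F_def power_le_one mult_le_one)
  have F'0: "F' t = 0" if "t \<notin> {-2..2}" for t
  proof -
    have "(F has_real_derivative 0) (at t)"
      by (rule has_field_derivative_transform_within_open[OF DERIV_const[of 0], where S = "- {-2..2}"])
         (use that F0 in \<open>auto intro: open_Compl\<close>)
    thus ?thesis using DERIV_unique F'(1) by blast
  qed
  have "compact (F' ` {-2..2})"
    by (intro compact_continuous_image smooth1_continuous_on F'(2) compact_Icc)
  then obtain M where M: "\<And>t. t \<in> {-2..2} \<Longrightarrow> \<bar>F' t\<bar> \<le> M"
    using compact_imp_bounded bounded_iff by (metis imageI real_norm_def)
  have "0 \<le> M" using M[of 0] by simp
  hence M': "\<bar>F' t\<bar> \<le> M" for t using F'0[of t] M[of t] by (cases "t \<in> {-2..2}") auto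
  have sw: "smooth1 w" using smooth1_antideriv w by blast
  obtain N where N: "0 \<le> N" and E: "?E \<le> ennreal (N * \<beta>)"
    using nn_integral_square_bounded[OF b(1) smooth1_continuous_on[OF sw]] by blast
  \<comment> \<open>After stretching by \<open>n\<close>, the square of the derivative is at most
    that of \<open>M / n\<close> on a logarithmic length \<open>4 * n\<close>, so \<open>B\<close>
    is at most 4 times the square of \<open>M\<close> over \<open>n\<close>. Together with the bound
    on \<open>?E\<close> the radial energy is at most \<open>Q / n\<close>.\<close>
  define Q where "Q = 4 * M\<^sup>2 * (N * \<beta>)"
  have Q: "Q \<ge> 0" using b N by (simp add: Q_def)
  obtain n0 :: nat where n0: "Q / \<epsilon> \<le> real n0" using real_arch_simple by blast
  define n where "n = real (Suc n0)"
  have n: "n > 0" "n \<ge> 1" "Q / n \<le> \<epsilon>" using n0 \<epsilon> by (auto simp: n_def field_simps)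
  define f f' where "f t = F (t / n)" and "f' t = F' (t / n) * (1 / n)" for t
  have f: "(f has_real_derivative f' x) (at x)" for x
    unfolding f_def[abs_def] f'_def
    by (rule DERIV_chain2[OF F'(1)]) (use n in \<open>auto intro!: derivative_eq_intros\<close>)
  have "smooth1 (\<lambda>t. t * (1 / n))" by (intro smooth1_intros)
  hence "smooth1 (\<lambda>t. t / n)" by simp
  hence sf: "smooth1 f'" unfolding f'_def[abs_def] by (intro smooth1_intros smooth1_compose[OF F'(2)])
  have f0: "f t = 0" if "t \<notin> {- 2 * n..2 * n}" for t
    unfolding f_def using that n by (intro F0) (auto simp: field_simps)
  define A where "A = (\<integral>\<^sup>+ \<rho>\<in>{0<..}. ennreal ((f (ln \<rho>))\<^sup>2 / \<rho>) \<partial>lborel)"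
  define B where "B = (\<integral>\<^sup>+ \<rho>\<in>{0<..}. ennreal ((f' (ln \<rho>))\<^sup>2 / \<rho>) \<partial>lborel)"
  have main: "ennreal c * (A * ?V) \<le> B * ?E + A * ?D"
    unfolding A_def B_def by (rule separated_hardy[OF b c f sf w f0 d w0])
  have "A \<le> (\<integral>\<^sup>+ \<rho>\<in>{0<..}. ennreal (1 / \<rho>) * indicator {- 2 * n..2 * n} (ln \<rho>) \<partial>lborel)" unfolding A_def
  proof (rule nn_integral_mono)
    fix \<rho> :: real
    show "ennreal ((f (ln \<rho>))\<^sup>2 / \<rho>) * indicator {0<..} \<rho> \<le> ennreal (1 / \<rho>) * indicator {- 2 * n..2 * n} (ln \<rho>) * indicator {0<..} \<rho>"
      using Fle[of "ln \<rho> / n"] f0[of "ln \<rho>"]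
      by (auto simp: indicator_def f_def intro!: ennreal_leI divide_right_mono)
  qed
  also have "\<dots> < top" using n by (subst nn_integral_log_strip) auto
  finally have Afin: "A < top" .
  \<comment> \<open>The plateau of the stretched cutoff has logarithmic length \<open>2 * n\<close>.
    The bound \<open>1 \<le> A\<close> is enough, because the radial energy itself is already below
    \<open>\<epsilon>\<close>.\<close>
  have "1 \<le> ennreal (2 * n)" using n by (simp flip: ennreal_1)
  also have "\<dots> = (\<integral>\<^sup>+ \<rho>\<in>{0<..}. ennreal (1 / \<rho>) * indicator {- n..n} (ln \<rho>) \<partial>lborel)"
    using n by (subst nn_integral_log_strip) auto
  also have "\<dots> \<le> A" unfolding A_def
  proof (rule nn_integral_mono)
    fix \<rho> :: real
    have "f (ln \<rho>) = 1" if "ln \<rho> \<in> {-n..n}" unfolding f_def using that n by (intro F1) (auto simp: field_simps)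
    thus "ennreal (1 / \<rho>) * indicator {- n..n} (ln \<rho>) * indicator {0<..} \<rho> \<le> ennreal ((f (ln \<rho>))\<^sup>2 / \<rho>) * indicator {0<..} \<rho>"
      by (auto simp: indicator_def)
  qed
  finally have A1: "1 \<le> A" .
  have "B \<le> (\<integral>\<^sup>+ \<rho>. ennreal (M\<^sup>2 / n\<^sup>2) * (ennreal (1 / \<rho>) * indicator {- 2 * n..2 * n} (ln \<rho>) * indicator {0<..} \<rho>) \<partial>lborel)" unfolding B_def
  proof (rule nn_integral_mono)
    fix \<rho> :: real
    have "f' (ln \<rho>) = 0" if "ln \<rho> \<notin> {- 2 * n..2 * n}"
      unfolding f'_def using that n by (subst F'0) (auto simp: field_simps)
    moreover have "(f' (ln \<rho>))\<^sup>2 / \<rho> \<le> M\<^sup>2 / n\<^sup>2 * (1 / \<rho>)" if "\<rho> > 0"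
    proof -
      have "(F' (ln \<rho> / n))\<^sup>2 \<le> M\<^sup>2" using power_mono[of "\<bar>F' (ln \<rho> / n)\<bar>" M 2] M'[of "ln \<rho> / n"] by simp
      hence "(f' (ln \<rho>))\<^sup>2 \<le> M\<^sup>2 / n\<^sup>2" by (simp add: f'_def power_divide divide_right_mono)
      thus ?thesis using that by (simp add: divide_right_mono field_simps)
    qed
    ultimately show "ennreal ((f' (ln \<rho>))\<^sup>2 / \<rho>) * indicator {0<..} \<rho> \<le> ennreal (M\<^sup>2 / n\<^sup>2) * (ennreal (1 / \<rho>) * indicator {- 2 * n..2 * n} (ln \<rho>) * indicator {0<..} \<rho>)"
      by (auto simp: indicator_def ennreal_mult[symmetric] intro!: ennreal_leI)
  qed
  also have "\<dots> = ennreal (M\<^sup>2 / n\<^sup>2) * ennreal (4 * n)"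
    using n by (subst nn_integral_cmult) (auto simp: nn_integral_log_strip)
  also have "\<dots> = ennreal (4 * M\<^sup>2 / n)" using n by (subst ennreal_mult[symmetric]) (auto simp: power2_eq_square)
  finally have "B * ?E \<le> ennreal (4 * M\<^sup>2 / n) * ennreal (N * \<beta>)" by (rule mult_mono[OF _ E]) auto
  also have "\<dots> = ennreal (Q / n)" using n b N by (subst ennreal_mult[symmetric]) (auto simp: Q_def)
  also have "\<dots> \<le> ennreal \<epsilon>" using n by (intro ennreal_leI)
  finally have BE: "B * ?E \<le> ennreal \<epsilon>" .
  have "A * (ennreal c * ?V) \<le> B * ?E + A * ?D" using main by (simp add: mult_ac)
  also have "\<dots> \<le> A * ennreal \<epsilon> + A * ?D"
  proof (rule add_right_mono)
    have "1 * ennreal \<epsilon> \<le> A * ennreal \<epsilon>" by (rule mult_right_mono[OF A1]) simp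
    with BE show "B * ?E \<le> A * ennreal \<epsilon>" by simp
  qed
  finally have "A * (ennreal c * ?V) \<le> A * (?D + ennreal \<epsilon>)" by (simp add: distrib_left add.commute)
  \<comment> \<open>In the extended reals \<open>A\<close> may be cancelled only because it is both
    nonzero and finite.\<close>
  moreover have "A \<noteq> 0" using A1 by auto
  ultimately show "ennreal c * ?V \<le> ?D + ennreal \<epsilon>" 
    using Afin ennreal_mult_le_mult_iff[of A] by auto
qed

section \<open>Functions with a free end on half of the interval\<close>

lemma nn_integral_symmetric:
  fixes h :: "real \<Rightarrow> ennreal"
  assumes [measurable]: "h \<in> borel_measurable borel" and sym: "\<And>x. h (\<beta> - x) = h x" and "\<beta> > 0"
  shows "(\<integral>\<^sup>+ x\<in>{0<..<\<beta>}. h x \<partial>lborel) = 2 * (\<integral>\<^sup>+ x\<in>{0<..<\<beta> / 2}. h x \<partial>lborel)"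
proof -
  have "(\<integral>\<^sup>+ x\<in>{0<..<\<beta>}. h x \<partial>lborel)
      = (\<integral>\<^sup>+ x. h x * indicator {0<..<\<beta> / 2} x + h x * indicator {\<beta> / 2<..<\<beta>} x \<partial>lborel)"
    using AE_lborel_singleton[of "\<beta> / 2"] \<open>\<beta> > 0\<close>
    by (intro nn_integral_cong_AE) (auto elim!: eventually_mono simp: indicator_def)
  also have "\<dots> = (\<integral>\<^sup>+ x\<in>{0<..<\<beta> / 2}. h x \<partial>lborel) + (\<integral>\<^sup>+ x\<in>{\<beta> / 2<..<\<beta>}. h x \<partial>lborel)"
    by (rule nn_integral_add) auto
  also have "(\<integral>\<^sup>+ x\<in>{\<beta> / 2<..<\<beta>}. h x \<partial>lborel) = (\<integral>\<^sup>+ x\<in>{0<..<\<beta> / 2}. h x \<partial>lborel)"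
    by (subst nn_integral_real_affine[where c = "-1" and t = \<beta>])
       (auto simp: sym indicator_def intro!: nn_integral_cong)
  finally show ?thesis by (simp add: mult_2)
qed

text \<open>The function on \<open>(0, a)\<close> is made constant beyond its free end \<open>a \<le> \<beta> / 2\<close>
  and then reflected at \<open>\<beta> / 2\<close>; this does not increase its energy.\<close>

lemma half_hardy_aux:
  assumes b: "0 < \<beta>" "\<beta> \<le> 2 * pi" and c: "wedge_hardy \<beta> c"
    and U: "\<And>x. (U has_real_derivative U' x) (at x)" "smooth1 U'"
    and d: "0 < \<delta>" and U0: "\<And>\<theta>. \<theta> \<in> {0<..\<delta>} \<Longrightarrow> U \<theta> = 0"
    and a: "a \<le> \<beta> / 2" and p: "\<delta> < p" "p < a"
  shows "ennreal c * (\<integral>\<^sup>+ \<theta>\<in>{0<..<p}. ennreal (ang_pot \<beta> \<theta> * (U \<theta>)\<^sup>2) \<partial>lborel)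
    \<le> (\<integral>\<^sup>+ \<theta>\<in>{0<..<a}. ennreal ((U' \<theta>)\<^sup>2) \<partial>lborel)" (is "_ * ?V \<le> ?D")
proof -
  have sU: "smooth1 U" using smooth1_antideriv U by blast
  note [measurable] = smooth1_measurable[OF sU] smooth1_measurable[OF U(2)]
  \<comment> \<open>The fold needs room before the free end: its slope drops smoothly from 1 to 0
    between \<open>p\<close> and \<open>q\<close>, strictly inside the arc.\<close>
  define q where "q = (p + a) / 2"
  have q: "p < q" "q < a" using p by (auto simp: q_def)
  define \<kappa> where "\<kappa> = smooth_step p q"
  have s\<kappa>: "smooth1 \<kappa>" unfolding \<kappa>_def by (rule smooth1_smooth_step[OF q(1)])
  note [measurable] = smooth1_measurable[OF s\<kappa>]
  have \<kappa>1: "\<kappa> x = 1" if "x \<le> p" for x using smooth_step_le[OF q(1) that] by (simp add: \<kappa>_def)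
  have \<kappa>0: "\<kappa> x = 0" if "q \<le> x" for x using smooth_step_ge[OF that] by (simp add: \<kappa>_def)
  have \<kappa>b: "0 \<le> \<kappa> x" "\<kappa> x \<le> 1" for x using smooth_step_bounds[OF q(1)] by (auto simp: \<kappa>_def)
  have "\<exists>G. \<forall>x. - \<infinity> < ereal x \<longrightarrow> ereal x < \<infinity> \<longrightarrow> (G has_vector_derivative \<kappa> x) (at x)"
    by (rule einterval_antiderivative) (auto intro: smooth1_isCont[OF s\<kappa>])
  then obtain G where G: "(G has_real_derivative \<kappa> x) (at x)" for x
    by (auto simp: has_real_derivative_iff_has_vector_derivative)
  have mv: "\<exists>z>x. z < y \<and> G y - G x = (y - x) * \<kappa> z" if "x < y" for x y
    using MVT2[OF that, of G \<kappa>] G by blast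
  \<comment> \<open>\<open>G\<close> has slope 1 up to \<open>p\<close> and is constant from
    \<open>q\<close> on. Adding \<open>G (\<beta> - \<theta>)\<close> makes \<open>S\<close>
    symmetric, and for angles up to \<open>\<beta> / 2\<close> this summand is the constant
    \<open>G \<beta>\<close>. So \<open>S\<close> is the identity up to \<open>p\<close>, constant
    on the middle part, and then runs back.\<close>
  define S where "S \<theta> = G \<theta> + G (\<beta> - \<theta>) - G \<beta> - G 0" for \<theta>
  define S' where "S' \<theta> = \<kappa> \<theta> - \<kappa> (\<beta> - \<theta>)" for \<theta>
  have dGr: "((\<lambda>\<theta>. G (\<beta> - \<theta>)) has_real_derivative - \<kappa> (\<beta> - \<theta>)) (at \<theta>)" for \<theta>
  proof -
    have "((\<lambda>\<theta>. \<beta> - \<theta>) has_real_derivative - 1) (at \<theta>)" by (auto intro!: derivative_eq_intros)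
    from DERIV_chain2[OF G this] show ?thesis by simp
  qed
  have S: "(S has_real_derivative S' \<theta>) (at \<theta>)" for \<theta>
    unfolding S_def[abs_def] S'_def by (rule derivative_eq_intros G dGr refl)+ simp
  have "smooth1 (\<lambda>x. \<beta> - x)" by (intro smooth1_intros)
  hence sS': "smooth1 S'" unfolding S'_def[abs_def] by (intro smooth1_intros s\<kappa> smooth1_compose[OF s\<kappa>])
  hence sS: "smooth1 S" using smooth1_antideriv[OF S] by blast
  have Ssym: "S (\<beta> - \<theta>) = S \<theta>" for \<theta> by (simp add: S_def)
  have S's: "S' (\<beta> - \<theta>) = - S' \<theta>" for \<theta> by (simp add: S'_def)
  have Gq: "G x = G y" if "q \<le> x" "q \<le> y" for x y
  proof (rule linorder_cases[of x y])
    assume "x < y" thus ?thesis using mv[of x y] \<kappa>0 that by force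
  next
    assume "y < x" thus ?thesis using mv[of y x] \<kappa>0 that by force
  qed simp
  have Sh: "S \<theta> = G \<theta> - G 0" if "\<theta> \<le> \<beta> / 2" for \<theta>
    using Gq[of "\<beta> - \<theta>" \<beta>] that q a b by (simp add: S_def)
  have S'h: "S' \<theta> = \<kappa> \<theta>" if "\<theta> \<le> \<beta> / 2" for \<theta>
    using \<kappa>0[of "\<beta> - \<theta>"] that q a by (simp add: S'_def)
  have Sid: "S \<theta> = \<theta>" if "0 \<le> \<theta>" "\<theta> \<le> p" for \<theta>
  proof (cases "\<theta> = 0")
    case False
    then obtain z where "z < \<theta>" "G \<theta> - G 0 = (\<theta> - 0) * \<kappa> z" using mv[of 0 \<theta>] \<open>0 \<le> \<theta>\<close> by auto
    thus ?thesis using Sh[of \<theta>] \<kappa>1[of z] that q a b by simp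
  qed (use Sh[of 0] b in simp)
  \<comment> \<open>The slope of \<open>S\<close> is at most 1, so its values never pass
    \<open>q\<close>, and only values of \<open>U'\<close> before \<open>a\<close> enter the
    energy.\<close>
  have Sq: "S q \<le> q"
  proof -
    have "0 < q" using p d q by simp
    then obtain z where z: "G q - G 0 = (q - 0) * \<kappa> z" using mv[of 0 q] by blast
    have "(q - 0) * \<kappa> z \<le> q" using \<kappa>b[of z] \<open>0 < q\<close> by (simp add: mult_left_le)
    thus ?thesis using Sh[of q] q a z by simp
  qed
  define w where "w \<theta> = U (S \<theta>)" for \<theta>
  define w' where "w' \<theta> = U' (S \<theta>) * S' \<theta>" for \<theta>
  have w: "(w has_real_derivative w' x) (at x)" for x
    unfolding w_def[abs_def] w'_def by (rule DERIV_chain2[OF U(1) S])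
  have sw': "smooth1 w'" unfolding w'_def[abs_def] by (intro smooth1_intros sS' smooth1_compose[OF U(2) sS])
  hence sw: "smooth1 w" using smooth1_antideriv[OF w] by blast
  note [measurable] = smooth1_measurable[OF sw] smooth1_measurable[OF sw']
  have w0: "w \<theta> = 0" if "\<theta> \<in> {0<..<\<beta>}" "\<theta> \<notin> {\<delta>..\<beta> - \<delta>}" for \<theta>
  proof -
    consider "0 < \<theta>" "\<theta> \<le> \<delta>" | "0 < \<beta> - \<theta>" "\<beta> - \<theta> \<le> \<delta>" using \<open>\<theta> \<in> {0<..<\<beta>}\<close> \<open>\<theta> \<notin> {\<delta>..\<beta> - \<delta>}\<close> by fastforce
    thus ?thesis
    proof cases
      case 1 thus ?thesis using Sid[of \<theta>] U0[of \<theta>] p by (simp add: w_def)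
    next
      case 2 thus ?thesis using Sid[of "\<beta> - \<theta>"] U0[of "\<beta> - \<theta>"] p Ssym[of \<theta>] by (simp add: w_def)
    qed
  qed
  have "ennreal c * (\<integral>\<^sup>+ \<theta>\<in>{0<..<\<beta>}. ennreal (ang_pot \<beta> \<theta> * (w \<theta>)\<^sup>2) \<partial>lborel)
    \<le> (\<integral>\<^sup>+ \<theta>\<in>{0<..<\<beta>}. ennreal ((w' \<theta>)\<^sup>2) \<partial>lborel)"
    by (rule angular_hardy[OF b c w sw' d w0])
  also have "(\<integral>\<^sup>+ \<theta>\<in>{0<..<\<beta>}. ennreal (ang_pot \<beta> \<theta> * (w \<theta>)\<^sup>2) \<partial>lborel)
      = 2 * (\<integral>\<^sup>+ \<theta>\<in>{0<..<\<beta> / 2}. ennreal (ang_pot \<beta> \<theta> * (w \<theta>)\<^sup>2) \<partial>lborel)"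
    by (rule nn_integral_symmetric, measurable) (use b in \<open>auto simp: w_def Ssym ang_pot_reflect\<close>)
  also have "(\<integral>\<^sup>+ \<theta>\<in>{0<..<\<beta>}. ennreal ((w' \<theta>)\<^sup>2) \<partial>lborel) = 2 * (\<integral>\<^sup>+ \<theta>\<in>{0<..<\<beta> / 2}. ennreal ((w' \<theta>)\<^sup>2) \<partial>lborel)"
    by (rule nn_integral_symmetric, measurable) (use b in \<open>auto simp: w'_def Ssym S's\<close>)
  finally have "2 * (ennreal c * (\<integral>\<^sup>+ \<theta>\<in>{0<..<\<beta> / 2}. ennreal (ang_pot \<beta> \<theta> * (w \<theta>)\<^sup>2) \<partial>lborel))
      \<le> 2 * (\<integral>\<^sup>+ \<theta>\<in>{0<..<\<beta> / 2}. ennreal ((w' \<theta>)\<^sup>2) \<partial>lborel)" by (simp add: mult_ac)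
  hence main: "ennreal c * (\<integral>\<^sup>+ \<theta>\<in>{0<..<\<beta> / 2}. ennreal (ang_pot \<beta> \<theta> * (w \<theta>)\<^sup>2) \<partial>lborel)
      \<le> (\<integral>\<^sup>+ \<theta>\<in>{0<..<\<beta> / 2}. ennreal ((w' \<theta>)\<^sup>2) \<partial>lborel)"
    by (subst (asm) ennreal_mult_le_mult_iff) auto
  have "?V \<le> (\<integral>\<^sup>+ \<theta>\<in>{0<..<\<beta> / 2}. ennreal (ang_pot \<beta> \<theta> * (w \<theta>)\<^sup>2) \<partial>lborel)"
  proof (rule nn_integral_mono)
    fix \<theta> :: real
    show "ennreal (ang_pot \<beta> \<theta> * (U \<theta>)\<^sup>2) * indicator {0<..<p} \<theta>
        \<le> ennreal (ang_pot \<beta> \<theta> * (w \<theta>)\<^sup>2) * indicator {0<..<\<beta> / 2} \<theta>"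
      using p a Sid[of \<theta>] by (auto simp: indicator_def w_def)
  qed
  hence "ennreal c * ?V \<le> (\<integral>\<^sup>+ \<theta>\<in>{0<..<\<beta> / 2}. ennreal ((w' \<theta>)\<^sup>2) \<partial>lborel)"
    using main by (meson mult_left_mono order_trans zero_le)
  also have "\<dots> \<le> (\<integral>\<^sup>+ \<theta>\<in>{0..q}. ennreal ((U' (S \<theta>))\<^sup>2) * ennreal (S' \<theta>) \<partial>lborel)"
  proof (rule nn_integral_mono)
    fix \<theta> :: real
    \<comment> \<open>Since the slope of \<open>S\<close> lies in [0, 1], its square is at most the
      slope itself; one factor \<open>S'\<close> is left, which is the Jacobian of the substitution
      x = S(theta).\<close>
    have "(w' \<theta>)\<^sup>2 \<le> (U' (S \<theta>))\<^sup>2 * S' \<theta>" "q < \<theta> \<Longrightarrow> w' \<theta> = 0" "S' \<theta> \<ge> 0" if "\<theta> \<le> \<beta> / 2"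
      using \<kappa>b[of \<theta>] \<kappa>0[of \<theta>] S'h[OF that]
      by (auto simp: w'_def power_mult_distrib power2_eq_square[of "\<kappa> \<theta>"] mult_left_le mult_left_mono)
    thus "ennreal ((w' \<theta>)\<^sup>2) * indicator {0<..<\<beta> / 2} \<theta> \<le> ennreal ((U' (S \<theta>))\<^sup>2) * ennreal (S' \<theta>) * indicator {0..q} \<theta>"
      by (auto simp: indicator_def ennreal_mult[symmetric] not_le intro!: ennreal_leI)
  qed
  also have "\<dots> = (\<integral>\<^sup>+ x\<in>{S 0..S q}. ennreal ((U' x)\<^sup>2) \<partial>lborel)"
  proof (rule nn_integral_substitution_aux[symmetric])
    show "0 \<le> S' x" if "x \<in> {0..q}" for x using that S'h[of x] \<kappa>b[of x] q a by simp
  qed (use S smooth1_continuous_on[OF sS'] q p d in simp_all)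
  also have "\<dots> \<le> ?D"
    using AE_lborel_singleton[of "0 :: real"] Sid[of 0] Sq p d q
    by (intro nn_integral_mono_AE) (auto elim!: eventually_mono simp: indicator_def)
  finally show ?thesis .
qed

text \<open>Letting \<open>p\<close> increase to \<open>a\<close> in the preceding inequality closes
  the gap between the two intervals, by monotone convergence. If \<open>\<delta>\<close> is not
  below \<open>a\<close>, the potential term is 0.\<close>

lemma half_hardy:
  assumes b: "0 < \<beta>" "\<beta> \<le> 2 * pi" and c: "wedge_hardy \<beta> c"
    and U: "\<And>x. (U has_real_derivative U' x) (at x)" "smooth1 U'"
    and d: "0 < \<delta>" and U0: "\<And>\<theta>. \<theta> \<in> {0<..\<delta>} \<Longrightarrow> U \<theta> = 0"
    and a: "a \<le> \<beta> / 2"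
  shows "ennreal c * (\<integral>\<^sup>+ \<theta>\<in>{0<..<a}. ennreal (ang_pot \<beta> \<theta> * (U \<theta>)\<^sup>2) \<partial>lborel)
    \<le> (\<integral>\<^sup>+ \<theta>\<in>{0<..<a}. ennreal ((U' \<theta>)\<^sup>2) \<partial>lborel)" (is "_ * ?V \<le> ?D")
proof (cases "\<delta> < a")
  case False
  have "?V = (\<integral>\<^sup>+ \<theta>. 0 \<partial>(lborel :: real measure))"
  proof (rule nn_integral_cong)
    fix \<theta> :: real
    show "ennreal (ang_pot \<beta> \<theta> * (U \<theta>)\<^sup>2) * indicator {0<..<a} \<theta> = 0"
      using False U0[of \<theta>] by (auto simp: indicator_def)
  qed
  thus ?thesis by simp
next
  case True
  let ?h = "\<lambda>\<theta>. ennreal (ang_pot \<beta> \<theta> * (U \<theta>)\<^sup>2)"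
  have sU: "smooth1 U" using smooth1_antideriv U by blast
  note [measurable] = smooth1_measurable[OF sU]
  \<comment> \<open>The denominator starts at 2, since 1 would give \<open>p 0 = \<delta>\<close>,
    and strict inequality is required.\<close>
  define p where "p n = a - (a - \<delta>) / real (n + 2)" for n
  have p: "\<delta> < p n" "p n < a" for n
  proof -
    have "(a - \<delta>) * 1 < (a - \<delta>) * real (n + 2)" using True by (intro mult_strict_left_mono) auto
    thus "\<delta> < p n" by (simp add: p_def field_simps)
    show "p n < a" using True by (simp add: p_def)
  qed
  have inc: "p n \<le> p (Suc n)" for n using True by (auto simp: p_def intro!: divide_left_mono)
  have "p \<longlonglongrightarrow> a - 0" unfolding p_def[abs_def]
    by (intro tendsto_diff tendsto_const LIMSEQ_ignore_initial_segment[OF lim_const_over_n])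
  hence lim: "p \<longlonglongrightarrow> a" by simp
  have "(\<lambda>n. \<integral>\<^sup>+ \<theta>\<in>{0<..<p n}. ?h \<theta> \<partial>lborel) \<longlonglongrightarrow> ?V"
  proof (rule nn_integral_LIMSEQ)
    show "incseq (\<lambda>n \<theta>. ?h \<theta> * indicator {0<..<p n} \<theta>)"
    proof (rule incseq_SucI, rule le_funI)
      fix n and \<theta> :: real
      show "?h \<theta> * indicator {0<..<p n} \<theta>
        \<le> ?h \<theta> * indicator {0<..<p (Suc n)} \<theta>"
        using inc[of n] by (auto simp: indicator_def)
    qed
    fix \<theta> :: real
    have "\<forall>\<^sub>F n in sequentially. ?h \<theta> * indicator {0<..<p n} \<theta>
        = ?h \<theta> * indicator {0<..<a} \<theta>"
    proof (cases "\<theta> < a")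
      case True
      from order_tendstoD(1)[OF lim this] show ?thesis
        by (rule eventually_mono) (use True in \<open>auto simp: indicator_def\<close>)
    next
      case False
      hence "\<not> \<theta> < p n" for n using p(2)[of n] by linarith
      with False show ?thesis by (auto simp: indicator_def)
    qed
    thus "(\<lambda>n. ?h \<theta> * indicator {0<..<p n} \<theta>)
      \<longlonglongrightarrow> ?h \<theta> * indicator {0<..<a} \<theta>"
      by (rule tendsto_eventually)
  qed simp
  hence "(\<lambda>n. ennreal c * (\<integral>\<^sup>+ \<theta>\<in>{0<..<p n}. ?h \<theta> \<partial>lborel)) \<longlonglongrightarrow> ennreal c * ?V"
    by (rule ennreal_tendsto_cmult[rotated]) simp
  thus ?thesis
    by (rule LIMSEQ_le_const2) (use half_hardy_aux[OF b c U d U0 a p] in blast)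
qed

section \<open>Lipschitz functions with derivative of one sign\<close>

text \<open>A closed interval is a ball about its midpoint, and the covering theorem for balls only
  asks that the point lie in the ball, not that it be the centre. Hence intervals with the point at
  an end are allowed, as difference quotients demand.\<close>

lemma Vitali_intervals:
  fixes S :: "real set" and K :: "(real \<times> real) set"
  assumes K: "\<And>l h. (l, h) \<in> K \<Longrightarrow> l < h"
    and S: "\<And>x d. x \<in> S \<Longrightarrow> 0 < d \<Longrightarrow> \<exists>l h. (l, h) \<in> K \<and> l \<le> x \<and> x \<le> h \<and> h - l < d"
  obtains C where "countable C" "C \<subseteq> K" "disjoint_family_on (\<lambda>i. {fst i..snd i}) C"
    "negligible (S - (\<Union>i\<in>C. {fst i..snd i}))"
proof -
  have cb: "cball ((fst i + snd i) / 2) ((snd i - fst i) / 2) = {fst i..snd i}" for i :: "real \<times> real"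
    by (auto simp: cball_eq_atLeastAtMost field_simps)
  obtain C where C: "countable C" "C \<subseteq> K"
     "pairwise (\<lambda>i j. disjnt (cball ((fst i + snd i) / 2) ((snd i - fst i) / 2))
        (cball ((fst j + snd j) / 2) ((snd j - fst j) / 2))) C"
     "negligible (S - (\<Union>i\<in>C. cball ((fst i + snd i) / 2) ((snd i - fst i) / 2)))"
  proof (rule Vitali_covering_theorem_cballs[where K = K and S = S
        and a = "\<lambda>i. (fst i + snd i) / 2" and r = "\<lambda>i. (snd i - fst i) / 2"])
    show "0 < (snd i - fst i) / 2" if "i \<in> K" for i using K[of "fst i" "snd i"] that by simp
    fix x d :: real assume "x \<in> S" "0 < d"
    then obtain l h where "(l, h) \<in> K" "l \<le> x" "x \<le> h" "h - l < d" using S by blast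
    thus "\<exists>i. i \<in> K \<and> x \<in> cball ((fst i + snd i) / 2) ((snd i - fst i) / 2) \<and> (snd i - fst i) / 2 < d"
      unfolding cb using \<open>0 < d\<close> by (intro exI[of _ "(l, h)"]) auto
  qed blast
  show ?thesis
  proof (rule that[OF C(1,2)])
    show "disjoint_family_on (\<lambda>i. {fst i..snd i}) C"
      using C(3) unfolding cb disjoint_family_on_def pairwise_def disjnt_def by blast
  qed (use C(4) in \<open>simp add: cb\<close>)
qed

lemma interval_in_open:
  assumes "open U" "x \<in> (U :: real set)"
  shows "\<exists>d>0. \<forall>l h. l \<le> x \<longrightarrow> x \<le> h \<longrightarrow> h - l < d \<longrightarrow> {l..h} \<subseteq> U"
proof -
  obtain d where d: "d > 0" "\<And>y. dist y x < d \<Longrightarrow> y \<in> U" using assms unfolding open_dist by blast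
  have "{l..h} \<subseteq> U" if "l \<le> x" "x \<le> h" "h - l < d" for l h
    using that by (intro subsetI d(2)) (auto simp: dist_real_def)
  with d(1) show ?thesis by blast
qed

context
  fixes g :: "real \<Rightarrow> real"
  assumes g_mono: "\<And>x y. x \<le> y \<Longrightarrow> g x \<le> g y" and g_cont: "continuous_on UNIV g"
begin

text \<open>Increments of \<open>g\<close> are masses of its Stieltjes measure, so a bound on the
  slopes over countably many disjoint intervals becomes a comparison of two measures on their
  union.\<close>

lemma interval_measure_UN_le:
  assumes "countable C" "disjoint_family_on (\<lambda>i. {fst i..snd i}) C" "0 \<le> u"
    and C: "\<And>l h. (l, h) \<in> C \<Longrightarrow> l < h \<and> g h - g l \<le> u * (h - l)"
  shows "emeasure (interval_measure g) (\<Union>i\<in>C. {fst i..snd i}) \<le> ennreal u * emeasure lborel (\<Union>i\<in>C. {fst i..snd i})"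
proof -
  have "emeasure (interval_measure g) (\<Union>i\<in>C. {fst i..snd i})
      = (\<integral>\<^sup>+ i. emeasure (interval_measure g) {fst i..snd i} \<partial>count_space C)"
    by (rule emeasure_UN_countable) (use assms in auto)
  also have "\<dots> \<le> (\<integral>\<^sup>+ i. ennreal u * emeasure lborel {fst i..snd i} \<partial>count_space C)"
  proof (rule nn_integral_mono)
    fix i assume "i \<in> space (count_space C)"
    hence i: "fst i < snd i" "g (snd i) - g (fst i) \<le> u * (snd i - fst i)" using C[of "fst i" "snd i"] by auto
    show "emeasure (interval_measure g) {fst i..snd i} \<le> ennreal u * emeasure lborel {fst i..snd i}"
      using i \<open>0 \<le> u\<close>
      by (simp add: emeasure_interval_measure_Icc[OF _ g_mono g_cont] ennreal_mult[symmetric] ennreal_leI)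
  qed
  also have "\<dots> = ennreal u * (\<integral>\<^sup>+ i. emeasure lborel {fst i..snd i} \<partial>count_space C)"
    by (rule nn_integral_cmult) simp
  also have "(\<integral>\<^sup>+ i. emeasure lborel {fst i..snd i} \<partial>count_space C) = emeasure lborel (\<Union>i\<in>C. {fst i..snd i})"
    by (rule emeasure_UN_countable[symmetric]) (use assms in auto)
  finally show ?thesis .
qed

lemma interval_measure_UN_ge:
  assumes "countable C" "disjoint_family_on (\<lambda>i. {fst i..snd i}) C" "0 \<le> v"
    and C: "\<And>l h. (l, h) \<in> C \<Longrightarrow> l < h \<and> v * (h - l) \<le> g h - g l"
  shows "ennreal v * emeasure lborel (\<Union>i\<in>C. {fst i..snd i}) \<le> emeasure (interval_measure g) (\<Union>i\<in>C. {fst i..snd i})"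
proof -
  have "emeasure lborel (\<Union>i\<in>C. {fst i..snd i}) = (\<integral>\<^sup>+ i. emeasure lborel {fst i..snd i} \<partial>count_space C)"
    by (rule emeasure_UN_countable) (use assms in auto)
  hence "ennreal v * emeasure lborel (\<Union>i\<in>C. {fst i..snd i})
      = (\<integral>\<^sup>+ i. ennreal v * emeasure lborel {fst i..snd i} \<partial>count_space C)"
    by (simp add: nn_integral_cmult)
  also have "\<dots> \<le> (\<integral>\<^sup>+ i. emeasure (interval_measure g) {fst i..snd i} \<partial>count_space C)"
  proof (rule nn_integral_mono)
    fix i assume "i \<in> space (count_space C)"
    hence i: "fst i < snd i" "v * (snd i - fst i) \<le> g (snd i) - g (fst i)" using C[of "fst i" "snd i"] by auto
    show "ennreal v * emeasure lborel {fst i..snd i} \<le> emeasure (interval_measure g) {fst i..snd i}"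
      using i \<open>0 \<le> v\<close>
      by (simp add: emeasure_interval_measure_Icc[OF _ g_mono g_cont] ennreal_mult[symmetric] ennreal_leI)
  qed
  also have "\<dots> = emeasure (interval_measure g) (\<Union>i\<in>C. {fst i..snd i})"
    by (rule emeasure_UN_countable[symmetric]) (use assms in auto)
  finally show ?thesis .
qed

text \<open>For \<open>u < v\<close> these points witness oscillation of the difference quotients.
  Intervals merely containing the point are used, because such families are Vitali coverings as they
  stand.\<close>

definition slope_gap :: "real \<Rightarrow> real \<Rightarrow> real set" where
  "slope_gap u v = {x. \<forall>d>0. (\<exists>l h. l < h \<and> l \<le> x \<and> x \<le> h \<and> h - l < d \<and> g h - g l \<le> u * (h - l))
      \<and> (\<exists>l h. l < h \<and> l \<le> x \<and> x \<le> h \<and> h - l < d \<and> v * (h - l) \<le> g h - g l)}"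

text \<open>Lebesgue's double covering: intervals of slope at most \<open>u\<close> inside a tight
  open superset, and inside these, intervals of slope at least \<open>v\<close>, each covering
  almost all of the set. Comparing Stieltjes masses gives
  \<open>v * m \<le> u * (m + \<epsilon>)\<close> for the outer measure \<open>m\<close>, hence
  \<open>m = 0\<close>.\<close>

lemma negligible_slope_gap:
  assumes uv: "0 \<le> u" "u < v"
  shows "negligible (slope_gap u v \<inter> {p<..<q})"
proof -
  define E where "E = slope_gap u v \<inter> {p<..<q}"
  \<comment> \<open>Measurability of \<open>E\<close> is not established, so a measurable hull of
    the same outer measure takes its place.\<close>
  obtain H where H: "H \<in> sets lebesgue" "E \<subseteq> H" "outer_measure_of lebesgue E = emeasure lebesgue H"
    using outer_measure_of_attain[of E lebesgue] by auto
  have "outer_measure_of lebesgue E \<le> outer_measure_of lebesgue {p<..<q}"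
    by (rule outer_measure_of_mono) (simp add: E_def)
  also have "\<dots> < \<infinity>" by (cases "p \<le> q") auto
  finally have fin: "emeasure lebesgue H < \<infinity>" using H(3) by simp
  define m where "m = measure lebesgue H"
  have m: "emeasure lebesgue H = ennreal m" "m \<ge> 0" unfolding m_def
    using fin by (auto simp: emeasure_eq_ennreal_measure)
  have step: "v * m \<le> u * (m + \<epsilon>)" if \<epsilon>: "\<epsilon> > 0" for \<epsilon>
  proof -
    obtain T where T: "open T" "H \<subseteq> T" "T - H \<in> lmeasurable" "emeasure lebesgue (T - H) < ennreal \<epsilon>"
      using sets_lebesgue_outer_open[OF H(1) \<epsilon>] by blast
    have "emeasure lebesgue T = emeasure lebesgue (H \<union> (T - H))" using T(2) by (simp add: Un_absorb1)
    also have "\<dots> \<le> emeasure lebesgue H + emeasure lebesgue (T - H)"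
      by (rule emeasure_subadditive) (use H T in \<open>auto intro: fmeasurableD\<close>)
    also have "\<dots> \<le> ennreal m + ennreal \<epsilon>" unfolding m(1) using T(4) by (intro add_left_mono) simp
    finally have eT: "emeasure lborel T \<le> ennreal (m + \<epsilon>)" using T(1) m \<epsilon> by simp
    define K1 where "K1 = {(l, h). l < h \<and> {l..h} \<subseteq> T \<and> g h - g l \<le> u * (h - l)}"
    obtain C1 where C1: "countable C1" "C1 \<subseteq> K1" "disjoint_family_on (\<lambda>i. {fst i..snd i}) C1"
      "negligible (E - (\<Union>i\<in>C1. {fst i..snd i}))"
    proof (rule Vitali_intervals[of K1 E])
      fix x d :: real assume x: "x \<in> E" "0 < d"
      then obtain d' where d': "d' > 0" "\<And>l h. l \<le> x \<Longrightarrow> x \<le> h \<Longrightarrow> h - l < d' \<Longrightarrow> {l..h} \<subseteq> T"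
        using interval_in_open[OF T(1), of x] T(2) H(2) x(1) by blast
      have "0 < min d d'" using d' x by simp
      then obtain l h where "l < h" "l \<le> x" "x \<le> h" "h - l < min d d'" "g h - g l \<le> u * (h - l)"
        using x(1) unfolding E_def slope_gap_def by blast
      thus "\<exists>l h. (l, h) \<in> K1 \<and> l \<le> x \<and> x \<le> h \<and> h - l < d"
        using d'(2)[of l h] by (intro exI[of _ l] exI[of _ h]) (auto simp: K1_def)
    qed (auto simp: K1_def)
    define I where "I = (\<Union>i\<in>C1. {fst i..snd i})"
    \<comment> \<open>Endpoints are discarded so that each remaining point has small intervals
      around it inside \<open>I\<close>. The loss is countable, hence null.\<close>
    define E' where "E' = E \<inter> (\<Union>i\<in>C1. {fst i<..<snd i})"
    define K2 where "K2 = {(l, h). l < h \<and> {l..h} \<subseteq> I \<and> v * (h - l) \<le> g h - g l}"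
    obtain C2 where C2: "countable C2" "C2 \<subseteq> K2" "disjoint_family_on (\<lambda>i. {fst i..snd i}) C2"
      "negligible (E' - (\<Union>i\<in>C2. {fst i..snd i}))"
    proof (rule Vitali_intervals[of K2 E'])
      fix x d :: real assume x: "x \<in> E'" "0 < d"
      have "open (\<Union>i\<in>C1. {fst i<..<snd i})" by auto
      moreover have "x \<in> (\<Union>i\<in>C1. {fst i<..<snd i})" using x(1) by (simp add: E'_def)
      ultimately obtain d' where d': "d' > 0"
        "\<And>l h. l \<le> x \<Longrightarrow> x \<le> h \<Longrightarrow> h - l < d' \<Longrightarrow> {l..h} \<subseteq> (\<Union>i\<in>C1. {fst i<..<snd i})"
        using interval_in_open by blast
      have "(\<Union>i\<in>C1. {fst i<..<snd i}) \<subseteq> I" unfolding I_def by force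
      hence sub: "{l..h} \<subseteq> I" if "l \<le> x" "x \<le> h" "h - l < d'" for l h using d'(2)[OF that] by blast
      have "0 < min d d'" using d' x by simp
      then obtain l h where "l < h" "l \<le> x" "x \<le> h" "h - l < min d d'" "v * (h - l) \<le> g h - g l"
        using x(1) unfolding E'_def E_def slope_gap_def by blast
      thus "\<exists>l h. (l, h) \<in> K2 \<and> l \<le> x \<and> x \<le> h \<and> h - l < d"
        using sub[of l h] by (intro exI[of _ l] exI[of _ h]) (auto simp: K2_def)
    qed (auto simp: K2_def)
    define J where "J = (\<Union>i\<in>C2. {fst i..snd i})"
    have JI: "J \<subseteq> I" using C2(2) unfolding J_def K2_def by fastforce
    have IT: "I \<subseteq> T" using C1(2) unfolding I_def K1_def by fastforce
    have [measurable]: "I \<in> sets borel" "J \<in> sets borel"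
      unfolding I_def J_def using C1(1) C2(1) by (auto intro!: sets.countable_UN')
    have "E - J \<subseteq> (E - I) \<union> (E' - J) \<union> (fst ` C1 \<union> snd ` C1)"
      unfolding I_def E'_def by force
    moreover have "negligible (fst ` C1 \<union> snd ` C1)" using C1(1)
      by (auto simp: negligible_iff_null_sets intro!: null_sets_completionI countable_imp_null_set_lborel)
    ultimately have "negligible (E - J)"
      using C1(4) C2(4) unfolding I_def[symmetric] J_def[symmetric]
      by (meson negligible_Un negligible_subset)
    hence N: "E - J \<in> null_sets lebesgue" by (simp add: negligible_iff_null_sets)
    have "ennreal m = outer_measure_of lebesgue E" using H(3) m(1) by simp
    also have "\<dots> \<le> outer_measure_of lebesgue (J \<union> (E - J))" by (rule outer_measure_of_mono) blast
    also have "\<dots> = emeasure lebesgue (J \<union> (E - J))" using N by (intro outer_measure_of_eq sets.Un) auto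
    also have "\<dots> = emeasure lebesgue J" by (rule emeasure_Un_null_set) (use N in auto)
    also have "\<dots> = emeasure lborel J" by simp
    finally have mJ: "ennreal m \<le> emeasure lborel J" .
    have "ennreal (v * m) = ennreal v * ennreal m" using uv m by (simp add: ennreal_mult)
    also have "\<dots> \<le> ennreal v * emeasure lborel J" by (intro mult_left_mono mJ) simp
    also have "\<dots> \<le> emeasure (interval_measure g) J" unfolding J_def
      by (rule interval_measure_UN_ge[OF C2(1,3)]) (use uv C2(2) in \<open>auto simp: K2_def\<close>)
    also have "\<dots> \<le> emeasure (interval_measure g) I" by (intro emeasure_mono JI) simp
    also have "\<dots> \<le> ennreal u * emeasure lborel I" unfolding I_def
      by (rule interval_measure_UN_le[OF C1(1,3)]) (use uv C1(2) in \<open>auto simp: K1_def\<close>)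
    also have "\<dots> \<le> ennreal u * emeasure lborel T" using T(1) IT by (intro mult_left_mono emeasure_mono) auto
    also have "\<dots> \<le> ennreal u * ennreal (m + \<epsilon>)" by (intro mult_left_mono eT) simp
    also have "\<dots> = ennreal (u * (m + \<epsilon>))" using uv m \<epsilon> by (simp add: ennreal_mult)
    finally show ?thesis using uv m \<epsilon> by (simp add: ennreal_le_iff)
  qed
  have "v * m \<le> u * m"
  proof (rule field_le_epsilon)
    fix e :: real assume e: "e > 0"
    \<comment> \<open>\<open>u\<close> may be 0, so \<open>e\<close> is divided by
      \<open>u + 1\<close>.\<close>
    have "v * m \<le> u * (m + e / (u + 1))" by (rule step) (use e uv in auto)
    also have "\<dots> \<le> u * m + e" using e uv by (simp add: field_simps)
    finally show "v * m \<le> u * m + e" .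
  qed
  hence "m = 0" using uv m(2) by (simp add: mult_le_cancel_right)
  hence "H \<in> null_sets lebesgue" using H(1) m(1) by auto
  thus ?thesis using H(2) negligible_subset unfolding E_def[symmetric] negligible_iff_null_sets[symmetric] by blast
qed

text \<open>At almost every point there are arbitrarily short intervals of slope at least
  \<open>s\<close>. A disjoint selection of them fills the interval up to a null set, and adding
  their Stieltjes masses yields the increment.\<close>

lemma deriv_ge_imp_increment_ge:
  assumes s: "0 \<le> s" "s < K" and pq: "p < q"
    and D: "\<And>x D. p < x \<Longrightarrow> x < q \<Longrightarrow> (g has_real_derivative D) (at x) \<Longrightarrow> K \<le> D"
  shows "s * (q - p) \<le> g q - g p"
proof -
  \<comment> \<open>Rational slopes keep the union countable; a gap between lower and upper
    derivative always contains two rationals.\<close>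
  define N where "N = (\<Union>r\<in>{r :: rat \<times> rat. 0 \<le> fst r \<and> fst r < snd r}. slope_gap (of_rat (fst r)) (of_rat (snd r)) \<inter> {p<..<q})"
  have N: "negligible N" unfolding N_def
    by (intro negligible_countable_Union) (auto intro!: negligible_slope_gap simp: of_rat_less)
  define K3 where "K3 = {(l, h). l < h \<and> {l..h} \<subseteq> {p<..<q} \<and> s * (h - l) \<le> g h - g l}"
  obtain C where C: "countable C" "C \<subseteq> K3" "disjoint_family_on (\<lambda>i. {fst i..snd i}) C"
    "negligible ({p<..<q} - N - (\<Union>i\<in>C. {fst i..snd i}))"
  proof (rule Vitali_intervals[of K3 "{p<..<q} - N"])
    fix x d :: real assume x: "x \<in> {p<..<q} - N" "0 < d"
    obtain d' where d': "d' > 0" "\<And>l h. l \<le> x \<Longrightarrow> x \<le> h \<Longrightarrow> h - l < d' \<Longrightarrow> {l..h} \<subseteq> {p<..<q}"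
      using interval_in_open[of "{p<..<q}" x] x(1) by auto
    define \<phi> where "\<phi> y = (g y - g x) / (y - x)" for y
    have slope: "\<exists>l h. l < h \<and> l \<le> x \<and> x \<le> h \<and> h - l = \<bar>y - x\<bar> \<and> g h - g l = \<phi> y * (h - l)" if "y \<noteq> x" for y
    proof (cases "y < x")
      case True thus ?thesis by (intro exI[of _ y] exI[of _ x]) (auto simp: \<phi>_def field_simps)
    next
      case False thus ?thesis using that by (intro exI[of _ x] exI[of _ y]) (auto simp: \<phi>_def field_simps)
    qed
    have \<phi>0: "0 \<le> \<phi> y" for y using g_mono[of x y] g_mono[of y x]
      by (cases "x \<le> y") (auto simp: \<phi>_def zero_le_divide_iff)
    show "\<exists>l h. (l, h) \<in> K3 \<and> l \<le> x \<and> x \<le> h \<and> h - l < d"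
    proof (rule ccontr)
      assume no: "\<not> ?thesis"
      \<comment> \<open>If no short interval at \<open>x\<close> has slope at least
        \<open>s\<close>, all nearby difference quotients are bounded by \<open>s\<close>. This also
        excludes an infinite derivative.\<close>
      have ev: "\<forall>\<^sub>F y in at x. \<phi> y \<le> s"
        unfolding eventually_at
      proof (intro exI[of _ "min d d'"] conjI ballI impI)
        fix y assume y: "y \<noteq> x \<and> dist y x < min d d'"
        obtain l h where lh: "l < h" "l \<le> x" "x \<le> h" "h - l = \<bar>y - x\<bar>" "g h - g l = \<phi> y * (h - l)"
          using slope[of y] y by blast
        hence lt: "h - l < d" "h - l < d'" using y by (auto simp: dist_real_def)
        show "\<phi> y \<le> s"
        proof (rule ccontr)
          assume "\<not> \<phi> y \<le> s"
          hence "s * (h - l) \<le> g h - g l" unfolding lh(5) using lh(1) by (intro mult_right_mono) auto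
          hence "(l, h) \<in> K3" unfolding K3_def using lh d'(2)[of l h] lt by auto
          with no lh lt show False by blast
        qed
      qed (use x d' in auto)
      define F where "F y = ereal (\<phi> y)" for y
      have b1: "0 \<le> Liminf (at x) F" by (rule Liminf_bounded) (auto simp: F_def \<phi>0)
      have b2: "Limsup (at x) F \<le> ereal s" by (rule Limsup_bounded) (use ev in \<open>simp add: F_def\<close>)
      have b3: "Liminf (at x) F \<le> Limsup (at x) F" by (rule Liminf_le_Limsup) simp
      show False
      proof (cases "Liminf (at x) F = Limsup (at x) F")
        case True
        \<comment> \<open>The common limit lies between 0 and \<open>s\<close>, so it is a real
          derivative and contradicts the assumed lower bound \<open>K > s\<close>.\<close>
        have "0 \<le> Limsup (at x) F" using b1 b3 by (rule order_trans)
        with b2 obtain D where D': "Limsup (at x) F = ereal D" "D \<le> s"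
          by (cases "Limsup (at x) F" rule: ereal_cases) auto
        have "(F \<longlongrightarrow> ereal D) (at x)" by (rule Liminf_eq_Limsup) (use True D' in auto)
        hence "(\<phi> \<longlongrightarrow> D) (at x)" by (simp add: F_def[abs_def])
        hence "(g has_real_derivative D) (at x)" by (simp add: has_field_derivative_iff \<phi>_def[abs_def])
        with D[of x D] x(1) have "K \<le> D" by auto
        with D' s show False by simp
      next
        case False
        with b3 have "Liminf (at x) F < Limsup (at x) F" by simp
        \<comment> \<open>Two rationals between lower and upper limit place \<open>x\<close> in one
          of the exceptional sets making up \<open>N\<close>.\<close>
        then obtain v where v: "Liminf (at x) F < ereal (of_rat v)" "ereal (of_rat v) < Limsup (at x) F"
          using ereal_dense3 by blast
        then obtain u where u: "Liminf (at x) F < ereal (of_rat u)" "ereal (of_rat u) < ereal (of_rat v)"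
          using ereal_dense3 by blast
        have "0 < ereal (of_rat u)" using b1 u(1) by (rule le_less_trans)
        hence u0: "0 \<le> u" by simp
        have uv: "u < v" using u(2) by (simp add: of_rat_less)
        have f1: "\<exists>y. y \<noteq> x \<and> dist y x < e \<and> \<phi> y < of_rat u" if "e > 0" for e
        proof (rule ccontr)
          assume "\<not> ?thesis"
          hence "\<forall>\<^sub>F y in at x. ereal (of_rat u) \<le> F y"
            unfolding eventually_at F_def using that by (intro exI[of _ e]) (auto simp: not_less)
          from Liminf_bounded[OF this] u(1) show False by simp
        qed
        have f2: "\<exists>y. y \<noteq> x \<and> dist y x < e \<and> \<phi> y > of_rat v" if "e > 0" for e
        proof (rule ccontr)
          assume "\<not> ?thesis"
          hence "\<forall>\<^sub>F y in at x. F y \<le> ereal (of_rat v)"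
            unfolding eventually_at F_def using that by (intro exI[of _ e]) (auto simp: not_less)
          from Limsup_bounded[OF this] v(2) show False by simp
        qed
        have "x \<in> slope_gap (of_rat u) (of_rat v)" unfolding slope_gap_def
        proof (intro CollectI allI impI conjI)
          fix e :: real assume "e > 0"
          then obtain y where y: "y \<noteq> x" "dist y x < e" "\<phi> y < of_rat u" using f1 by blast
          obtain l h where "l < h" "l \<le> x" "x \<le> h" "h - l = \<bar>y - x\<bar>" "g h - g l = \<phi> y * (h - l)"
            using slope[OF y(1)] by blast
          thus "\<exists>l h. l < h \<and> l \<le> x \<and> x \<le> h \<and> h - l < e \<and> g h - g l \<le> of_rat u * (h - l)"
            using y by (intro exI[of _ l] exI[of _ h]) (auto simp: dist_real_def intro!: mult_right_mono)
        next
          fix e :: real assume "e > 0"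
          then obtain y where y: "y \<noteq> x" "dist y x < e" "\<phi> y > of_rat v" using f2 by blast
          obtain l h where "l < h" "l \<le> x" "x \<le> h" "h - l = \<bar>y - x\<bar>" "g h - g l = \<phi> y * (h - l)"
            using slope[OF y(1)] by blast
          thus "\<exists>l h. l < h \<and> l \<le> x \<and> x \<le> h \<and> h - l < e \<and> of_rat v * (h - l) \<le> g h - g l"
            using y by (intro exI[of _ l] exI[of _ h]) (auto simp: dist_real_def intro!: mult_right_mono)
        qed
        hence "x \<in> N" unfolding N_def using x(1) u0 uv by (intro UN_I[of "(u, v)"]) auto
        with x(1) show False by blast
      qed
    qed
  qed (auto simp: K3_def)
  define I where "I = (\<Union>i\<in>C. {fst i..snd i})"
  have I[measurable]: "I \<in> sets borel" unfolding I_def using C(1) by (auto intro!: sets.countable_UN')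
  have Ipq: "I \<subseteq> {p<..<q}" using C(2) unfolding I_def K3_def by fastforce
  have "negligible ({p<..<q} - I)"
    by (rule negligible_subset[of "({p<..<q} - N - I) \<union> N"]) (use C(4) N in \<open>auto simp: I_def\<close>)
  hence n: "{p<..<q} - I \<in> null_sets lebesgue" by (simp add: negligible_iff_null_sets)
  have "ennreal (q - p) = emeasure lebesgue {p<..<q}" using pq by simp
  also have "\<dots> = emeasure lebesgue (I \<union> ({p<..<q} - I))" using Ipq by (simp add: Un_absorb1)
  also have "\<dots> = emeasure lebesgue I" by (rule emeasure_Un_null_set) (use n in auto)
  also have "\<dots> = emeasure lborel I" by simp
  finally have eI: "emeasure lborel I = ennreal (q - p)" ..
  have "ennreal (s * (q - p)) = ennreal s * emeasure lborel I" using s pq eI by (simp add: ennreal_mult)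
  also have "\<dots> \<le> emeasure (interval_measure g) I" unfolding I_def
    by (rule interval_measure_UN_ge[OF C(1,3)]) (use s C(2) in \<open>auto simp: K3_def\<close>)
  also have "\<dots> \<le> emeasure (interval_measure g) {p..q}" using Ipq by (intro emeasure_mono) auto
  also have "\<dots> = ennreal (g q - g p)" using pq by (intro emeasure_interval_measure_Icc g_mono g_cont) auto
  finally show ?thesis using g_mono[of p q] pq by (simp add: ennreal_le_iff)
qed

end

text \<open>Subtracting \<open>f\<close> from a steep linear function gives an increasing function,
  to which the increment bound applies; its derivative, wherever it exists, is at least
  \<open>K\<close>.\<close>

lemma lipschitz_deriv_nonpos_imp_antimono:
  fixes f :: "real \<Rightarrow> real"
  assumes f: "L-lipschitz_on {p..q} f" and pq: "p \<le> q"
    and D: "\<And>x D. p < x \<Longrightarrow> x < q \<Longrightarrow> (f has_real_derivative D) (at x) \<Longrightarrow> D \<le> 0"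
  shows "f q \<le> f p"
proof (cases "p = q")
  case False
  hence pq': "p < q" using pq by simp
  \<comment> \<open>Clamping to the interval extends \<open>f\<close> to the whole line with the
    same Lipschitz constant, as the Stieltjes measure needs a function on the line.\<close>
  define cl where "cl x = max p (min q x)" for x
  have cl: "cl x \<in> {p..q}" "\<bar>cl x - cl y\<bar> \<le> \<bar>x - y\<bar>" for x y using pq by (auto simp: cl_def)
  have clm: "cl x \<le> cl y" if "x \<le> y" for x y using that by (auto simp: cl_def)
  have L: "0 \<le> L" using lipschitz_on_nonneg[OF f] .
  define K where "K = L + 1"
  define g where "g x = K * x - f (cl x)" for x
  have Lf: "\<bar>f (cl x) - f (cl y)\<bar> \<le> L * \<bar>x - y\<bar>" for x y
  proof -
    have "\<bar>f (cl x) - f (cl y)\<bar> \<le> L * \<bar>cl x - cl y\<bar>"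
      using lipschitz_onD[OF f cl(1)[of x] cl(1)[of y]] by (simp add: dist_real_def)
    also have "\<dots> \<le> L * \<bar>x - y\<bar>" using L cl(2) by (intro mult_left_mono)
    finally show ?thesis .
  qed
  have gm: "g x \<le> g y" if "x \<le> y" for x y
    using Lf[of y x] that by (simp add: g_def K_def algebra_simps)
  have "L-lipschitz_on UNIV (\<lambda>x. f (cl x))" by (rule lipschitz_onI) (use Lf L in \<open>auto simp: dist_real_def\<close>)
  hence gc: "continuous_on UNIV g" unfolding g_def[abs_def]
    by (intro continuous_intros lipschitz_on_continuous_on)
  have gD: "K \<le> D'" if x: "p < x" "x < q" and g': "(g has_real_derivative D') (at x)" for x D'
  proof -
    have "((\<lambda>x. K * x - g x) has_real_derivative K - D') (at x)"
      using g' by (auto intro!: derivative_eq_intros)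
    hence "(f has_real_derivative K - D') (at x)"
      by (rule has_field_derivative_transform_within_open[where S = "{p<..<q}"])
         (use x in \<open>auto simp: g_def cl_def\<close>)
    from D[OF x this] show ?thesis by simp
  qed
  have gval: "g q - g p = K * (q - p) - (f q - f p)" using pq by (simp add: g_def cl_def algebra_simps)
  show ?thesis
  proof (rule ccontr)
    assume "\<not> f q \<le> f p"
    hence pos: "0 < f q - f p" by simp
    \<comment> \<open>Half of the supposed mean increase is subtracted: this makes
      \<open>s < K\<close>, yet the increment bound with \<open>s\<close> already contradicts the
      full increase. The Lipschitz bound keeps \<open>s\<close> nonnegative.\<close>
    define s where "s = K - (f q - f p) / (2 * (q - p))"
    have "f q - f p \<le> L * (q - p)" using Lf[of q p] pq by (simp add: cl_def)
    hence "(f q - f p) / (q - p) \<le> L" using pq' by (simp add: field_simps)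
    hence s: "0 \<le> s" using L pos pq' by (simp add: s_def K_def field_simps)
    have s': "s < K" using pos pq' by (simp add: s_def)
    have "s * (q - p) \<le> g q - g p" by (rule deriv_ge_imp_increment_ge[OF gm gc s s' pq' gD])
    moreover have "s * (q - p) = K * (q - p) - (f q - f p) / 2" using pq' by (simp add: s_def field_simps)
    ultimately have "K * (q - p) - (f q - f p) / 2 \<le> K * (q - p) - (f q - f p)" unfolding gval by simp
    thus False using pos by (simp add: field_simps)
  qed
qed simp

section \<open>The Hardy inequality on the domain\<close>

text \<open>Such a \<open>P\<close> is the interval from 0 to its supremum, with or without the
  right end, which is a null set. Vanishing near 0 is asked only for nonempty \<open>P\<close>,
  since a circle may miss the half in question.\<close>

lemma half_hardy_initial_segment:
  assumes b: "0 < \<beta>" "\<beta> \<le> 2 * pi" and c: "wedge_hardy \<beta> c"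
    and U: "\<And>x. (U has_real_derivative U' x) (at x)" "smooth1 U'"
    and P: "P \<subseteq> {0<..<\<beta> / 2}" "\<And>x y. y \<in> P \<Longrightarrow> 0 < x \<Longrightarrow> x \<le> y \<Longrightarrow> x \<in> P"
    and U0: "P \<noteq> {} \<Longrightarrow> \<exists>\<delta>>0. \<forall>\<theta>\<in>P. \<theta> < \<delta> \<longrightarrow> U \<theta> = 0"
  shows "ennreal c * (\<integral>\<^sup>+ \<theta>\<in>P. ennreal (ang_pot \<beta> \<theta> * (U \<theta>)\<^sup>2) \<partial>lborel)
    \<le> (\<integral>\<^sup>+ \<theta>\<in>P. ennreal ((U' \<theta>)\<^sup>2) \<partial>lborel)"
proof (cases "P = {}")
  case False
  then obtain y where y: "y \<in> P" by blast
  hence y': "0 < y" "y < \<beta> / 2" using P(1) by auto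
  have bdd: "bdd_above P" using P(1) by (meson bdd_above_Ioo bdd_above_mono)
  define a where "a = Sup P"
  have ya: "y \<le> a" unfolding a_def by (rule cSup_upper[OF y bdd])
  have a: "a \<le> \<beta> / 2" unfolding a_def by (rule cSup_least[OF False]) (use P(1) in auto)
  have sub: "{0<..<a} \<subseteq> P"
  proof
    fix x assume "x \<in> {0<..<a}"
    then obtain z where "z \<in> P" "x < z" "0 < x" using less_cSup_iff[OF False bdd] by (auto simp: a_def)
    thus "x \<in> P" using P(2)[of z x] by simp
  qed
  have sup: "P \<subseteq> {0<..a}" using P(1) cSup_upper[OF _ bdd] by (auto simp: a_def)
  have eq: "(\<integral>\<^sup>+ \<theta>\<in>P. h \<theta> \<partial>lborel) = (\<integral>\<^sup>+ \<theta>\<in>{0<..<a}. h \<theta> \<partial>lborel)" for h :: "real \<Rightarrow> ennreal"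
  proof (rule nn_integral_cong_AE)
    have "\<theta> \<in> P \<longleftrightarrow> \<theta> \<in> {0<..<a}" if "\<theta> \<noteq> a" for \<theta>
    proof
      assume "\<theta> \<in> P" thus "\<theta> \<in> {0<..<a}" using sup that by fastforce
    qed (use sub in blast)
    thus "AE \<theta> in lborel. h \<theta> * indicator P \<theta> = h \<theta> * indicator {0<..<a} \<theta>"
      using AE_lborel_singleton[of a] by (auto elim!: eventually_mono simp: indicator_def)
  qed
  obtain \<delta> where \<delta>: "\<delta> > 0" "\<And>\<theta>. \<theta> \<in> P \<Longrightarrow> \<theta> < \<delta> \<Longrightarrow> U \<theta> = 0" using U0[OF False] by blast
  \<comment> \<open>\<open>U\<close> is known to vanish only at points of \<open>P\<close>, so the
    new bound must also stay below \<open>a\<close>; halving makes both inequalities strict.\<close>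
  define \<delta>' where "\<delta>' = min \<delta> a / 2"
  have d': "0 < \<delta>'" "\<delta>' < \<delta>" "\<delta>' < a" using \<delta>(1) y' ya by (auto simp: \<delta>'_def min_def)
  have U0': "U \<theta> = 0" if "\<theta> \<in> {0<..\<delta>'}" for \<theta>
    using \<delta>(2)[of \<theta>] subsetD[OF sub, of \<theta>] that d' by auto
  show ?thesis unfolding eq by (rule half_hardy[OF b c U d'(1) U0' a])
qed simp

text \<open>A slice of the domain at fixed radius. Monotonicity of \<open>r\<close> makes its left
  half, and the mirror image of its right half, an initial segment; a nonempty half forces the
  radius below \<open>r 0\<close> or \<open>r \<beta>\<close>, and then the corresponding vanishing
  condition is available.\<close>

lemma arc_hardy:
  fixes r :: "real \<Rightarrow> real"
  assumes b: "0 < \<beta>" "\<beta> \<le> 2 * pi" and c: "wedge_hardy \<beta> c"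
    and U: "\<And>x. (U has_real_derivative U' x) (at x)" "smooth1 U'"
    and r: "continuous_on {0..\<beta>} r"
      "\<And>x y. 0 \<le> x \<Longrightarrow> x \<le> y \<Longrightarrow> y \<le> \<beta> / 2 \<Longrightarrow> r y \<le> r x"
      "\<And>x y. \<beta> / 2 \<le> x \<Longrightarrow> x \<le> y \<Longrightarrow> y \<le> \<beta> \<Longrightarrow> r x \<le> r y"
    and U0: "\<rho> < r 0 \<Longrightarrow> \<exists>\<delta>>0. \<forall>\<theta>. 0 < \<theta> \<longrightarrow> \<theta> < \<beta> \<longrightarrow> \<rho> < r \<theta> \<longrightarrow> \<theta> < \<delta> \<longrightarrow> U \<theta> = 0"
    and U1: "\<rho> < r \<beta> \<Longrightarrow> \<exists>\<delta>>0. \<forall>\<theta>. 0 < \<theta> \<longrightarrow> \<theta> < \<beta> \<longrightarrow> \<rho> < r \<theta> \<longrightarrow> \<beta> - \<delta> < \<theta> \<longrightarrow> U \<theta> = 0"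
  shows "ennreal c * (\<integral>\<^sup>+ \<theta>\<in>{\<theta>. 0 < \<theta> \<and> \<theta> < \<beta> \<and> \<rho> < r \<theta>}. ennreal (ang_pot \<beta> \<theta> * (U \<theta>)\<^sup>2) \<partial>lborel)
    \<le> (\<integral>\<^sup>+ \<theta>\<in>{\<theta>. 0 < \<theta> \<and> \<theta> < \<beta> \<and> \<rho> < r \<theta>}. ennreal ((U' \<theta>)\<^sup>2) \<partial>lborel)"
proof -
  have sU: "smooth1 U" using smooth1_antideriv U by blast
  note [measurable] = smooth1_measurable[OF sU] smooth1_measurable[OF U(2)]
  define A where "A = {\<theta>. 0 < \<theta> \<and> \<theta> < \<beta> \<and> \<rho> < r \<theta>}"
  define P where "P = {\<theta>. 0 < \<theta> \<and> \<theta> < \<beta> / 2 \<and> \<rho> < r \<theta>}"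
  define Q where "Q = {\<theta>. 0 < \<theta> \<and> \<theta> < \<beta> / 2 \<and> \<rho> < r (\<beta> - \<theta>)}"
  have "open ({0<..<\<beta>} \<inter> r -` {\<rho><..})"
    by (rule continuous_open_preimage[OF continuous_on_subset[OF r(1)]]) auto
  also have "{0<..<\<beta>} \<inter> r -` {\<rho><..} = A" by (auto simp: A_def)
  finally have [measurable]: "A \<in> sets borel" by simp
  have P': "P = A \<inter> {..<\<beta> / 2}" using b by (auto simp: A_def P_def)
  have Q': "Q = {\<theta>. \<beta> - \<theta> \<in> A \<inter> {\<beta> / 2<..}}" using b by (auto simp: A_def Q_def)
  have [measurable]: "P \<in> sets borel" unfolding P' by simp
  have [measurable]: "A \<inter> {\<beta> / 2<..} \<in> sets borel" by simp
  \<comment> \<open>The midpoint is a null set, and the right half is reflected to start at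
    0.\<close>
  have split: "(\<integral>\<^sup>+ \<theta>\<in>A. h \<theta> \<partial>lborel) = (\<integral>\<^sup>+ \<theta>\<in>P. h \<theta> \<partial>lborel) + (\<integral>\<^sup>+ \<theta>\<in>Q. h (\<beta> - \<theta>) \<partial>lborel)"
    if [measurable]: "h \<in> borel_measurable borel" for h :: "real \<Rightarrow> ennreal"
  proof -
    have "(\<integral>\<^sup>+ \<theta>\<in>A. h \<theta> \<partial>lborel) = (\<integral>\<^sup>+ \<theta>. h \<theta> * indicator P \<theta> + h \<theta> * indicator (A \<inter> {\<beta> / 2<..}) \<theta> \<partial>lborel)"
      using AE_lborel_singleton[of "\<beta> / 2"]
      by (intro nn_integral_cong_AE) (auto elim!: eventually_mono simp: indicator_def P')
    also have "\<dots> = (\<integral>\<^sup>+ \<theta>\<in>P. h \<theta> \<partial>lborel) + (\<integral>\<^sup>+ \<theta>\<in>A \<inter> {\<beta> / 2<..}. h \<theta> \<partial>lborel)"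
      by (rule nn_integral_add) measurable
    also have "(\<integral>\<^sup>+ \<theta>\<in>A \<inter> {\<beta> / 2<..}. h \<theta> \<partial>lborel)
        = (\<integral>\<^sup>+ \<theta>. h (\<beta> - \<theta>) * indicator (A \<inter> {\<beta> / 2<..}) (\<beta> - \<theta>) \<partial>lborel)"
      by (subst nn_integral_real_affine[where c = "-1" and t = \<beta>]) auto
    also have "\<dots> = (\<integral>\<^sup>+ \<theta>\<in>Q. h (\<beta> - \<theta>) \<partial>lborel)"
      by (intro nn_integral_cong) (auto simp: Q' indicator_def)
    finally show ?thesis .
  qed
  have dU: "((\<lambda>\<theta>. U (\<beta> - \<theta>)) has_real_derivative - U' (\<beta> - x)) (at x)" for x
  proof -
    have "((\<lambda>\<theta>. \<beta> - \<theta>) has_real_derivative - 1) (at x)" by (auto intro!: derivative_eq_intros)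
    from DERIV_chain2[OF U(1) this] show ?thesis by simp
  qed
  have "smooth1 (\<lambda>x. \<beta> - x)" by (intro smooth1_intros)
  hence "smooth1 (\<lambda>x. -1 * U' (\<beta> - x))" by (intro smooth1_intros smooth1_compose[OF U(2)])
  hence sU': "smooth1 (\<lambda>x. - U' (\<beta> - x))" by simp
  have I1: "ennreal c * (\<integral>\<^sup>+ \<theta>\<in>P. ennreal (ang_pot \<beta> \<theta> * (U \<theta>)\<^sup>2) \<partial>lborel)
    \<le> (\<integral>\<^sup>+ \<theta>\<in>P. ennreal ((U' \<theta>)\<^sup>2) \<partial>lborel)"
  proof (rule half_hardy_initial_segment[OF b c U])
    show "P \<subseteq> {0<..<\<beta> / 2}" by (auto simp: P_def)
    show "x \<in> P" if "y \<in> P" "0 < x" "x \<le> y" for x y using that r(2)[of x y] by (auto simp: P_def)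
    assume "P \<noteq> {}"
    then obtain y where "0 < y" "y < \<beta> / 2" "\<rho> < r y" by (auto simp: P_def)
    hence "\<rho> < r 0" using r(2)[of 0 y] by simp
    then obtain \<delta> where "\<delta> > 0" "\<forall>\<theta>. 0 < \<theta> \<longrightarrow> \<theta> < \<beta> \<longrightarrow> \<rho> < r \<theta> \<longrightarrow> \<theta> < \<delta> \<longrightarrow> U \<theta> = 0" using U0 by blast
    thus "\<exists>\<delta>>0. \<forall>\<theta>\<in>P. \<theta> < \<delta> \<longrightarrow> U \<theta> = 0" unfolding P_def using b by (intro exI[of _ \<delta>]) auto
  qed
  have I2: "ennreal c * (\<integral>\<^sup>+ \<theta>\<in>Q. ennreal (ang_pot \<beta> \<theta> * (U (\<beta> - \<theta>))\<^sup>2) \<partial>lborel)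
    \<le> (\<integral>\<^sup>+ \<theta>\<in>Q. ennreal ((- U' (\<beta> - \<theta>))\<^sup>2) \<partial>lborel)"
  proof (rule half_hardy_initial_segment[OF b c dU sU'])
    show "Q \<subseteq> {0<..<\<beta> / 2}" by (auto simp: Q_def)
    show "x \<in> Q" if "y \<in> Q" "0 < x" "x \<le> y" for x y using that r(3)[of "\<beta> - y" "\<beta> - x"] by (auto simp: Q_def)
    assume "Q \<noteq> {}"
    then obtain y where "0 < y" "y < \<beta> / 2" "\<rho> < r (\<beta> - y)" by (auto simp: Q_def)
    hence "\<rho> < r \<beta>" using r(3)[of "\<beta> - y" \<beta>] by simp
    then obtain \<delta> where "\<delta> > 0" "\<forall>\<theta>. 0 < \<theta> \<longrightarrow> \<theta> < \<beta> \<longrightarrow> \<rho> < r \<theta> \<longrightarrow> \<beta> - \<delta> < \<theta> \<longrightarrow> U \<theta> = 0" using U1 by blast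
    thus "\<exists>\<delta>>0. \<forall>\<theta>\<in>Q. \<theta> < \<delta> \<longrightarrow> U (\<beta> - \<theta>) = 0" unfolding Q_def using b by (intro exI[of _ \<delta>]) auto
  qed
  have "ennreal c * (\<integral>\<^sup>+ \<theta>\<in>A. ennreal (ang_pot \<beta> \<theta> * (U \<theta>)\<^sup>2) \<partial>lborel)
      \<le> (\<integral>\<^sup>+ \<theta>\<in>A. ennreal ((U' \<theta>)\<^sup>2) \<partial>lborel)"
    using add_mono[OF I1 I2]
    by (subst (1 2) split) (simp_all add: ang_pot_reflect[OF b] distrib_left)
  thus ?thesis unfolding A_def .
qed

text \<open>On each circle the radial derivative is dropped from the gradient and the distance to
  \<open>Gamma0\<close> is replaced by the smaller distance to the full rays. Both changes
  strengthen what is to be shown and lead to the angular inequality on the slice.\<close>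

lemma Dom_hardy:
  assumes b: "0 < \<beta>" "\<beta> \<le> 2 * pi" and c: "wedge_hardy \<beta> c"
    and r: "continuous_on {0..\<beta>} r"
      "\<And>x y. 0 \<le> x \<Longrightarrow> x \<le> y \<Longrightarrow> y \<le> \<beta> / 2 \<Longrightarrow> r y \<le> r x"
      "\<And>x y. \<beta> / 2 \<le> x \<Longrightarrow> x \<le> y \<Longrightarrow> y \<le> \<beta> \<Longrightarrow> r x \<le> r y"
    and r0: "0 < r 0" and u: "u \<in> admissible \<beta> r"
  shows "ennreal c * (\<integral>\<^sup>+ x \<in> Dom \<beta> r. ennreal ((u x)\<^sup>2 / (infdist x (Gamma0 \<beta> r))\<^sup>2) \<partial>lborel)
    \<le> (\<integral>\<^sup>+ x \<in> Dom \<beta> r. ennreal (grad_sq u x) \<partial>lborel)"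
proof -
  let ?q = "\<lambda>x. (u x)\<^sup>2 / (infdist x (Gamma0 \<beta> r))\<^sup>2"
  have su: "smooth_R2 u" using u by (simp add: admissible_def)
  obtain O' where O': "open O'" "Gamma0 \<beta> r \<subseteq> O'" "\<And>x. x \<in> O' \<Longrightarrow> x \<in> closure (Dom \<beta> r) \<Longrightarrow> u x = 0"
    using u unfolding admissible_def by blast
  obtain u1 u2 where du: "\<And>x. (u has_derivative (\<lambda>h. fst h * u1 x + snd h * u2 x)) (at x)"
    using su by (rule smooth_R2_gradE) blast
  have mg: "(\<lambda>x. ennreal (grad_sq u x)) \<in> borel_measurable borel" using grad_sq_measurable[OF su] by simp
  have [measurable]: "u \<in> borel_measurable borel"
    by (rule borel_measurable_continuous_onI[OF smooth_R2_continuous[OF su]])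
  have [measurable]: "(\<lambda>x. infdist x (Gamma0 \<beta> r)) \<in> borel_measurable borel"
    by (intro borel_measurable_continuous_onI continuous_on_infdist continuous_intros)
  have mv: "(\<lambda>x. ennreal c * ennreal (?q x)) \<in> borel_measurable borel" by simp
  have [measurable]: "Dom \<beta> r \<in> sets borel" using open_Dom[OF b(2) r(1)] by simp
  have Gne: "Gamma0 \<beta> r \<noteq> {}" using r0 unfolding Gamma0_def by fastforce
  have "ennreal c * (\<integral>\<^sup>+ x \<in> Dom \<beta> r. ennreal (?q x) \<partial>lborel)
      = (\<integral>\<^sup>+ x \<in> Dom \<beta> r. ennreal c * ennreal (?q x) \<partial>lborel)"
    by (subst nn_integral_cmult[symmetric]) (auto simp: mult.assoc)
  also have "\<dots> \<le> (\<integral>\<^sup>+ x \<in> Dom \<beta> r. ennreal (grad_sq u x) \<partial>lborel)"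
    unfolding nn_integral_Dom[OF b(2) r(1) mv] nn_integral_Dom[OF b(2) r(1) mg]
  proof (rule nn_integral_mono)
    fix \<rho> :: real
    let ?A = "{\<theta>. 0 < \<theta> \<and> \<theta> < \<beta> \<and> \<rho> < r \<theta>}"
    show "(\<integral>\<^sup>+ \<theta>\<in>?A. ennreal \<rho> * (ennreal c * ennreal (?q (pol \<rho> \<theta>))) \<partial>lborel) * indicator {0<..} \<rho>
      \<le> (\<integral>\<^sup>+ \<theta>\<in>?A. ennreal \<rho> * ennreal (grad_sq u (pol \<rho> \<theta>)) \<partial>lborel) * indicator {0<..} \<rho>"
    proof (cases "\<rho> > 0")
      case True
      define U where "U \<theta> = u (pol \<rho> \<theta>)" for \<theta>
      have "smooth1 (\<lambda>t. \<rho> * cos t)" "smooth1 (\<lambda>t. \<rho> * sin t)"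
        by (intro smooth1_intros smooth1_sin_cos)+
      hence sU: "smooth1 U" unfolding U_def[abs_def] pol_def by (rule smooth_R2_curve[OF su])
      then obtain U' where U': "\<And>x. (U has_real_derivative U' x) (at x)" "smooth1 U'"
        by (rule smooth1_derivE) blast
      note [measurable] = smooth1_measurable[OF sU] smooth1_measurable[OF U'(2)]
      have [measurable]: "?A \<in> sets borel"
      proof -
        have "open ({0<..<\<beta>} \<inter> r -` {\<rho><..})"
          by (rule continuous_open_preimage[OF continuous_on_subset[OF r(1)]]) auto
        also have "{0<..<\<beta>} \<inter> r -` {\<rho><..} = ?A" by auto
        finally show ?thesis by simp
      qed
      have U'eq: "U' \<theta> = - u1 (pol \<rho> \<theta>) * (\<rho> * sin \<theta>) + u2 (pol \<rho> \<theta>) * (\<rho> * cos \<theta>)" for \<theta>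
      proof -
        have "((\<lambda>t. pol \<rho> t) has_derivative (\<lambda>h. (- (\<rho> * sin \<theta>) * h, \<rho> * cos \<theta> * h))) (at \<theta>)"
          unfolding pol_def
          by (intro has_derivative_Pair) (auto intro!: derivative_eq_intros simp: fun_eq_iff)
        from has_derivative_compose[OF this du]
        have "(U has_real_derivative (- u1 (pol \<rho> \<theta>) * (\<rho> * sin \<theta>) + u2 (pol \<rho> \<theta>) * (\<rho> * cos \<theta>))) (at \<theta>)"
          unfolding has_field_derivative_def U_def[abs_def]
          by (rule has_derivative_eq_rhs) (simp add: fun_eq_iff algebra_simps)
        thus ?thesis using DERIV_unique U'(1) by blast
      qed
      \<comment> \<open>The squares of the tangential and radial components add up to the square of
        the gradient, and \<open>U'\<close> is \<open>\<rho>\<close> times the tangential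
        one.\<close>
      have gr: "(U' \<theta>)\<^sup>2 / \<rho> \<le> \<rho> * grad_sq u (pol \<rho> \<theta>)" for \<theta>
      proof -
        define x y s k where "x = u1 (pol \<rho> \<theta>)" and "y = u2 (pol \<rho> \<theta>)" and "s = sin \<theta>" and "k = cos \<theta>"
        have "(U' \<theta>)\<^sup>2 + \<rho>\<^sup>2 * (x * k + y * s)\<^sup>2 = \<rho>\<^sup>2 * ((x\<^sup>2 + y\<^sup>2) * (s\<^sup>2 + k\<^sup>2))"
          unfolding U'eq x_def[symmetric] y_def[symmetric] s_def[symmetric] k_def[symmetric]
          by (simp add: power2_eq_square algebra_simps)
        also have "\<dots> = \<rho>\<^sup>2 * grad_sq u (pol \<rho> \<theta>)"
          unfolding grad_sq_eq[OF du] by (simp add: x_def y_def s_def k_def)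
        finally have "(U' \<theta>)\<^sup>2 \<le> \<rho>\<^sup>2 * grad_sq u (pol \<rho> \<theta>)"
          by (metis le_add_same_cancel1 mult_nonneg_nonneg zero_le_power2)
        thus ?thesis using True by (simp add: field_simps power2_eq_square)
      qed
      have pt: "\<rho> * (?q (pol \<rho> \<theta>)) \<le> 1 / \<rho> * (ang_pot \<beta> \<theta> * (U \<theta>)\<^sup>2)"
        if "0 < \<theta>" "\<theta> < \<beta>" for \<theta>
      proof -
        define d where "d = infdist (pol 1 \<theta>) (rays \<beta>)"
        have d: "d > 0" unfolding d_def by (rule infdist_pol_bounds[OF b that])
        \<comment> \<open>\<open>Gamma0\<close> is a subset of the rays, so its distance is at least
          as large, and the distance to the rays scales with \<open>\<rho>\<close>.\<close>
        have "\<rho> * d \<le> infdist (pol \<rho> \<theta>) (Gamma0 \<beta> r)"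
          using infdist_mono[OF Gamma0_subset_rays Gne, of "pol \<rho> \<theta>"]
          unfolding infdist_pol_scale[OF b True] d_def .
        hence "(U \<theta>)\<^sup>2 / (infdist (pol \<rho> \<theta>) (Gamma0 \<beta> r))\<^sup>2 \<le> (U \<theta>)\<^sup>2 / (\<rho> * d)\<^sup>2"
          using d True by (intro divide_left_mono power_mono mult_pos_pos zero_less_power) (auto intro: less_le_trans[of 0 "\<rho> * d"])
        hence "\<rho> * ((U \<theta>)\<^sup>2 / (infdist (pol \<rho> \<theta>) (Gamma0 \<beta> r))\<^sup>2) \<le> \<rho> * ((U \<theta>)\<^sup>2 / (\<rho> * d)\<^sup>2)"
          using True by (intro mult_left_mono) auto
        also have "\<dots> = 1 / \<rho> * (ang_pot \<beta> \<theta> * (U \<theta>)\<^sup>2)"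
          using True d by (simp add: ang_pot_def d_def[symmetric] power2_eq_square field_simps)
        finally show ?thesis by (simp add: U_def)
      qed
      have near: "\<exists>\<delta>>0. \<forall>\<theta>. \<bar>\<theta> - \<theta>0\<bar> < \<delta> \<longrightarrow> pol \<rho> \<theta> \<in> O'" if "pol \<rho> \<theta>0 \<in> O'" for \<theta>0
      proof -
        have "open ((\<lambda>\<theta>. pol \<rho> \<theta>) -` O')" unfolding pol_def
          by (intro continuous_open_vimage O') (auto intro!: continuous_intros)
        with that show ?thesis unfolding open_dist by (auto simp: dist_real_def)
      qed
      have inD: "pol \<rho> \<theta> \<in> closure (Dom \<beta> r)" if "0 < \<theta>" "\<theta> < \<beta>" "\<rho> < r \<theta>" for \<theta>
        using that True b closure_subset[of "Dom \<beta> r"] by (auto simp: Dom_iff ang_pol norm_pol)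
      have arc: "ennreal c * (\<integral>\<^sup>+ \<theta>\<in>?A. ennreal (ang_pot \<beta> \<theta> * (U \<theta>)\<^sup>2) \<partial>lborel)
          \<le> (\<integral>\<^sup>+ \<theta>\<in>?A. ennreal ((U' \<theta>)\<^sup>2) \<partial>lborel)"
      proof (rule arc_hardy[OF b c U' r])
        assume "\<rho> < r 0"
        hence "pol \<rho> 0 \<in> O'" using O'(2) True by (auto simp: Gamma0_def pol_def)
        from near[OF this] obtain \<delta> where \<delta>: "\<delta> > 0" "\<And>\<theta>. \<bar>\<theta> - 0\<bar> < \<delta> \<Longrightarrow> pol \<rho> \<theta> \<in> O'" by blast
        thus "\<exists>\<delta>>0. \<forall>\<theta>. 0 < \<theta> \<longrightarrow> \<theta> < \<beta> \<longrightarrow> \<rho> < r \<theta> \<longrightarrow> \<theta> < \<delta> \<longrightarrow> U \<theta> = 0"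
          using inD O'(3) by (intro exI[of _ \<delta>]) (auto simp: U_def)
      next
        assume "\<rho> < r \<beta>"
        hence "pol \<rho> \<beta> \<in> Gamma0 \<beta> r" using True unfolding Gamma0_def pol_def
          by (intro UnI2 CollectI exI[of _ \<rho>]) simp
        hence "pol \<rho> \<beta> \<in> O'" using O'(2) by blast
        from near[OF this] obtain \<delta> where \<delta>: "\<delta> > 0" "\<And>\<theta>. \<bar>\<theta> - \<beta>\<bar> < \<delta> \<Longrightarrow> pol \<rho> \<theta> \<in> O'" by blast
        thus "\<exists>\<delta>>0. \<forall>\<theta>. 0 < \<theta> \<longrightarrow> \<theta> < \<beta> \<longrightarrow> \<rho> < r \<theta> \<longrightarrow> \<beta> - \<delta> < \<theta> \<longrightarrow> U \<theta> = 0"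
          using inD O'(3) by (intro exI[of _ \<delta>]) (auto simp: U_def)
      qed
      have "(\<integral>\<^sup>+ \<theta>\<in>?A. ennreal \<rho> * (ennreal c * ennreal (?q (pol \<rho> \<theta>))) \<partial>lborel)
        \<le> (\<integral>\<^sup>+ \<theta>. ennreal (1 / \<rho>) * (ennreal c * (ennreal (ang_pot \<beta> \<theta> * (U \<theta>)\<^sup>2) * indicator ?A \<theta>)) \<partial>lborel)"
      proof (rule nn_integral_mono)
        fix \<theta> :: real
        have "ennreal \<rho> * (ennreal c * ennreal (?q (pol \<rho> \<theta>)))
            \<le> ennreal (1 / \<rho>) * (ennreal c * ennreal (ang_pot \<beta> \<theta> * (U \<theta>)\<^sup>2))" if "0 < \<theta>" "\<theta> < \<beta>"
        proof -
          have "ennreal \<rho> * (ennreal c * ennreal (?q (pol \<rho> \<theta>)))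
              = ennreal c * ennreal (\<rho> * (?q (pol \<rho> \<theta>)))"
            using True by (subst ennreal_mult[of \<rho>]) (simp_all add: mult.left_commute)
          also have "\<dots> \<le> ennreal c * ennreal (1 / \<rho> * (ang_pot \<beta> \<theta> * (U \<theta>)\<^sup>2))"
            by (intro mult_left_mono ennreal_leI pt that) simp
          also have "\<dots> = ennreal (1 / \<rho>) * (ennreal c * ennreal (ang_pot \<beta> \<theta> * (U \<theta>)\<^sup>2))"
            using True by (subst ennreal_mult) (auto simp: ang_pot_nonneg mult.left_commute)
          finally show ?thesis .
        qed
        thus "ennreal \<rho> * (ennreal c * ennreal (?q (pol \<rho> \<theta>))) * indicator ?A \<theta>
            \<le> ennreal (1 / \<rho>) * (ennreal c * (ennreal (ang_pot \<beta> \<theta> * (U \<theta>)\<^sup>2) * indicator ?A \<theta>))"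
          by (cases "\<theta> \<in> ?A") auto
      qed
      also have "\<dots> = ennreal (1 / \<rho>) * (ennreal c * (\<integral>\<^sup>+ \<theta>\<in>?A. ennreal (ang_pot \<beta> \<theta> * (U \<theta>)\<^sup>2) \<partial>lborel))"
        by (subst nn_integral_cmult, measurable, subst nn_integral_cmult, measurable)
      also have "\<dots> \<le> ennreal (1 / \<rho>) * (\<integral>\<^sup>+ \<theta>\<in>?A. ennreal ((U' \<theta>)\<^sup>2) \<partial>lborel)"
        by (intro mult_left_mono arc) simp
      also have "\<dots> = (\<integral>\<^sup>+ \<theta>. ennreal (1 / \<rho>) * (ennreal ((U' \<theta>)\<^sup>2) * indicator ?A \<theta>) \<partial>lborel)"
        by (subst nn_integral_cmult, measurable)
      also have "\<dots> \<le> (\<integral>\<^sup>+ \<theta>\<in>?A. ennreal \<rho> * ennreal (grad_sq u (pol \<rho> \<theta>)) \<partial>lborel)"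
      proof (rule nn_integral_mono)
        fix \<theta> :: real
        have "ennreal (1 / \<rho>) * ennreal ((U' \<theta>)\<^sup>2) \<le> ennreal \<rho> * ennreal (grad_sq u (pol \<rho> \<theta>))"
        proof -
          have "0 \<le> grad_sq u (pol \<rho> \<theta>)" by (simp add: grad_sq_def)
          thus ?thesis using True gr[of \<theta>] by (simp add: ennreal_mult[symmetric] ennreal_leI)
        qed
        thus "ennreal (1 / \<rho>) * (ennreal ((U' \<theta>)\<^sup>2) * indicator ?A \<theta>) \<le> ennreal \<rho> * ennreal (grad_sq u (pol \<rho> \<theta>)) * indicator ?A \<theta>"
          by (cases "\<theta> \<in> ?A") auto
      qed
      finally show ?thesis using True by simp
    qed simp
  qed
  finally show ?thesis .
qed

section \<open>The admissible constants and their supremum\<close>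

lemma wedge_hardy_0: "wedge_hardy \<beta> 0"
  by (simp add: wedge_hardy_def)

text \<open>\<open>Sup\<close> of a set of reals says something only for a bounded set. A single
  angular test function bounds all constants, as the angular potential is at least 1 inside the
  wedge.\<close>

lemma bdd_above_wedge_hardy:
  assumes b: "0 < \<beta>" "\<beta> \<le> 2 * pi"
  shows "bdd_above {c. wedge_hardy \<beta> c}"
proof -
  \<comment> \<open>The two steps give a function equal to 1 on the middle fifth of the interval and
    0 on the first and the last.\<close>
  define w where "w t = smooth_step (3 * \<beta> / 5) (4 * \<beta> / 5) t * smooth_step (3 * \<beta> / 5) (4 * \<beta> / 5) (\<beta> - t)" for t
  have "smooth1 (\<lambda>x. \<beta> - x)" by (intro smooth1_intros)
  hence "smooth1 w" unfolding w_def[abs_def]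
    using b by (intro smooth1_intros smooth1_smooth_step smooth1_compose[OF smooth1_smooth_step, of _ _ "\<lambda>x. \<beta> - x"]) auto
  then obtain w' where w': "\<And>x. (w has_real_derivative w' x) (at x)" "smooth1 w'" by (rule smooth1_derivE) blast
  have w0: "w t = 0" if "t \<in> {0<..<\<beta>}" "t \<notin> {\<beta> / 5..\<beta> - \<beta> / 5}" for t
    using that smooth_step_ge[of "4 * \<beta> / 5" t "3 * \<beta> / 5"] smooth_step_ge[of "4 * \<beta> / 5" "\<beta> - t" "3 * \<beta> / 5"]
    by (auto simp: w_def)
  have d: "0 < \<beta> / 5" using b by simp
  have w1: "w t = 1" if "t \<in> {2 * \<beta> / 5..3 * \<beta> / 5}" for t
    using that b by (auto simp: w_def smooth_step_le)
  obtain N where N: "0 \<le> N" and D: "(\<integral>\<^sup>+ \<theta>\<in>{0<..<\<beta>}. ennreal ((w' \<theta>)\<^sup>2) \<partial>lborel) \<le> ennreal (N * \<beta>)"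
    using nn_integral_square_bounded[OF b(1) smooth1_continuous_on[OF w'(2)]] by blast
  have V: "ennreal (\<beta> / 5) \<le> (\<integral>\<^sup>+ \<theta>\<in>{0<..<\<beta>}. ennreal (ang_pot \<beta> \<theta> * (w \<theta>)\<^sup>2) \<partial>lborel)"
  proof -
    have "ennreal (\<beta> / 5) = (\<integral>\<^sup>+ \<theta>. indicator {2 * \<beta> / 5..3 * \<beta> / 5} \<theta> \<partial>lborel)" using b by simp
    also have "\<dots> \<le> (\<integral>\<^sup>+ \<theta>\<in>{0<..<\<beta>}. ennreal (ang_pot \<beta> \<theta> * (w \<theta>)\<^sup>2) \<partial>lborel)"
    proof (rule nn_integral_mono)
      fix \<theta> :: real
      have "1 \<le> ennreal (ang_pot \<beta> \<theta> * (w \<theta>)\<^sup>2)" if "\<theta> \<in> {2 * \<beta> / 5..3 * \<beta> / 5}"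
        using ang_pot_ge_1[OF b, of \<theta>] w1[OF that] that b by simp
      thus "indicator {2 * \<beta> / 5..3 * \<beta> / 5} \<theta> \<le> ennreal (ang_pot \<beta> \<theta> * (w \<theta>)\<^sup>2) * indicator {0<..<\<beta>} \<theta>"
        using b by (auto simp: indicator_def)
    qed
    finally show ?thesis .
  qed
  have "c \<le> 5 * N" if c: "wedge_hardy \<beta> c" for c
  proof -
    have c0: "c \<ge> 0" using c by (simp add: wedge_hardy_def)
    have "ennreal (c * (\<beta> / 5)) = ennreal c * ennreal (\<beta> / 5)" using c0 b by (intro ennreal_mult) auto
    also have "\<dots> \<le> ennreal c * (\<integral>\<^sup>+ \<theta>\<in>{0<..<\<beta>}. ennreal (ang_pot \<beta> \<theta> * (w \<theta>)\<^sup>2) \<partial>lborel)"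
      by (intro mult_left_mono V) simp
    also have "\<dots> \<le> (\<integral>\<^sup>+ \<theta>\<in>{0<..<\<beta>}. ennreal ((w' \<theta>)\<^sup>2) \<partial>lborel)"
      by (rule angular_hardy[OF b c w' d w0])
    also note D
    finally have "c * (\<beta> / 5) \<le> N * \<beta>" using b N by (simp add: ennreal_le_iff)
    thus ?thesis using b by (simp add: field_simps)
  qed
  thus ?thesis by (intro bdd_aboveI[where M = "5 * N"]) simp
qed

text \<open>Passing from each constant to the supremum is a division by \<open>X\<close>, so the
  values 0 and \<open>top\<close> of \<open>X\<close> are handled apart.\<close>

lemma ennreal_Sup_mult_le:
  assumes "S \<noteq> {}" "\<And>c. c \<in> S \<Longrightarrow> ennreal c * X \<le> Y"
  shows "ennreal (Sup S) * X \<le> Y"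
proof (cases "Y = top")
  case False
  then obtain y where y: "Y = ennreal y" "y \<ge> 0" by (cases Y) auto
  show ?thesis
  proof (cases "X = top")
    case True
    \<comment> \<open>A positive constant times \<open>top\<close> would exceed the finite
      \<open>Y\<close>.\<close>
    have "c \<le> 0" if "c \<in> S" for c
      using assms(2)[OF that] True y by (auto simp: ennreal_mult_top ennreal_eq_0_iff top_unique split: if_splits)
    hence "Sup S \<le> 0" using assms(1) by (intro cSup_least) auto
    thus ?thesis using True by (simp add: ennreal_neg)
  next
    case False
    then obtain x where x: "X = ennreal x" "x \<ge> 0" by (cases X) auto
    show ?thesis
    proof (cases "x = 0")
      case False
      have "c \<le> y / x" if "c \<in> S" for c
      proof (cases "c \<ge> 0")
        case True
        hence "ennreal (c * x) \<le> ennreal y" using assms(2)[OF that] x y by (simp add: ennreal_mult)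
        hence "c * x \<le> y" using y by (simp add: ennreal_le_iff)
        thus ?thesis using x \<open>x \<noteq> 0\<close> by (simp add: field_simps)
      next
        case False
        have "0 \<le> y / x" using x y by simp
        with False show ?thesis by linarith
      qed
      hence "Sup S \<le> y / x" using assms(1) by (intro cSup_least) auto
      hence "ennreal (Sup S) * ennreal x \<le> ennreal (y / x) * ennreal x" by (intro mult_right_mono ennreal_leI) auto
      also have "\<dots> = Y" using x y False by (simp add: ennreal_mult[symmetric])
      finally show ?thesis using x by simp
    qed (use x in simp)
  qed
qed simp

section \<open>Sharpness\<close>

lemma nn_integral_scaleR:
  fixes G :: "real \<times> real \<Rightarrow> ennreal"
  assumes [measurable]: "G \<in> borel_measurable borel" and k: "k > 0"
  shows "(\<integral>\<^sup>+ x. G x \<partial>lborel) = (\<integral>\<^sup>+ x. ennreal (k\<^sup>2) * G (k *\<^sub>R x) \<partial>lborel)"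
proof -
  have "lborel = density (distr lborel borel (\<lambda>x :: real \<times> real. 0 + k *\<^sub>R x)) (\<lambda>_. ennreal (\<bar>k\<bar> ^ DIM(real \<times> real)))"
    by (rule lborel_affine) (use k in simp)
  hence l: "lborel = density (distr lborel borel (\<lambda>x :: real \<times> real. k *\<^sub>R x)) (\<lambda>_. ennreal (k\<^sup>2))"
    using k by (simp add: power2_eq_square)
  have "(\<integral>\<^sup>+ x. G x \<partial>lborel) = (\<integral>\<^sup>+ x. G x \<partial>density (distr lborel borel (\<lambda>x :: real \<times> real. k *\<^sub>R x)) (\<lambda>_. ennreal (k\<^sup>2)))"
    using l by simp
  also have "\<dots> = (\<integral>\<^sup>+ x. ennreal (k\<^sup>2) * G (k *\<^sub>R x) \<partial>lborel)"
    by (simp add: nn_integral_density nn_integral_distr)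
  finally show ?thesis .
qed

lemma smooth_R2_scaleR:
  assumes "smooth_R2 u" shows "smooth_R2 (\<lambda>x. u (k *\<^sub>R x))"
proof -
  from assms obtain F where F: "u \<in> F" "\<And>g. g \<in> F \<Longrightarrow> \<exists>g1 g2. g1 \<in> F \<and> g2 \<in> F \<and>
      (\<forall>x. (g has_derivative (\<lambda>h. fst h * g1 x + snd h * g2 x)) (at x))"
    unfolding smooth_R2_def by blast
  \<comment> \<open>Every differentiation produces another factor \<open>k\<close>, so the family
    must be closed under scalar multiples.\<close>
  define F' where "F' = {\<lambda>x. a * g (k *\<^sub>R x) | a g. g \<in> F}"
  have "\<exists>h1 h2. h1 \<in> F' \<and> h2 \<in> F' \<and> (\<forall>x. (h has_derivative (\<lambda>y. fst y * h1 x + snd y * h2 x)) (at x))"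
    if h: "h \<in> F'" for h
  proof -
    obtain a g where ag: "h = (\<lambda>x. a * g (k *\<^sub>R x))" "g \<in> F" using h unfolding F'_def by blast
    obtain g1 g2 where g: "g1 \<in> F" "g2 \<in> F"
      "\<And>x. (g has_derivative (\<lambda>h. fst h * g1 x + snd h * g2 x)) (at x)" using F(2)[OF ag(2)] by blast
    have "(h has_derivative (\<lambda>y. fst y * (a * k * g1 (k *\<^sub>R x)) + snd y * (a * k * g2 (k *\<^sub>R x)))) (at x)" for x
    proof -
      have "((\<lambda>x :: real \<times> real. k *\<^sub>R x) has_derivative (\<lambda>y. k *\<^sub>R y)) (at x)" by (auto intro!: derivative_eq_intros)
      from has_derivative_mult_right[OF has_derivative_compose[OF this g(3)], of a]
      show ?thesis unfolding ag(1) by (rule has_derivative_eq_rhs) (simp add: fun_eq_iff algebra_simps)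
    qed
    moreover have "(\<lambda>x. a * k * g1 (k *\<^sub>R x)) \<in> F'" "(\<lambda>x. a * k * g2 (k *\<^sub>R x)) \<in> F'"
      unfolding F'_def using g(1,2) by blast+
    ultimately show ?thesis by blast
  qed
  moreover have "(\<lambda>x. u (k *\<^sub>R x)) \<in> F'" unfolding F'_def using F(1) by (auto intro!: exI[of _ 1] exI[of _ u])
  ultimately show ?thesis unfolding smooth_R2_def by blast
qed

lemma grad_sq_scaleR:
  assumes "smooth_R2 u" shows "grad_sq (\<lambda>x. u (k *\<^sub>R x)) x = k\<^sup>2 * grad_sq u (k *\<^sub>R x)"
proof -
  obtain u1 u2 where du: "\<And>x. (u has_derivative (\<lambda>h. fst h * u1 x + snd h * u2 x)) (at x)"
    using assms by (rule smooth_R2_gradE) blast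
  have "((\<lambda>x :: real \<times> real. k *\<^sub>R x) has_derivative (\<lambda>y. k *\<^sub>R y)) (at x)" by (auto intro!: derivative_eq_intros)
  from has_derivative_compose[OF this du]
  have "((\<lambda>x. u (k *\<^sub>R x)) has_derivative (\<lambda>y. fst y * (k * u1 (k *\<^sub>R x)) + snd y * (k * u2 (k *\<^sub>R x)))) (at x)"
    by (rule has_derivative_eq_rhs) (simp add: fun_eq_iff algebra_simps)
  from grad_sq_eq[OF this] grad_sq_eq[OF du, of "k *\<^sub>R x"] show ?thesis
    by (simp add: power_mult_distrib distrib_left)
qed

lemma grad_sq_zero:
  assumes "open S" "x \<in> S" "\<And>y. y \<in> S \<Longrightarrow> u y = 0" shows "grad_sq u x = 0"
proof -
  have "(u has_derivative (\<lambda>h. fst h * 0 + snd h * 0)) (at x)"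
    by (rule has_derivative_transform_within_open[of "\<lambda>x. 0" _ _ _ S]) (use assms in auto)
  from grad_sq_eq[OF this] show ?thesis by simp
qed

lemma ang_scaleR: "k > 0 \<Longrightarrow> ang (k *\<^sub>R x) = ang x"
proof (cases "x = 0")
  case False
  assume k: "k > 0"
  have "k *\<^sub>R x = k *\<^sub>R pol (norm x) (ang x)" by (simp add: pol_ang)
  also have "\<dots> = pol (k * norm x) (ang x)" by (simp add: pol_def)
  finally show ?thesis using k False ang_bounds[of x] by (simp add: ang_pol)
qed simp

text \<open>In the plane a dilation changes the area element by the square of the factor, which
  exactly balances the gradient square and the inverse square distance. Near the origin
  \<open>Gamma0\<close> and the full rays are indistinguishable.\<close>

lemma scaled_test_function:
  assumes b: "0 < \<beta>" "\<beta> \<le> 2 * pi" and r: "continuous_on {0..\<beta>} r" "\<And>\<theta>. \<theta> \<in> {0..\<beta>} \<Longrightarrow> 0 < r \<theta>"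
    and u: "u \<in> Cc_infty (wedge \<beta>)"
  obtains v where "v \<in> admissible \<beta> r"
    "(\<integral>\<^sup>+ x \<in> Dom \<beta> r. ennreal (grad_sq v x) \<partial>lborel) = (\<integral>\<^sup>+ x \<in> wedge \<beta>. ennreal (grad_sq u x) \<partial>lborel)"
    "(\<integral>\<^sup>+ x \<in> Dom \<beta> r. ennreal ((v x)\<^sup>2 / (infdist x (Gamma0 \<beta> r))\<^sup>2) \<partial>lborel)
      = (\<integral>\<^sup>+ x \<in> wedge \<beta>. ennreal ((u x)\<^sup>2 / (infdist x (frontier (wedge \<beta>)))\<^sup>2) \<partial>lborel)"
proof -
  obtain K where K: "compact K" "K \<subseteq> wedge \<beta>" "\<And>x. x \<notin> K \<Longrightarrow> u x = 0" and su: "smooth_R2 u"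
    using u unfolding Cc_infty_def by blast
  obtain R where R: "R > 0" "\<And>x. x \<in> K \<Longrightarrow> norm x \<le> R"
    using compact_imp_bounded[OF K(1)] bounded_pos by blast
  obtain \<theta>0 where \<theta>0: "\<theta>0 \<in> {0..\<beta>}" "\<And>\<theta>. \<theta> \<in> {0..\<beta>} \<Longrightarrow> r \<theta>0 \<le> r \<theta>"
    using continuous_attains_inf[OF compact_Icc _ r(1)] b by auto
  define m where "m = r \<theta>0"
  have m: "m > 0" "\<And>\<theta>. \<theta> \<in> {0..\<beta>} \<Longrightarrow> m \<le> r \<theta>" using \<theta>0 r(2) by (auto simp: m_def)
  \<comment> \<open>The factor 4 brings the support within norm \<open>m / 4\<close>. A nearest
    point on the rays is no farther away than the origin, so it has norm at most
    \<open>m / 2\<close>, below both \<open>r 0\<close> and \<open>r \<beta>\<close>, and lies in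
    \<open>Gamma0\<close>.\<close>
  define k where "k = 4 * R / m"
  have k: "k > 0" using R m by (simp add: k_def)
  define v where "v x = u (k *\<^sub>R x)" for x
  define K' where "K' = (\<lambda>x. k *\<^sub>R x) -` K"
  have K'c: "closed K'" unfolding K'_def
    by (rule continuous_closed_vimage[OF compact_imp_closed[OF K(1)]]) (auto intro!: continuous_intros)
  have wk: "k *\<^sub>R x \<in> wedge \<beta> \<longleftrightarrow> x \<in> wedge \<beta>" for x using k b by (simp add: wedge_iff ang_scaleR)
  have K'w: "x \<in> wedge \<beta>" if "x \<in> K'" for x
    using that K(2) wk[of x] unfolding K'_def by blast
  have K'n: "norm x \<le> m / 4" if "x \<in> K'" for x
  proof -
    have "k * norm x \<le> R" using R(2)[of "k *\<^sub>R x"] that k by (simp add: K'_def)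
    thus ?thesis using R m by (simp add: k_def field_simps)
  qed
  have v0: "v x = 0" if "x \<notin> K'" for x using that K(3) by (simp add: v_def K'_def)
  have K'D: "x \<in> Dom \<beta> r" if "x \<in> K'" for x
  proof -
    have A: "0 < ang x" "ang x < \<beta>" using K'w[OF that] b by (auto simp: wedge_iff)
    hence "m \<le> r (ang x)" by (intro m) auto
    thus ?thesis using A K'n[OF that] m(1) b by (simp add: Dom_iff)
  qed
  have DW: "Dom \<beta> r \<subseteq> wedge \<beta>" using b by (auto simp: Dom_iff wedge_iff)
  have sv: "smooth_R2 v" unfolding v_def[abs_def] by (rule smooth_R2_scaleR[OF su])
  have rW: "rays \<beta> \<inter> wedge \<beta> = {}"
    unfolding frontier_wedge[OF b, symmetric] frontier_def interior_open[OF open_wedge[OF b(2)]] by blast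
  have adm: "v \<in> admissible \<beta> r" unfolding admissible_def
  proof (intro CollectI conjI exI[of _ "- K'"])
    show "Gamma0 \<beta> r \<subseteq> - K'" using Gamma0_subset_rays rW K'w by blast
  qed (use sv K'c v0 in auto)
  have g0: "grad_sq v x = 0" if "x \<notin> K'" for x
    by (rule grad_sq_zero[of "- K'"]) (use that K'c v0 in auto)
  have [measurable]: "wedge \<beta> \<in> sets borel" using open_wedge[OF b(2)] by simp
  have [measurable]: "(\<lambda>x. grad_sq u x) \<in> borel_measurable borel" using grad_sq_measurable[OF su] by simp
  have [measurable]: "u \<in> borel_measurable borel"
    by (rule borel_measurable_continuous_onI[OF smooth_R2_continuous[OF su]])
  have [measurable]: "(\<lambda>x. infdist x (rays \<beta>)) \<in> borel_measurable borel"
    by (intro borel_measurable_continuous_onI continuous_on_infdist continuous_intros)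
  have "(\<integral>\<^sup>+ x \<in> wedge \<beta>. ennreal (grad_sq u x) \<partial>lborel)
      = (\<integral>\<^sup>+ x. ennreal (k\<^sup>2) * (ennreal (grad_sq u (k *\<^sub>R x)) * indicator (wedge \<beta>) (k *\<^sub>R x)) \<partial>lborel)"
    by (rule nn_integral_scaleR) (use k in measurable)
  also have "\<dots> = (\<integral>\<^sup>+ x \<in> Dom \<beta> r. ennreal (grad_sq v x) \<partial>lborel)"
  proof (rule nn_integral_cong)
    fix x :: "real \<times> real"
    have "ennreal (k\<^sup>2) * ennreal (grad_sq u (k *\<^sub>R x)) = ennreal (grad_sq v x)"
      using grad_sq_scaleR[OF su, of k x] k unfolding v_def[abs_def]
      by (simp add: ennreal_mult grad_sq_def)
    thus "ennreal (k\<^sup>2) * (ennreal (grad_sq u (k *\<^sub>R x)) * indicator (wedge \<beta>) (k *\<^sub>R x))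
        = ennreal (grad_sq v x) * indicator (Dom \<beta> r) x"
      using g0[of x] K'D[of x] K'w[of x] wk[of x] by (cases "x \<in> K'") (auto simp: indicator_def mult.assoc[symmetric])
  qed
  finally have G: "(\<integral>\<^sup>+ x \<in> Dom \<beta> r. ennreal (grad_sq v x) \<partial>lborel) = (\<integral>\<^sup>+ x \<in> wedge \<beta>. ennreal (grad_sq u x) \<partial>lborel)" ..
  have dist: "infdist x (Gamma0 \<beta> r) = infdist x (rays \<beta>)" if x: "x \<in> K'" for x
  proof (rule antisym)
    obtain p where p: "p \<in> rays \<beta>" "infdist x (rays \<beta>) = dist x p"
      using infdist_attains_inf[OF closed_rays[OF b] rays_ne] by blast
    have "dist x p \<le> dist x 0" using infdist_le[OF zero_in_rays, of x] p(2) by metis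
    hence "norm p \<le> m / 2" using K'n[OF x] norm_triangle_ineq2[of p x] by (simp add: dist_norm norm_minus_commute)
    hence "p \<in> Gamma0 \<beta> r" using m(1) m(2)[of 0] m(2)[of \<beta>] b by (intro Gamma0_iff p) auto
    from infdist_le[OF this] show "infdist x (Gamma0 \<beta> r) \<le> infdist x (rays \<beta>)" using p(2) by simp
    have "Gamma0 \<beta> r \<noteq> {}" using \<open>p \<in> Gamma0 \<beta> r\<close> by blast
    thus "infdist x (rays \<beta>) \<le> infdist x (Gamma0 \<beta> r)" by (rule infdist_mono[OF Gamma0_subset_rays])
  qed
  have scale: "infdist (k *\<^sub>R x) (rays \<beta>) = k * infdist x (rays \<beta>)" if "x \<noteq> 0" for x
  proof -
    have "k *\<^sub>R x = k *\<^sub>R pol (norm x) (ang x)" by (simp add: pol_ang)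
    also have "\<dots> = pol (k * norm x) (ang x)" by (simp add: pol_def)
    finally have "infdist (k *\<^sub>R x) (rays \<beta>) = k * (norm x * infdist (pol 1 (ang x)) (rays \<beta>))"
      using infdist_pol_scale[OF b, of "k * norm x" "ang x"] k that by simp
    also have "norm x * infdist (pol 1 (ang x)) (rays \<beta>) = infdist x (rays \<beta>)"
      using infdist_pol_scale[OF b, of "norm x" "ang x"] that by (simp add: pol_ang)
    finally show ?thesis .
  qed
  have "(\<integral>\<^sup>+ x \<in> wedge \<beta>. ennreal ((u x)\<^sup>2 / (infdist x (rays \<beta>))\<^sup>2) \<partial>lborel)
      = (\<integral>\<^sup>+ x. ennreal (k\<^sup>2) * (ennreal ((u (k *\<^sub>R x))\<^sup>2 / (infdist (k *\<^sub>R x) (rays \<beta>))\<^sup>2) * indicator (wedge \<beta>) (k *\<^sub>R x)) \<partial>lborel)"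
    by (rule nn_integral_scaleR) (use k in measurable)
  also have "\<dots> = (\<integral>\<^sup>+ x \<in> Dom \<beta> r. ennreal ((v x)\<^sup>2 / (infdist x (Gamma0 \<beta> r))\<^sup>2) \<partial>lborel)"
  proof (rule nn_integral_cong)
    fix x :: "real \<times> real"
    show "ennreal (k\<^sup>2) * (ennreal ((u (k *\<^sub>R x))\<^sup>2 / (infdist (k *\<^sub>R x) (rays \<beta>))\<^sup>2) * indicator (wedge \<beta>) (k *\<^sub>R x))
        = ennreal ((v x)\<^sup>2 / (infdist x (Gamma0 \<beta> r))\<^sup>2) * indicator (Dom \<beta> r) x"
    proof (cases "x \<in> K'")
      case True
      have "0 < ang x" using K'w[OF True] b by (simp add: wedge_iff)
      hence "x \<noteq> 0" using ang_zero by auto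
      hence "k\<^sup>2 * ((u (k *\<^sub>R x))\<^sup>2 / (infdist (k *\<^sub>R x) (rays \<beta>))\<^sup>2) = (v x)\<^sup>2 / (infdist x (Gamma0 \<beta> r))\<^sup>2"
        using k by (simp add: scale dist[OF True] v_def power_mult_distrib)
      hence "ennreal (k\<^sup>2) * ennreal ((u (k *\<^sub>R x))\<^sup>2 / (infdist (k *\<^sub>R x) (rays \<beta>))\<^sup>2) = ennreal ((v x)\<^sup>2 / (infdist x (Gamma0 \<beta> r))\<^sup>2)"
        by (subst ennreal_mult[symmetric]) auto
      thus ?thesis using K'D[OF True] K'w[OF True] wk[of x] by (simp add: indicator_def)
    qed (use v0[of x] in \<open>simp add: v_def\<close>)
  qed
  finally have V: "(\<integral>\<^sup>+ x \<in> Dom \<beta> r. ennreal ((v x)\<^sup>2 / (infdist x (Gamma0 \<beta> r))\<^sup>2) \<partial>lborel)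
      = (\<integral>\<^sup>+ x \<in> wedge \<beta>. ennreal ((u x)\<^sup>2 / (infdist x (rays \<beta>))\<^sup>2) \<partial>lborel)" ..
  show ?thesis using that[OF adm G] V unfolding frontier_wedge[OF b] by blast
qed

theorem theorem3:
  fixes \<beta> :: real and r :: "real \<Rightarrow> real" and L :: real
  assumes "pi < \<beta>" and "\<beta> \<le> 2 * pi"
    and "\<forall>\<theta>\<in>{0..\<beta>}. r \<theta> > 0"
    and "lipschitz_on L {0..\<beta>} r"
    and "\<forall>\<theta>\<in>{0..\<beta>/2}. \<forall>D. (r has_real_derivative D) (at \<theta> within {0..\<beta>}) \<longrightarrow> D \<le> 0"
    and "\<forall>\<theta>\<in>{\<beta>/2..\<beta>}. \<forall>D. (r has_real_derivative D) (at \<theta> within {0..\<beta>}) \<longrightarrow> D \<ge> 0"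
  shows "(\<forall>u \<in> admissible \<beta> r.
            (\<integral>\<^sup>+ x \<in> Dom \<beta> r. ennreal (grad_sq u x) \<partial>lborel) \<ge>
            ennreal (hardy_const \<beta>) *
              (\<integral>\<^sup>+ x \<in> Dom \<beta> r. ennreal ((u x)\<^sup>2 / (infdist x (Gamma0 \<beta> r))\<^sup>2) \<partial>lborel))
       \<and> (\<forall>c > hardy_const \<beta>. \<exists>u \<in> admissible \<beta> r.
            (\<integral>\<^sup>+ x \<in> Dom \<beta> r. ennreal (grad_sq u x) \<partial>lborel) <
            ennreal c *
              (\<integral>\<^sup>+ x \<in> Dom \<beta> r. ennreal ((u x)\<^sup>2 / (infdist x (Gamma0 \<beta> r))\<^sup>2) \<partial>lborel))"
proof -
  have b: "0 < \<beta>" "\<beta> \<le> 2 * pi" using assms(1,2) pi_gt_zero by linarith+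
  have rpos: "0 < r \<theta>" if "\<theta> \<in> {0..\<beta>}" for \<theta> using assms(3) that by blast
  have cont: "continuous_on {0..\<beta>} r" by (rule lipschitz_on_continuous_on[OF assms(4)])
  \<comment> \<open>The hypotheses speak of derivatives within the closed interval, whereas the
    monotonicity lemma tests full derivatives at interior points; the latter are special
    cases.\<close>
  have within: "(r has_real_derivative D) (at x within {0..\<beta>})" if "(r has_real_derivative D) (at x)" for x D
    using that by (rule has_field_derivative_at_within)
  have dec: "r y \<le> r x" if "0 \<le> x" "x \<le> y" "y \<le> \<beta> / 2" for x y
  proof (rule lipschitz_deriv_nonpos_imp_antimono[where f = r])
    show "L-lipschitz_on {x..y} r" by (rule lipschitz_on_subset[OF assms(4)]) (use that b in auto)
    show "D \<le> 0" if z: "x < z" "z < y" "(r has_real_derivative D) (at z)" for z D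
    proof -
      have "z \<in> {0..\<beta> / 2}" using z \<open>0 \<le> x\<close> \<open>y \<le> \<beta> / 2\<close> by simp
      thus ?thesis using assms(5) within[OF z(3)] by blast
    qed
  qed (use that in auto)
  have inc: "r x \<le> r y" if "\<beta> / 2 \<le> x" "x \<le> y" "y \<le> \<beta>" for x y
  proof -
    \<comment> \<open>The increasing half is the decreasing case for the negated function.\<close>
    have "- r y \<le> - r x"
    proof (rule lipschitz_deriv_nonpos_imp_antimono[where f = "\<lambda>t. - r t"])
      have "L-lipschitz_on {x..y} r" by (rule lipschitz_on_subset[OF assms(4)]) (use that b in auto)
      thus "L-lipschitz_on {x..y} (\<lambda>t. - r t)" by (simp add: lipschitz_on_def dist_minus)
      show "D \<le> 0" if z: "x < z" "z < y" "((\<lambda>t. - r t) has_real_derivative D) (at z)" for z D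
      proof -
        have "(r has_real_derivative - D) (at z)" using DERIV_minus[OF z(3)] by simp
        hence "(r has_real_derivative - D) (at z within {0..\<beta>})" by (rule within)
        moreover have "z \<in> {\<beta> / 2..\<beta>}" using z \<open>\<beta> / 2 \<le> x\<close> \<open>y \<le> \<beta>\<close> by simp
        ultimately have "0 \<le> - D" using assms(6) by blast
        thus ?thesis by simp
      qed
    qed (use that in auto)
    thus ?thesis by simp
  qed
  show ?thesis
  proof (intro conjI ballI allI impI)
    fix u assume u: "u \<in> admissible \<beta> r"
    show "ennreal (hardy_const \<beta>) * (\<integral>\<^sup>+ x \<in> Dom \<beta> r. ennreal ((u x)\<^sup>2 / (infdist x (Gamma0 \<beta> r))\<^sup>2) \<partial>lborel)
      \<le> (\<integral>\<^sup>+ x \<in> Dom \<beta> r. ennreal (grad_sq u x) \<partial>lborel)"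
      unfolding hardy_const_eq
    proof (rule ennreal_Sup_mult_le)
      show "{c. wedge_hardy \<beta> c} \<noteq> {}" using wedge_hardy_0 by blast
      fix c assume "c \<in> {c. wedge_hardy \<beta> c}"
      hence c: "wedge_hardy \<beta> c" by simp
      show "ennreal c * (\<integral>\<^sup>+ x \<in> Dom \<beta> r. ennreal ((u x)\<^sup>2 / (infdist x (Gamma0 \<beta> r))\<^sup>2) \<partial>lborel)
        \<le> (\<integral>\<^sup>+ x \<in> Dom \<beta> r. ennreal (grad_sq u x) \<partial>lborel)"
        by (rule Dom_hardy[OF b c cont dec inc _ u]) (use rpos b in auto)
    qed
  next
    fix c assume c: "hardy_const \<beta> < c"
    note bdd = bdd_above_wedge_hardy[OF b]
    \<comment> \<open>Nonnegativity matters: then \<open>c\<close> can fail to be admissible only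
      through a test function that violates the inequality.\<close>
    have "0 \<le> hardy_const \<beta>" unfolding hardy_const_eq
      by (rule cSup_upper[OF _ bdd]) (simp add: wedge_hardy_0)
    hence "c \<ge> 0" using c by simp
    moreover have "\<not> wedge_hardy \<beta> c"
      using cSup_upper[OF _ bdd, of c] c unfolding hardy_const_eq by auto
    ultimately obtain u where u: "u \<in> Cc_infty (wedge \<beta>)"
      "(\<integral>\<^sup>+ x \<in> wedge \<beta>. ennreal (grad_sq u x) \<partial>lborel) <
        ennreal c * (\<integral>\<^sup>+ x \<in> wedge \<beta>. ennreal ((u x)\<^sup>2 / (infdist x (frontier (wedge \<beta>)))\<^sup>2) \<partial>lborel)"
      unfolding wedge_hardy_def by (auto simp: not_le)
    obtain v where v: "v \<in> admissible \<beta> r"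
      "(\<integral>\<^sup>+ x \<in> Dom \<beta> r. ennreal (grad_sq v x) \<partial>lborel) = (\<integral>\<^sup>+ x \<in> wedge \<beta>. ennreal (grad_sq u x) \<partial>lborel)"
      "(\<integral>\<^sup>+ x \<in> Dom \<beta> r. ennreal ((v x)\<^sup>2 / (infdist x (Gamma0 \<beta> r))\<^sup>2) \<partial>lborel)
        = (\<integral>\<^sup>+ x \<in> wedge \<beta>. ennreal ((u x)\<^sup>2 / (infdist x (frontier (wedge \<beta>)))\<^sup>2) \<partial>lborel)"
      using scaled_test_function[OF b cont rpos u(1)] by blast
    show "\<exists>u \<in> admissible \<beta> r. (\<integral>\<^sup>+ x \<in> Dom \<beta> r. ennreal (grad_sq u x) \<partial>lborel) <
        ennreal c * (\<integral>\<^sup>+ x \<in> Dom \<beta> r. ennreal ((u x)\<^sup>2 / (infdist x (Gamma0 \<beta> r))\<^sup>2) \<partial>lborel)"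
      by (rule bexI[OF _ v(1)]) (unfold v(2,3), rule u(2))
  qed
qed

end
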